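(* Let $X$ be a del Pezzo surface of degree $4$ over $\mathbb C$, let $Q_1,Q_2$ be the associated basis of $H^0(X,\mathrm{Sym}^2T_X)$, and let $\Phi=(Q_1,Q_2):T_X^*\to\mathbb C^2$ be the induced morphism. Then $\Phi$ is a Lagrangian fibration; that is, for every $e\in\mathbb C^2$ the restriction $\omega|_{S_e}$ of the natural symplectic two-form $\omega$ on $T_X^*$ to the level surface $S_e=\Phi^{-1}(e)$ is zero.
   Context: We work over $\mathbb C$. A del Pezzo surface $X$ of degree $4$ is a smooth complete intersection of two quadrics in $\mathbb P^4$; after a linear change of coordinates $X=\{Q_1=Q_2=0\}\subset\mathbb P^4_{y_1,\dots,y_5}$ with $Q_1=\sum_{i=1}^5y_i^2$, $Q_2=\sum_{i=1}^5a_iy_i^2$, the $a_i\in\mathbb C$ distinct. It is known that there is an isomorphism of graded rings $\bigoplus_{m\ge0}H^0(X,\mathrm{Sym}^mT_X)\simeq\mathbb C[Q_1,Q_2]$ with $Q_1,Q_2$ in degree $2$; in particular $Q_1,Q_2$ form a basis of $H^0(X,\mathrm{Sym}^2T_X)$. The quadratic form $Q_k$ is viewed as a section of $\mathrm{Sym}^2T_X$ as follows: for $x\in X$, $Q_k$ restricted to the affine cone over the embedded projective tangent plane $\mathbf T_xX\subset\mathbb P^4$ descends to a quadratic form on $T_xX\otimes\mathcal O_X(-1)_x$, giving a section of $\mathrm{Sym}^2(\Omega^1_X(1))$, and $\Omega^1_X(1)\cong\Omega^1_X\otimes\mathcal O_X(-K_X)\cong T_X$. A section of $\mathrm{Sym}^2T_X$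 is a regular function on the total space of the cotangent bundle $T_X^*$ (quadratic on each fiber), so $(Q_1,Q_2)$ defines a morphism $\Phi:T_X^*\to\mathbb C^2$. The form $\omega$ is the canonical holomorphic symplectic form on $T_X^*$. Vanishing of $\omega|_{S_e}$ is understood on the smooth locus of $S_e$, i.e. $\omega|_{T_qS_e}=0$ for all smooth points $q$ of $S_e$. *)

theory Defs
  imports "HOL-Analysis.Analysis"
begin

section \<open>The surface\<close>

text \<open>Quadratic forms on \<open>\<complex>\<^sup>5\<close> are given by symmetric matrices; \<open>bil M\<close> is the polar form, normalised
  so that \<open>quad M y = bil M y y\<close>, hence the differential of \<open>quad M\<close> at \<open>y\<close> is \<open>2 * bil M y\<close>.\<close>

definition bil :: "complex^5^5 \<Rightarrow> complex^5 \<Rightarrow> complex^5 \<Rightarrow> complex"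
  where "bil M u v = (\<Sum>i\<in>UNIV. u $ i * (M *v v) $ i)"

definition quad :: "complex^5^5 \<Rightarrow> complex^5 \<Rightarrow> complex"
  where "quad M y = bil M y y"

text \<open>Degree 4 del Pezzo surfaces: smooth complete intersections of two quadrics in \<open>\<P>\<^sup>4\<close>
  (Jacobian criterion at every point of the common zero locus).\<close>

definition del_pezzo_4 :: "complex^5^5 \<Rightarrow> complex^5^5 \<Rightarrow> bool"
  where "del_pezzo_4 M1 M2 \<longleftrightarrow>
    transpose M1 = M1 \<and> transpose M2 = M2 \<and>
    (\<forall>y. y \<noteq> 0 \<and> quad M1 y = 0 \<and> quad M2 y = 0 \<longrightarrow>
      (\<forall>a b. a *s (M1 *v y) + b *s (M2 *v y) = 0 \<longrightarrow> a = 0 \<and> b = 0))"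

text \<open>The simultaneously diagonal normal form is an instance.\<close>

lemma del_pezzo_4_diagonal:
  fixes a :: "5 \<Rightarrow> complex"
  assumes "inj a"
  shows "del_pezzo_4 (mat 1) (\<chi> i j. if i = j then a i else 0)"
proof -
  let ?D = "(\<chi> i j. if i = j then a i else 0) :: complex^5^5"
  have D: "(?D *v y) $ i = a i * y $ i" for y i
    by (simp add: matrix_vector_mult_def if_distrib [of "\<lambda>x. x * _"] cong: if_cong)
  have "c = 0 \<and> d = 0"
    if y: "y \<noteq> 0" "quad (mat 1) y = 0" and e: "c *s (mat 1 *v y) + d *s (?D *v y) = 0" for y c d
  proof (rule ccontr)
    assume cd: "\<not> (c = 0 \<and> d = 0)"
    have z: "c + d * a i = 0" if "y $ i \<noteq> 0" for i
    proof -
      have "(c *s (mat 1 *v y) + d *s (?D *v y)) $ i = 0" using e by simp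
      then have "(c + d * a i) * y $ i = 0"
        by (simp only: vector_add_component vector_smult_component D matrix_vector_mul_lid)
          (simp add: algebra_simps)
      with that show ?thesis by simp
    qed
    obtain k where k: "y $ k \<noteq> 0" using y(1) by (auto simp: vec_eq_iff)
    have o: "y $ i = 0" if "i \<noteq> k" for i
    proof (rule ccontr)
      assume "y $ i \<noteq> 0"
      from z [OF this] z [OF k] have "c + d * a i = c + d * a k" by simp
      then have "d * (a i - a k) = 0" by (simp add: right_diff_distrib)
      moreover have "a i \<noteq> a k" using that assms by (auto dest: injD)
      ultimately have "d = 0" by simp
      with z [OF k] cd show False by simp
    qed
    have "quad (mat 1) y = (\<Sum>i\<in>UNIV. if i = k then (y $ k)\<^sup>2 else 0)"
      unfolding quad_def bil_def matrix_vector_mul_lid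
      by (rule sum.cong) (auto simp: o power2_eq_square)
    with y(2) k show False by simp
  qed
  moreover have "transpose ?D = ?D" by (auto simp: transpose_def vec_eq_iff)
  ultimately show ?thesis by (auto simp: del_pezzo_4_def transpose_mat)
qed

text \<open>A point of \<open>\<P>\<^sup>4\<close> is a line \<open>x\<close> through the origin of \<open>\<complex>\<^sup>5\<close>.\<close>

definition surface :: "complex^5^5 \<Rightarrow> complex^5^5 \<Rightarrow> (complex^5) set set"
  where "surface M1 M2 = {vec.span {y} | y. y \<noteq> 0 \<and> quad M1 y = 0 \<and> quad M2 y = 0}"

text \<open>The affine cone over the embedded projective tangent plane at \<open>x\<close>.\<close>

definition tangent_cone :: "complex^5^5 \<Rightarrow> complex^5^5 \<Rightarrow> (complex^5) set \<Rightarrow> (complex^5) set"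
  where "tangent_cone M1 M2 x = {v. \<forall>y\<in>x. bil M1 y v = 0 \<and> bil M2 y v = 0}"


section \<open>The cotangent bundle\<close>

text \<open>Write \<open>W = tangent_cone M1 M2 x / x\<close>, which is \<open>T\<^sub>xX \<otimes> \<O>(-1)\<^sub>x\<close>. Then \<open>T\<^sub>xX = Hom(x, W)\<close>: a pair
  \<open>(y, v)\<close> with \<open>0 \<noteq> y \<in> x\<close> and \<open>v\<close> in the tangent cone represents the tangent vector sending \<open>y\<close> to
  \<open>v\<close> modulo \<open>x\<close>; it is the velocity at \<open>t = 0\<close> of \<open>t \<mapsto> [y + t v]\<close>. Two pairs represent the same
  tangent vector iff they are related by \<open>(y, v) \<mapsto> (t y, t v + c y)\<close>. A covector at \<open>x\<close> is encoded
  as a function \<open>\<xi>\<close> of such pairs that is linear in \<open>v\<close> and respects these identifications,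
  extended by 0 to all other arguments.\<close>

definition cotangent_space ::
  "complex^5^5 \<Rightarrow> complex^5^5 \<Rightarrow> (complex^5) set \<Rightarrow> (complex^5 \<Rightarrow> complex^5 \<Rightarrow> complex) set"
  where "cotangent_space M1 M2 x = {\<xi>.
    (\<forall>y v. y \<notin> x - {0} \<or> v \<notin> tangent_cone M1 M2 x \<longrightarrow> \<xi> y v = 0) \<and>
    (\<forall>y\<in>x - {0}.
      \<xi> y y = 0 \<and>
      (\<forall>u\<in>tangent_cone M1 M2 x. \<forall>v\<in>tangent_cone M1 M2 x. \<forall>a b.
        \<xi> y (a *s u + b *s v) = a * \<xi> y u + b * \<xi> y v) \<and>
      (\<forall>v\<in>tangent_cone M1 M2 x. \<forall>t. t \<noteq> 0 \<longrightarrow> \<xi> (t *s y) (t *s v) = \<xi> y v))}"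

type_synonym covector = "(complex^5) set \<times> (complex^5 \<Rightarrow> complex^5 \<Rightarrow> complex)"

definition cotangent_bundle :: "complex^5^5 \<Rightarrow> complex^5^5 \<Rightarrow> covector set"
  where "cotangent_bundle M1 M2 = Sigma (surface M1 M2) (cotangent_space M1 M2)"


section \<open>The morphism \<open>\<Phi>\<close>\<close>

text \<open>The isomorphism \<open>\<O>(-K\<^sub>X) \<cong> \<O>(1)\<close> is the one given by the Poincare residue of
  \<open>det(y, dy, dy, dy, dy) / (Q\<^sub>1 Q\<^sub>2)\<close>. It is unique up to a nonzero constant, which only rescales
  \<open>\<Phi>\<close>. Explicitly, for \<open>0 \<noteq> y \<in> x\<close> and \<open>u, v\<close> in the tangent cone at \<open>x\<close>, the residue is the number
  \<open>c\<close> with \<open>det(y, u, v, n\<^sub>1, n\<^sub>2) = c * det (dQ\<^sub>i(n\<^sub>j))\<close> for all \<open>n\<^sub>1, n\<^sub>2\<close> in \<open>\<complex>\<^sup>5\<close>. As a function of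
  \<open>(u, v)\<close> it is an area form on \<open>W\<close>, homogeneous of degree -1 in \<open>y\<close>.\<close>

definition residue_form ::
  "complex^5^5 \<Rightarrow> complex^5^5 \<Rightarrow> complex^5 \<Rightarrow> complex^5 \<Rightarrow> complex^5 \<Rightarrow> complex"
  where "residue_form M1 M2 y u v = (THE c. \<forall>n1 n2.
    det (vector [y, u, v, n1, n2] :: complex^5^5) =
      c * ((2 * bil M1 y n1) * (2 * bil M2 y n2) - (2 * bil M1 y n2) * (2 * bil M2 y n1)))"

text \<open>The quadratic form \<open>quad M\<close>, for \<open>M\<close> in the span of \<open>M1\<close> and \<open>M2\<close>, descends from the tangent
  cone to \<open>W\<close>, that is, to an element of \<open>Sym\<^sup>2(\<Omega>\<^sup>1(1))\<^sub>x = Sym\<^sup>2 W\<^sup>*\<close>. The isomorphism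
  \<open>\<Omega>\<^sup>1(1) \<cong> \<Omega>\<^sup>1 \<otimes> \<O>(-K\<^sub>X) \<cong> T\<^sub>X\<close> is dual to the isomorphism of \<open>T\<^sup>*\<^sub>xX\<close> with \<open>W\<close> taking \<open>\<xi>\<close> to the class of
  the \<open>w\<close> with \<open>\<xi>(y, u) = residue_form y w u\<close> for all \<open>u\<close>. This class does not depend on the choice
  of \<open>y\<close> in \<open>x\<close>, and the section of \<open>Sym\<^sup>2 T\<^sub>X\<close> defined by \<open>quad M\<close> is the function \<open>\<xi> \<mapsto> quad M w\<close>
  on the cotangent bundle.\<close>

definition sym2_section ::
  "complex^5^5 \<Rightarrow> complex^5^5 \<Rightarrow> complex^5^5 \<Rightarrow> covector \<Rightarrow> complex"
  where "sym2_section M1 M2 M = (\<lambda>(x, \<xi>). THE c.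
    \<exists>y\<in>x - {0}. \<exists>w\<in>tangent_cone M1 M2 x.
      (\<forall>u\<in>tangent_cone M1 M2 x. \<xi> y u = residue_form M1 M2 y w u) \<and> c = quad M w)"

definition Phi :: "complex^5^5 \<Rightarrow> complex^5^5 \<Rightarrow> covector \<Rightarrow> complex \<times> complex"
  where "Phi M1 M2 q = (sym2_section M1 M2 M1 q, sym2_section M1 M2 M2 q)"

definition level_surface :: "complex^5^5 \<Rightarrow> complex^5^5 \<Rightarrow> complex \<times> complex \<Rightarrow> covector set"
  where "level_surface M1 M2 e = {q \<in> cotangent_bundle M1 M2. Phi M1 M2 q = e}"


section \<open>Smooth points of subsets of \<open>\<complex>\<^sup>n\<close>\<close>

definition holomorphic_map :: "(complex^'n \<Rightarrow> complex^'m) \<Rightarrow> (complex^'n) set \<Rightarrow> bool"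
  where "holomorphic_map f U \<longleftrightarrow> open U \<and>
    (\<forall>z\<in>U. \<exists>D. (f has_derivative D) (at z) \<and> (\<forall>c v. D (c *s v) = c *s D v))"

text \<open>\<open>A\<close> is a complex submanifold near \<open>q\<close>: a biholomorphic map \<open>F\<close> defined near \<open>q\<close>, with inverse
  \<open>G\<close>, straightens \<open>A\<close> to a complex linear subspace \<open>L\<close>.\<close>

definition smooth_point :: "(complex^'n) set \<Rightarrow> complex^'n \<Rightarrow> bool"
  where "smooth_point A q \<longleftrightarrow> q \<in> A \<and>
    (\<exists>W (F :: complex^'n \<Rightarrow> complex^'n) G L. q \<in> W \<and> holomorphic_map F W \<and> holomorphic_map G (F ` W) \<and>
      (\<forall>z\<in>W. G (F z) = z) \<and> vec.subspace L \<and> F ` (W \<inter> A) = F ` W \<inter> L)"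

text \<open>Velocities of holomorphic curves in \<open>A\<close>; at a smooth point this is the tangent space.\<close>

definition tangent_space :: "(complex^'n) set \<Rightarrow> complex^'n \<Rightarrow> (complex^'n) set"
  where "tangent_space A q = {v. \<exists>\<gamma> r. 0 < r \<and> \<gamma> ` ball 0 r \<subseteq> A \<and> \<gamma> 0 = q \<and>
    (\<forall>i. (\<lambda>t. \<gamma> t $ i) holomorphic_on ball 0 r \<and> deriv (\<lambda>t. \<gamma> t $ i) 0 = v $ i)}"


section \<open>The symplectic form\<close>

definition partial_deriv :: "'n \<Rightarrow> (complex^'n \<Rightarrow> complex^'m) \<Rightarrow> complex^'n \<Rightarrow> complex^'m"
  where "partial_deriv j f s = frechet_derivative f (at s) (axis j 1)"

text \<open>A local holomorphic parametrisation \<open>s \<mapsto> [\<sigma> s]\<close> of the surface, given by a lift to the cone.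
  Independence of \<open>\<sigma>, \<partial>\<^sub>1\<sigma>, \<partial>\<^sub>2\<sigma>\<close> means that \<open>[\<sigma>]\<close> is an immersion. So \<open>[\<sigma>]\<close> is the inverse of a
  holomorphic coordinate chart of the surface, and all charts arise in this way locally.\<close>

definition local_parametrisation ::
  "complex^5^5 \<Rightarrow> complex^5^5 \<Rightarrow> (complex^2) set \<Rightarrow> (complex^2 \<Rightarrow> complex^5) \<Rightarrow> bool"
  where "local_parametrisation M1 M2 U \<sigma> \<longleftrightarrow>
    holomorphic_map \<sigma> U \<and>
    (\<forall>s\<in>U. \<sigma> s \<noteq> 0 \<and> vec.span {\<sigma> s} \<in> surface M1 M2 \<and>
      (\<forall>a b c. a *s \<sigma> s + b *s partial_deriv 1 \<sigma> s + c *s partial_deriv 2 \<sigma> s = 0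
        \<longrightarrow> a = 0 \<and> b = 0 \<and> c = 0)) \<and>
    inj_on (\<lambda>s. vec.span {\<sigma> s}) U"

text \<open>The induced parametrisation of the cotangent bundle: \<open>(s\<^sub>1, s\<^sub>2, \<pi>\<^sub>1, \<pi>\<^sub>2)\<close> is sent to the covector
  \<open>\<pi>\<^sub>1 ds\<^sub>1 + \<pi>\<^sub>2 ds\<^sub>2\<close> at the point \<open>[\<sigma> s]\<close>, i.e. the one taking the value \<open>\<pi>\<^sub>j\<close> on the tangent vector
  \<open>\<partial>\<^sub>j[\<sigma>]\<close>, which is represented by the pair \<open>(\<sigma> s, \<partial>\<^sub>j\<sigma> s)\<close>.\<close>

definition base_point :: "complex^4 \<Rightarrow> complex^2"
  where "base_point z = vector [z $ 1, z $ 2]"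

definition cotangent_chart ::
  "complex^5^5 \<Rightarrow> complex^5^5 \<Rightarrow> (complex^2 \<Rightarrow> complex^5) \<Rightarrow> complex^4 \<Rightarrow> covector"
  where "cotangent_chart M1 M2 \<sigma> z =
    (let s = base_point z; x = vec.span {\<sigma> s} in
      (x, THE \<xi>. \<xi> \<in> cotangent_space M1 M2 x \<and>
        \<xi> (\<sigma> s) (partial_deriv 1 \<sigma> s) = z $ 3 \<and>
        \<xi> (\<sigma> s) (partial_deriv 2 \<sigma> s) = z $ 4))"

text \<open>In these coordinates the tautological 1-form is \<open>\<pi>\<^sub>1 ds\<^sub>1 + \<pi>\<^sub>2 ds\<^sub>2\<close>, and the canonical
  symplectic form is its exterior derivative \<open>d\<pi>\<^sub>1 \<and> ds\<^sub>1 + d\<pi>\<^sub>2 \<and> ds\<^sub>2\<close>.\<close>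

definition symplectic_form :: "complex^4 \<Rightarrow> complex^4 \<Rightarrow> complex"
  where "symplectic_form u v = (u $ 3 * v $ 1 - u $ 1 * v $ 3) + (u $ 4 * v $ 2 - u $ 2 * v $ 4)"

text \<open>Vanishing of the restriction of the symplectic form to the smooth locus of a subset \<open>S\<close> of the
  cotangent bundle, expressed in all charts.\<close>

definition symplectic_form_vanishes_on ::
  "complex^5^5 \<Rightarrow> complex^5^5 \<Rightarrow> covector set \<Rightarrow> bool"
  where "symplectic_form_vanishes_on M1 M2 S \<longleftrightarrow>
    (\<forall>U \<sigma>. local_parametrisation M1 M2 U \<sigma> \<longrightarrow>
      (let A = {z. base_point z \<in> U \<and> cotangent_chart M1 M2 \<sigma> z \<in> S} in
        \<forall>q. smooth_point A q \<longrightarrow>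
          (\<forall>u\<in>tangent_space A q. \<forall>v\<in>tangent_space A q. symplectic_form u v = 0)))"

end

theory Submission
  imports Defs "HOL-Complex_Analysis.Cauchy_Integral_Formula"
begin

text \<open>A covector at \<open>[y]\<close> is the same as a vector \<open>w\<close> of the tangent cone modulo \<open>y\<close>, and then
  \<open>\<Phi> = (Q\<^sub>1(w), Q\<^sub>2(w))\<close>. The velocity \<open>(a, a')\<close> of a curve \<open>(y, w)\<close> in a fibre satisfies the six linear
  equations obtained by differentiating \<open>Q\<^sub>k(y) = 0\<close>, \<open>B\<^sub>k(y, w) = 0\<close>, \<open>Q\<^sub>k(w) = e\<^sub>k\<close>, and the residue formula
  expresses the symplectic form of two such velocities by \<open>5 \<times> 5\<close> determinants. If \<open>w \<noteq> 0\<close> modulo \<open>y\<close> and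
  no quadric of the pencil is singular at a point \<open>w + t y\<close>, linear algebra shows that this expression
  vanishes: for \<open>e = 0\<close> the line through \<open>y\<close> and \<open>w\<close> lies on the surface and is rigid, so \<open>a, a'\<close> lie in
  its span; for \<open>e \<noteq> 0\<close> one takes the pencil member \<open>Q\<close> with \<open>Q(w) = 0\<close>, whose Hamiltonian vector moves
  \<open>y\<close> in the direction \<open>w\<close>, and checks that it is orthogonal to all velocities. At a smooth point of
  the fibre that is a limit of such points the form vanishes by continuity of the tangent spaces.
  Otherwise all nearby points are exceptional: either they lie in the zero section, or \<open>w\<close> is a multiple
  of the fixed vertex of a singular quadric modulo \<open>y\<close>, while \<open>y\<close> runs through a curve.\<close>

section \<open>Determinants and bilinear forms on \<open>\<complex>\<^sup>5\<close>\<close>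

text \<open>\<open>smooth_point\<close> concerns the level set as a set, not its equations: the two
  components of \<open>Phi\<close> may have dependent differentials there, so that Poisson
  commutation of the two functions would not settle the claim at such a point. Likewise the six
  linear equations are only necessary conditions on a velocity; on the zero section, for instance,
  they are far too weak. This is why neighbouring points and honest curves come in. The determinants
  stem from the tautological form: for constant vectors \<open>m\<close>, \<open>n\<close> its value
  on \<open>dy\<close> is \<open>det(y, w, dy, m, n) / (4 J)\<close>, where \<open>4 J\<close> is
  the Jacobian determinant of the two quadrics on \<open>m\<close>, \<open>n\<close>. The exterior
  derivative of this quotient is what the linear algebra has to kill. The freedom in
  \<open>m\<close>, \<open>n\<close> is an asset: in the general case they are chosen so that the
  determinants involving the Hamiltonian vector vanish. Since the matrices are not assumed diagonal,
  vertices of singular quadrics appear as kernels.\<close>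

lemma exhaust_5:
  fixes x :: 5
  shows "x = 1 \<or> x = 2 \<or> x = 3 \<or> x = 4 \<or> x = 5"
proof (induct x)
  case (of_int z)
  then have "0 \<le> z" and "z < 5" by simp_all
  then have "z = 0 \<or> z = 1 \<or> z = 2 \<or> z = 3 \<or> z = 4" by arith
  then show ?case by auto
qed

lemma forall_5: "(\<forall>i::5. P i) \<longleftrightarrow> P 1 \<and> P 2 \<and> P 3 \<and> P 4 \<and> P 5"
  by (metis exhaust_5)

lemma UNIV_5: "UNIV = {1, 2, 3, 4, 5::5}"
  using exhaust_5 by auto

lemma sum_5: "sum f (UNIV::5 set) = f 1 + f 2 + f 3 + f 4 + f 5"
  unfolding UNIV_5 by (simp add: ac_simps)

lemma vector_5 [simp]:
  "(vector [a, b, c, d, e] :: 'a::zero^5) $ 1 = a"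
  "(vector [a, b, c, d, e] :: 'a::zero^5) $ 2 = b"
  "(vector [a, b, c, d, e] :: 'a::zero^5) $ 3 = c"
  "(vector [a, b, c, d, e] :: 'a::zero^5) $ 4 = d"
  "(vector [a, b, c, d, e] :: 'a::zero^5) $ 5 = e"
  unfolding vector_def by simp_all

abbreviation det5 :: "complex^5 \<Rightarrow> complex^5 \<Rightarrow> complex^5 \<Rightarrow> complex^5 \<Rightarrow> complex^5 \<Rightarrow> complex"
  where "det5 a b c d e \<equiv> det (vector [a, b, c, d, e] :: complex^5^5)"

lemma det5_add:
  "det5 (x + x') b c d e = det5 x b c d e + det5 x' b c d e"
  "det5 a (x + x') c d e = det5 a x c d e + det5 a x' c d e"
  "det5 a b (x + x') d e = det5 a b x d e + det5 a b x' d e"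
  "det5 a b c (x + x') e = det5 a b c x e + det5 a b c x' e"
  "det5 a b c d (x + x') = det5 a b c d x + det5 a b c d x'"
proof -
  have *: "det A = det B + det C"
    if "A $ k = B $ k + C $ k" "\<forall>i. i = k \<or> A $ i = B $ i \<and> A $ i = C $ i"
    for A B C :: "complex^5^5" and k
  proof -
    have e: "A = (\<chi> i. if i = k then B $ k + C $ k else A $ i)"
      "(\<chi> i. if i = k then B $ k else A $ i) = B" "(\<chi> i. if i = k then C $ k else A $ i) = C"
      using that by (auto simp: vec_eq_iff)
    have "det A = det (\<chi> i. if i = k then B $ k + C $ k else A $ i)"
      by (rule arg_cong [OF e(1)])
    also have "\<dots> = det B + det C" unfolding det_row_add e(2,3) ..
    finally show ?thesis .
  qed
  show "det5 (x + x') b c d e = det5 x b c d e + det5 x' b c d e"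
    by (rule * [of _ 1]) (simp_all add: forall_5)
  show "det5 a (x + x') c d e = det5 a x c d e + det5 a x' c d e"
    by (rule * [of _ 2]) (simp_all add: forall_5)
  show "det5 a b (x + x') d e = det5 a b x d e + det5 a b x' d e"
    by (rule * [of _ 3]) (simp_all add: forall_5)
  show "det5 a b c (x + x') e = det5 a b c x e + det5 a b c x' e"
    by (rule * [of _ 4]) (simp_all add: forall_5)
  show "det5 a b c d (x + x') = det5 a b c d x + det5 a b c d x'"
    by (rule * [of _ 5]) (simp_all add: forall_5)
qed

lemma det5_scale:
  "det5 (s *s x) b c d e = s * det5 x b c d e"
  "det5 a (s *s x) c d e = s * det5 a x c d e"
  "det5 a b (s *s x) d e = s * det5 a b x d e"
  "det5 a b c (s *s x) e = s * det5 a b c x e"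
  "det5 a b c d (s *s x) = s * det5 a b c d x"
proof -
  have *: "det A = s * det B"
    if "A $ k = s *s B $ k" "\<forall>i. i = k \<or> A $ i = B $ i"
    for A B :: "complex^5^5" and k
  proof -
    have e: "A = (\<chi> i. if i = k then s *s B $ k else A $ i)"
      "(\<chi> i. if i = k then B $ k else A $ i) = B"
      using that by (auto simp: vec_eq_iff)
    have "det A = det (\<chi> i. if i = k then s *s B $ k else A $ i)"
      by (rule arg_cong [OF e(1)])
    also have "\<dots> = s * det B" unfolding det_row_mul e(2) ..
    finally show ?thesis .
  qed
  show "det5 (s *s x) b c d e = s * det5 x b c d e"
    by (rule * [of _ 1]) (simp_all add: forall_5)
  show "det5 a (s *s x) c d e = s * det5 a x c d e"
    by (rule * [of _ 2]) (simp_all add: forall_5)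
  show "det5 a b (s *s x) d e = s * det5 a b x d e"
    by (rule * [of _ 3]) (simp_all add: forall_5)
  show "det5 a b c (s *s x) e = s * det5 a b c x e"
    by (rule * [of _ 4]) (simp_all add: forall_5)
  show "det5 a b c d (s *s x) = s * det5 a b c d x"
    by (rule * [of _ 5]) (simp_all add: forall_5)
qed

lemma det5_same [simp]:
  "det5 x x c d e = 0" "det5 x b x d e = 0" "det5 x b c x e = 0" "det5 x b c d x = 0"
  "det5 a x x d e = 0" "det5 a x c x e = 0" "det5 a x c d x = 0"
  "det5 a b x x e = 0" "det5 a b x d x = 0" "det5 a b c x x = 0"
proof -
  have *: "det A = 0" if "i \<noteq> j" "A $ i = A $ j" for A :: "complex^5^5" and i j
    using det_identical_rows [of i j A] that by (simp add: row_def)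
  show "det5 x x c d e = 0" by (rule * [of 1 2]) simp_all
  show "det5 x b x d e = 0" by (rule * [of 1 3]) simp_all
  show "det5 x b c x e = 0" by (rule * [of 1 4]) simp_all
  show "det5 x b c d x = 0" by (rule * [of 1 5]) simp_all
  show "det5 a x x d e = 0" by (rule * [of 2 3]) simp_all
  show "det5 a x c x e = 0" by (rule * [of 2 4]) simp_all
  show "det5 a x c d x = 0" by (rule * [of 2 5]) simp_all
  show "det5 a b x x e = 0" by (rule * [of 3 4]) simp_all
  show "det5 a b x d x = 0" by (rule * [of 3 5]) simp_all
  show "det5 a b c x x = 0" by (rule * [of 4 5]) simp_all
qed

lemma det5_swap:
  "det5 a b c d e = - det5 b a c d e"
  "det5 a b c d e = - det5 c b a d e"
  "det5 a b c d e = - det5 a c b d e"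
  "det5 a b c d e = - det5 a b c e d"
  using det5_same(1) [of "a + b" c d e] det5_same(2) [of "a + c" b d e]
    det5_same(5) [of a "b + c" d e] det5_same(10) [of a b c "d + e"]
  by (simp_all add: det5_add del: det5_same, simp_all add: eq_neg_iff_add_eq_0 add.commute)

lemmas det5_lin = det5_add det5_scale

text \<open>The matrix with these rows kills \<open>x\<close>, hence is singular. Several
  determinants below vanish because one covector annihilates all five rows.\<close>

lemma det5_eq_0:
  assumes "x \<noteq> 0" "(\<Sum>i\<in>UNIV. a $ i * x $ i) = 0" "(\<Sum>i\<in>UNIV. b $ i * x $ i) = 0"
    "(\<Sum>i\<in>UNIV. c $ i * x $ i) = 0" "(\<Sum>i\<in>UNIV. d $ i * x $ i) = 0" "(\<Sum>i\<in>UNIV. e $ i * x $ i) = 0"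
  shows "det5 a b c d e = 0"
proof (rule ccontr)
  assume "det5 a b c d e \<noteq> 0"
  then have "invertible (vector [a, b, c, d, e] :: complex^5^5)"
    by (simp add: invertible_det_nz)
  moreover have "(vector [a, b, c, d, e] :: complex^5^5) *v x = 0"
    unfolding vec_eq_iff forall_5 using assms(2-) by (simp add: matrix_vector_mult_def)
  ultimately show False
    using assms(1) matrix_left_invertible_ker invertible_left_inverse by blast
qed

lemma det5_dependent:
  assumes "det5 a b c d e = 0"
  obtains \<alpha> \<beta> \<gamma> \<delta> \<epsilon> where "\<not> (\<alpha> = 0 \<and> \<beta> = 0 \<and> \<gamma> = 0 \<and> \<delta> = 0 \<and> \<epsilon> = 0)"
    "\<alpha> *s a + \<beta> *s b + \<gamma> *s c + \<delta> *s d + \<epsilon> *s e = 0"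
proof -
  have "\<not> invertible (vector [a, b, c, d, e] :: complex^5^5)"
    using assms by (simp add: invertible_det_nz)
  then obtain f i where f: "(\<Sum>i\<in>UNIV. f i *s row i (vector [a, b, c, d, e] :: complex^5^5)) = 0"
    and i: "f i \<noteq> 0"
    unfolding invertible_right_inverse matrix_right_invertible_independent_rows by blast
  have r: "row i A = A $ i" for i and A :: "complex^5^5" by (simp add: row_def)
  show ?thesis
  proof (rule that)
    show "f 1 *s a + f 2 *s b + f 3 *s c + f 4 *s d + f 5 *s e = 0"
      using f by (simp add: sum_5 r)
    show "\<not> (f 1 = 0 \<and> f 2 = 0 \<and> f 3 = 0 \<and> f 4 = 0 \<and> f 5 = 0)"
      using i exhaust_5 [of i] by auto
  qed
qed

section \<open>Bilinear forms\<close>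

lemma bil_sum: "bil M u v = (\<Sum>i\<in>UNIV. \<Sum>j\<in>UNIV. u $ i * M $ i $ j * v $ j)"
  by (simp add: bil_def matrix_vector_mult_def sum_distrib_left mult.assoc)

lemma bil_add:
  "bil M (u + v) x = bil M u x + bil M v x" "bil M x (u + v) = bil M x u + bil M x v"
  by (simp_all add: bil_sum distrib_left distrib_right sum.distrib)

lemma bil_scale: "bil M (s *s u) x = s * bil M u x" "bil M x (s *s u) = s * bil M x u"
  by (simp_all add: bil_sum sum_distrib_left mult_ac)

lemma bil_minus: "bil M (- u) x = - bil M u x" "bil M x (- u) = - bil M x u"
  using bil_scale(1) [of M "-1" u x] bil_scale(2) [of M x "-1" u] by simp_all

lemma bil_0 [simp]: "bil M 0 x = 0" "bil M x 0 = 0"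
  using bil_scale(1) [of M 0 0 x] bil_scale(2) [of M x 0 0] by simp_all

lemmas bil_lin = bil_add bil_scale

lemma bil_commute:
  assumes "transpose M = M"
  shows "bil M u v = bil M v u"
proof -
  have "M $ i $ j = transpose M $ j $ i" for i j by (simp add: transpose_def)
  then have *: "M $ i $ j = M $ j $ i" for i j unfolding assms .
  have "u $ i * M $ i $ j * v $ j = v $ j * M $ j $ i * u $ i" for i j
    unfolding * [of i j] by (simp only: mult_ac)
  then have "bil M u v = (\<Sum>i\<in>UNIV. \<Sum>j\<in>UNIV. v $ j * M $ j $ i * u $ i)"
    unfolding bil_sum by (intro sum.cong refl)
  also have "\<dots> = bil M v u" unfolding bil_sum by (rule sum.swap)
  finally show ?thesis .
qed

lemma independent_minor:
  fixes p q :: "complex^5"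
  assumes "\<And>\<alpha> \<beta>. \<alpha> *s p + \<beta> *s q = 0 \<Longrightarrow> \<alpha> = 0 \<and> \<beta> = 0"
  obtains i j where "p $ i * q $ j - p $ j * q $ i \<noteq> 0"
proof -
  have "p \<noteq> 0" using assms [of 1 0] by auto
  then obtain i where i: "p $ i \<noteq> 0" by (auto simp: vec_eq_iff)
  have "\<exists>j. p $ i * q $ j - p $ j * q $ i \<noteq> 0"
  proof (rule ccontr)
    assume "\<not> ?thesis"
    then have "(- q $ i) *s p + p $ i *s q = 0" by (auto simp: vec_eq_iff algebra_simps)
    then show False using assms i by blast
  qed
  then show ?thesis using that by blast
qed

lemma bil_diff: "bil M (u - v) x = bil M u x - bil M v x" "bil M x (u - v) = bil M x u - bil M x v"
  by (simp_all add: bil_sum left_diff_distrib right_diff_distrib sum_subtractf)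

section \<open>The tangent cone at a point of the surface\<close>

text \<open>The differential of \<open>quad M\<close> at \<open>y\<close> is
  \<open>2 * bil M y\<close>, so this is a quarter of the Jacobian determinant in
  \<open>residue_form\<close>; hence the factors 4 that accompany \<open>jac\<close>.\<close>

definition jac :: "complex^5^5 \<Rightarrow> complex^5^5 \<Rightarrow> complex^5 \<Rightarrow> complex^5 \<Rightarrow> complex^5 \<Rightarrow> complex"
  where "jac M1 M2 y m n = bil M1 y m * bil M2 y n - bil M1 y n * bil M2 y m"

text \<open>The differential of \<open>jac\<close> in \<open>y\<close> along \<open>a\<close>, with
  \<open>m\<close> and \<open>n\<close> held constant.\<close>

definition jac_deriv ::
  "complex^5^5 \<Rightarrow> complex^5^5 \<Rightarrow> complex^5 \<Rightarrow> complex^5 \<Rightarrow> complex^5 \<Rightarrow> complex^5 \<Rightarrow> complex"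
  where "jac_deriv M1 M2 y m n a = bil M1 a m * bil M2 y n + bil M1 y m * bil M2 a n
    - bil M1 a n * bil M2 y m - bil M1 y n * bil M2 a m"

definition tangent :: "complex^5^5 \<Rightarrow> complex^5^5 \<Rightarrow> complex^5 \<Rightarrow> complex^5 \<Rightarrow> bool"
  where "tangent M1 M2 y v \<longleftrightarrow> bil M1 y v = 0 \<and> bil M2 y v = 0"

locale dp_point =
  fixes M1 M2 :: "complex^5^5" and y :: "complex^5"
  assumes dp: "del_pezzo_4 M1 M2" and y_nz: "y \<noteq> 0"
    and quad1: "quad M1 y = 0" and quad2: "quad M2 y = 0"
begin

lemma sym: "bil M1 u v = bil M1 v u" "bil M2 u v = bil M2 v u"
  by (rule bil_commute, use dp in \<open>simp add: del_pezzo_4_def\<close>)+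

lemma bil_y [simp]: "bil M1 y y = 0" "bil M2 y y = 0"
  using quad1 quad2 by (simp_all add: quad_def)

lemma smooth: "\<alpha> *s (M1 *v y) + \<beta> *s (M2 *v y) = 0 \<Longrightarrow> \<alpha> = 0 \<and> \<beta> = 0"
  using dp y_nz quad1 quad2 unfolding del_pezzo_4_def by blast

lemma bil_eq: "(\<Sum>i\<in>UNIV. v $ i * (\<alpha> *s (M1 *v y) + \<beta> *s (M2 *v y)) $ i) = \<alpha> * bil M1 y v + \<beta> * bil M2 y v"
  unfolding sym [of y] by (simp add: bil_def algebra_simps sum.distrib sum_distrib_left)

lemma bil_axis: "bil M1 y (axis i 1) = (M1 *v y) $ i" "bil M2 y (axis i 1) = (M2 *v y) $ i"
  unfolding sym [of y] by (simp_all add: bil_def axis_def if_distrib [of "\<lambda>x. x * _"] cong: if_cong)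

lemma jac_exists: obtains m n where "jac M1 M2 y m n \<noteq> 0"
proof -
  obtain i j where "(M1 *v y) $ i * (M2 *v y) $ j - (M1 *v y) $ j * (M2 *v y) $ i \<noteq> 0"
    using independent_minor [of "M1 *v y" "M2 *v y"] smooth by metis
  then show ?thesis using that [of "axis i 1" "axis j 1"] by (simp add: jac_def bil_axis)
qed

text \<open>\<open>m\<close> and \<open>n\<close> span a complement of the tangent cone; the
  coefficients come from Cramer's rule for \<open>bil M1 y\<close> and
  \<open>bil M2 y\<close>.\<close>

lemma jac_dual:
  assumes "jac M1 M2 y m n \<noteq> 0"
  obtains \<mu> \<nu> where "tangent M1 M2 y (v + \<mu> *s m + \<nu> *s n)"
proof -
  let ?J = "jac M1 M2 y m n"
  let ?\<mu> = "(bil M2 y v * bil M1 y n - bil M1 y v * bil M2 y n) / ?J"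
  let ?\<nu> = "(bil M1 y v * bil M2 y m - bil M2 y v * bil M1 y m) / ?J"
  have "tangent M1 M2 y (v + ?\<mu> *s m + ?\<nu> *s n)"
    unfolding tangent_def bil_lin using assms
    by (simp add: field_simps) (simp add: jac_def algebra_simps)
  then show ?thesis by (rule that)
qed

text \<open>Some nontrivial combination of the two gradients at \<open>y\<close> annihilates
  \<open>n\<close>. It is nonzero by smoothness and annihilates the four tangent vectors too. In
  effect the tangent cone has dimension 3.\<close>

lemma det5_tangent:
  assumes "tangent M1 M2 y a" "tangent M1 M2 y b" "tangent M1 M2 y c" "tangent M1 M2 y d"
  shows "det5 a b c d n = 0"
proof -
  obtain \<alpha> \<beta> where *: "\<not> (\<alpha> = 0 \<and> \<beta> = 0)" "\<alpha> * bil M1 y n + \<beta> * bil M2 y n = 0"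
  proof (cases "bil M1 y n = 0")
    case True then show ?thesis using that [of 1 0] by simp
  next
    case False then show ?thesis using that [of "- bil M2 y n" "bil M1 y n"] by simp
  qed
  show ?thesis
  proof (rule det5_eq_0 [of "\<alpha> *s (M1 *v y) + \<beta> *s (M2 *v y)"], unfold bil_eq)
    show "\<alpha> *s (M1 *v y) + \<beta> *s (M2 *v y) \<noteq> 0" using smooth *(1) by blast
  qed (use * assms in \<open>simp_all add: tangent_def\<close>)
qed

lemma tangent_lin:
  "tangent M1 M2 y u \<Longrightarrow> tangent M1 M2 y v \<Longrightarrow> tangent M1 M2 y (s *s u + t *s v)"
  "tangent M1 M2 y u \<Longrightarrow> tangent M1 M2 y (s *s u)"
  "tangent M1 M2 y u \<Longrightarrow> tangent M1 M2 y v \<Longrightarrow> tangent M1 M2 y (u + v)"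
  "tangent M1 M2 y u \<Longrightarrow> tangent M1 M2 y v \<Longrightarrow> tangent M1 M2 y (u - v)"
  by (simp_all add: tangent_def bil_lin bil_diff)

lemma tangent_y: "tangent M1 M2 y y" by (simp add: tangent_def)

text \<open>Applying \<open>bil M1 y\<close> and \<open>bil M2 y\<close> to a relation of the five
  rows leaves a system with determinant \<open>jac\<close> for the coefficients of \<open>m\<close>
  and \<open>n\<close>, which therefore vanish.\<close>

lemma det5_tangent_dependent:
  assumes "tangent M1 M2 y a" "tangent M1 M2 y b" "tangent M1 M2 y c"
    and "jac M1 M2 y m n \<noteq> 0" "det5 a b c m n = 0"
  obtains \<alpha> \<beta> \<gamma> where "\<not> (\<alpha> = 0 \<and> \<beta> = 0 \<and> \<gamma> = 0)" "\<alpha> *s a + \<beta> *s b + \<gamma> *s c = 0"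
proof -
  obtain \<alpha> \<beta> \<gamma> \<delta> \<epsilon> where nz: "\<not> (\<alpha> = 0 \<and> \<beta> = 0 \<and> \<gamma> = 0 \<and> \<delta> = 0 \<and> \<epsilon> = 0)"
    and 0: "\<alpha> *s a + \<beta> *s b + \<gamma> *s c + \<delta> *s m + \<epsilon> *s n = 0"
    using det5_dependent [OF assms(5)] by blast
  have "bil M1 y (\<alpha> *s a + \<beta> *s b + \<gamma> *s c + \<delta> *s m + \<epsilon> *s n) = 0"
    "bil M2 y (\<alpha> *s a + \<beta> *s b + \<gamma> *s c + \<delta> *s m + \<epsilon> *s n) = 0"
    unfolding 0 by simp_all
  then have e: "\<delta> * bil M1 y m + \<epsilon> * bil M1 y n = 0" "\<delta> * bil M2 y m + \<epsilon> * bil M2 y n = 0"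
    using assms(1-3) by (simp_all add: bil_lin tangent_def)
  have "\<delta> * jac M1 M2 y m n = (\<delta> * bil M1 y m + \<epsilon> * bil M1 y n) * bil M2 y n
      - (\<delta> * bil M2 y m + \<epsilon> * bil M2 y n) * bil M1 y n"
    "\<epsilon> * jac M1 M2 y m n = (\<delta> * bil M2 y m + \<epsilon> * bil M2 y n) * bil M1 y m
      - (\<delta> * bil M1 y m + \<epsilon> * bil M1 y n) * bil M2 y m"
    by (simp_all add: jac_def algebra_simps)
  then have "\<delta> = 0" "\<epsilon> = 0" unfolding e using assms(4) by simp_all
  then show ?thesis using nz 0 by (intro that) auto
qed

text \<open>Modulo the tangent cone the last two arguments live in a plane, on which \<open>jac\<close> is an area form.\<close>

lemma det5_jac:
  assumes T: "tangent M1 M2 y a" "tangent M1 M2 y b" "tangent M1 M2 y c"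
  shows "det5 a b c m n * jac M1 M2 y m' n' = det5 a b c m' n' * jac M1 M2 y m n"
proof (cases "jac M1 M2 y m n = 0 \<and> jac M1 M2 y m' n' = 0")
  case False
  have *: "det5 a b c m n * jac M1 M2 y m' n' = det5 a b c m' n' * jac M1 M2 y m n"
    if J: "jac M1 M2 y m' n' \<noteq> 0" for m n m' n'
  proof -
    obtain \<mu> \<nu> where m: "tangent M1 M2 y (m + \<mu> *s m' + \<nu> *s n')" using jac_dual [OF J] .
    obtain \<rho> \<sigma> where n: "tangent M1 M2 y (n + \<rho> *s m' + \<sigma> *s n')" using jac_dual [OF J] .
    \<comment> \<open>The parts of \<open>m\<close> and \<open>n\<close> in the tangent cone do not
      contribute, so the determinant and \<open>jac\<close> both acquire the factor
      \<open>\<mu> * \<sigma> - \<nu> * \<rho>\<close> of the base change modulo the cone.\<close>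
    have "det5 a b c (m + \<mu> *s m' + \<nu> *s n') n = 0" by (rule det5_tangent [OF T m])
    then have 1: "det5 a b c m n = - \<mu> * det5 a b c m' n - \<nu> * det5 a b c n' n"
      by (simp add: det5_lin algebra_simps eq_neg_iff_add_eq_0)
    have "det5 a b c k (n + \<rho> *s m' + \<sigma> *s n') = 0" for k
      using det5_tangent [OF T n, of k] det5_swap(4) [of a b c k] by simp
    then have 2: "det5 a b c k n = - \<rho> * det5 a b c k m' - \<sigma> * det5 a b c k n'" for k
      by (simp add: det5_lin algebra_simps eq_neg_iff_add_eq_0)
    have 3: "det5 a b c m n = (\<mu> * \<sigma> - \<nu> * \<rho>) * det5 a b c m' n'"
      unfolding 1 2 [of m'] 2 [of n'] using det5_swap(4) [of a b c n' m'] by (simp add: algebra_simps)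
    have b: "bil M1 y m = - \<mu> * bil M1 y m' - \<nu> * bil M1 y n'" "bil M2 y m = - \<mu> * bil M2 y m' - \<nu> * bil M2 y n'"
      "bil M1 y n = - \<rho> * bil M1 y m' - \<sigma> * bil M1 y n'" "bil M2 y n = - \<rho> * bil M2 y m' - \<sigma> * bil M2 y n'"
      using m n unfolding tangent_def bil_lin by algebra+
    have "jac M1 M2 y m n = (\<mu> * \<sigma> - \<nu> * \<rho>) * jac M1 M2 y m' n'"
      unfolding jac_def b by (simp add: algebra_simps)
    then show ?thesis unfolding 3 by simp
  qed
  show ?thesis
  \<comment> \<open>The identity is symmetric in the two pairs; either one with nonzero
    \<open>jac\<close> can serve as the basis.\<close>
  proof (cases "jac M1 M2 y m' n' = 0")
    case True
    with False have "jac M1 M2 y m n \<noteq> 0" by simp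
    from * [OF this, of m' n'] show ?thesis by simp
  qed (rule *)
next
  case True then show ?thesis by simp
qed

end

section \<open>Infinitesimal level sets\<close>

text \<open>If \<open>(a, a')\<close> and \<open>(b, b')\<close> are the velocities of \<open>(y, w)\<close> along two curves in the cotangent bundle, then
  \<open>curv\<close> is \<open>4 * jac M1 M2 y m n\<close> times the value of the symplectic form on them, for all \<open>m\<close>, \<open>n\<close> with
  \<open>jac M1 M2 y m n \<noteq> 0\<close>: it is what remains of the differential of \<open>det(y, w, dy, m, n)\<close>.\<close>

definition curv ::
  "complex^5^5 \<Rightarrow> complex^5^5 \<Rightarrow> complex^5 \<Rightarrow> complex^5 \<Rightarrow> complex^5 \<Rightarrow> complex^5 \<Rightarrow>
    complex^5 \<Rightarrow> complex^5 \<Rightarrow> complex^5 \<Rightarrow> complex^5 \<Rightarrow> complex"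
  where "curv M1 M2 y w m n a a' b b' =
    2 * det5 a w b m n + det5 y a' b m n - det5 y b' a m n
    - (det5 y w b m n * jac_deriv M1 M2 y m n a - det5 y w a m n * jac_deriv M1 M2 y m n b)
      / jac M1 M2 y m n"

text \<open>The derivatives of the equations of a fibre, with the factor 2 dropped in those for
  \<open>y\<close> and for \<open>w\<close> alone. The solution space contains all velocities in the
  fibre and may be larger.\<close>

definition inf_level ::
  "complex^5^5 \<Rightarrow> complex^5^5 \<Rightarrow> complex^5 \<Rightarrow> complex^5 \<Rightarrow> complex^5 \<Rightarrow> complex^5 \<Rightarrow> bool"
  where "inf_level M1 M2 y w a a' \<longleftrightarrow> (\<forall>M\<in>{M1, M2}.
    bil M y a = 0 \<and> bil M y a' + bil M w a = 0 \<and> bil M w a' = 0)"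

lemma jac_deriv_lin:
  "jac_deriv M1 M2 y m n (s *s a + t *s c) = s * jac_deriv M1 M2 y m n a + t * jac_deriv M1 M2 y m n c"
  by (simp add: jac_deriv_def bil_lin algebra_simps)

lemma curv_swap: "curv M1 M2 y w m n a a' b b' = - curv M1 M2 y w m n b b' a a'"
  unfolding curv_def using det5_swap(2) [of a w b m n] by (simp add: diff_divide_distrib)

lemma curv_self: "curv M1 M2 y w m n a a' a a' = 0"
  using curv_swap [of M1 M2 y w m n a a' a a'] by simp

lemma curv_lin:
  "curv M1 M2 y w m n (s *s a + t *s c) (s *s a' + t *s c') b b' =
    s * curv M1 M2 y w m n a a' b b' + t * curv M1 M2 y w m n c c' b b'"
  unfolding curv_def jac_deriv_lin det5_lin
  by (simp add: algebra_simps diff_divide_distrib add_divide_distrib)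

text \<open>An alternating form vanishes on two vectors once a nontrivial combination of them pairs
  to 0 with both. It then suffices to find one good combination of two given velocities.\<close>

lemma curv_dependent:
  assumes "\<not> (s = 0 \<and> t = 0)"
    and "curv M1 M2 y w m n (s *s a + t *s b) (s *s a' + t *s b') a a' = 0"
    and "curv M1 M2 y w m n (s *s a + t *s b) (s *s a' + t *s b') b b' = 0"
  shows "curv M1 M2 y w m n a a' b b' = 0"
proof (cases "s = 0")
  case False
  then show ?thesis using assms(3) by (simp add: curv_lin curv_self)
next
  case True
  with assms(1) have "t \<noteq> 0" by simp
  then have "curv M1 M2 y w m n b b' a a' = 0" using assms(2) by (simp add: curv_lin curv_self)
  then show ?thesis using curv_swap [of M1 M2 y w m n a a' b b'] by simp
qed

text \<open>Changing \<open>y\<close> by a factor or \<open>w\<close> by a multiple of \<open>y\<close> does not move the covector.\<close>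

lemma curv_gauge:
  assumes "jac M1 M2 y m n \<noteq> 0"
  shows "curv M1 M2 y w m n (r *s y) (r' *s y) b b' = 0"
proof -
  have "jac_deriv M1 M2 y m n (r *s y) = 2 * r * jac M1 M2 y m n"
    by (simp add: jac_deriv_def jac_def bil_lin algebra_simps)
  then show ?thesis using assms by (simp add: curv_def det5_lin)
qed

lemma curv_add:
  "curv M1 M2 y w m n (a + c) (a' + c') b b' =
    curv M1 M2 y w m n a a' b b' + curv M1 M2 y w m n c c' b b'"
  using curv_lin [of M1 M2 y w m n 1 a 1 c a' c' b b'] by simp

lemma inf_level_lin:
  assumes "inf_level M1 M2 y w a a'" "inf_level M1 M2 y w b b'"
  shows "inf_level M1 M2 y w (s *s a + t *s b) (s *s a' + t *s b')"
proof -
  have "s * p + t * q + (s * p' + t * q') = s * (p + p') + t * (q + q')" for p q p' q' :: complex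
    by (simp add: algebra_simps)
  then show ?thesis using assms unfolding inf_level_def bil_lin by simp
qed

text \<open>A 4 x 5 matrix with independent rows has a right inverse, which solves the system for
  any prescribed values. This is the source of the Hamiltonian vector in
  \<open>curv_generic\<close>.\<close>

lemma four_functionals:
  fixes p q r s :: "complex^5"
  assumes "\<And>\<alpha> \<beta> \<gamma> \<delta>. \<alpha> *s p + \<beta> *s q + \<gamma> *s r + \<delta> *s s = 0 \<Longrightarrow> \<alpha> = 0 \<and> \<beta> = 0 \<and> \<gamma> = 0 \<and> \<delta> = 0"
  obtains z where "(\<Sum>i\<in>UNIV. z $ i * p $ i) = k" "(\<Sum>i\<in>UNIV. z $ i * q $ i) = l"
    "(\<Sum>i\<in>UNIV. z $ i * r $ i) = m" "(\<Sum>i\<in>UNIV. z $ i * s $ i) = n"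
proof -
  define N :: "complex^5^4" where "N = (\<chi> i. if i = 1 then p else if i = 2 then q else if i = 3 then r else s)"
  have N: "N $ 1 = p" "N $ 2 = q" "N $ 3 = r" "N $ 4 = s" by (simp_all add: N_def)
  have row: "row i N = N $ i" for i by (simp add: row_def)
  have "\<exists>B. N ** B = mat 1"
    unfolding matrix_right_invertible_independent_rows row sum_4 forall_4 N using assms by blast
  then obtain B where B: "N ** B = mat 1" by blast
  define h :: "complex^4" where "h = (\<chi> i. if i = 1 then k else if i = 2 then l else if i = 3 then m else n)"
  have "N *v (B *v h) = h" by (simp add: matrix_vector_mul_assoc B)
  then have *: "(\<Sum>j\<in>UNIV. N $ i $ j * (B *v h) $ j) = h $ i" for i
    by (simp add: matrix_vector_mult_def [of N] vec_eq_iff)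
  show ?thesis
    by (rule that [of "B *v h"])
      (use * [of 1] * [of 2] * [of 3] * [of 4] in \<open>simp_all add: N h_def mult.commute\<close>)
qed

context dp_point
begin

lemma bil_left: "bil M1 u v = (\<Sum>i\<in>UNIV. v $ i * (M1 *v u) $ i)" "bil M2 u v = (\<Sum>i\<in>UNIV. v $ i * (M2 *v u) $ i)"
  unfolding sym [of u v] by (simp_all add: bil_def)

text \<open>The two gradients at \<open>y\<close> span the annihilator of the tangent cone: the
  combination with the values of \<open>x\<close> on \<open>m\<close> and \<open>n\<close> agrees
  with \<open>x\<close> on the basis \<open>a\<close>, \<open>b\<close>, \<open>c\<close> of the
  cone as well.\<close>

lemma tangent_dual:
  assumes T: "tangent M1 M2 y a" "tangent M1 M2 y b" "tangent M1 M2 y c"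
    and J: "jac M1 M2 y m n \<noteq> 0" and d: "det5 a b c m n \<noteq> 0"
    and x: "(\<Sum>i\<in>UNIV. a $ i * x $ i) = 0" "(\<Sum>i\<in>UNIV. b $ i * x $ i) = 0" "(\<Sum>i\<in>UNIV. c $ i * x $ i) = 0"
  obtains \<alpha> \<beta> where "x = \<alpha> *s (M1 *v y) + \<beta> *s (M2 *v y)"
proof -
  let ?J = "jac M1 M2 y m n"
  define p q where "p = (\<Sum>i\<in>UNIV. m $ i * x $ i)" and "q = (\<Sum>i\<in>UNIV. n $ i * x $ i)"
  define \<alpha> \<beta> where "\<alpha> = (p * bil M2 y n - q * bil M2 y m) / ?J"
    and "\<beta> = (q * bil M1 y m - p * bil M1 y n) / ?J"
  define X where "X = x - (\<alpha> *s (M1 *v y) + \<beta> *s (M2 *v y))"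
  have e: "(\<Sum>i\<in>UNIV. v $ i * X $ i) = (\<Sum>i\<in>UNIV. v $ i * x $ i) - (\<alpha> * bil M1 y v + \<beta> * bil M2 y v)" for v
    unfolding X_def vector_minus_component right_diff_distrib sum_subtractf bil_eq ..
  have "\<alpha> * bil M1 y m + \<beta> * bil M2 y m = p" "\<alpha> * bil M1 y n + \<beta> * bil M2 y n = q"
    unfolding \<alpha>_def \<beta>_def using J by (simp_all add: field_simps) (simp_all add: jac_def algebra_simps)
  then have "X = 0"
    using d det5_eq_0 [of X a b c m n] T x unfolding e tangent_def p_def q_def by auto
  then show ?thesis using that unfolding X_def by simp
qed

text \<open>If \<open>y\<close>, \<open>a\<close>, \<open>b\<close> were a basis of the cone,
  \<open>M2 *v v\<close> would annihilate the whole cone and in particular \<open>v\<close>. So in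
  the plane formed by the cone modulo \<open>y\<close>, the orthogonal of an anisotropic vector is
  only a line.\<close>

lemma perp_dependent:
  assumes v: "tangent M1 M2 y v" "bil M2 v v \<noteq> 0"
    and ab: "tangent M1 M2 y a" "tangent M1 M2 y b" "bil M2 v a = 0" "bil M2 v b = 0"
    and J: "jac M1 M2 y m n \<noteq> 0"
  shows "det5 y a b m n = 0"
proof (rule ccontr)
  assume "det5 y a b m n \<noteq> 0"
  from tangent_dual [OF tangent_y ab(1,2) J this, of "M2 *v v"]
  obtain \<alpha> \<beta> where "M2 *v v = \<alpha> *s (M1 *v y) + \<beta> *s (M2 *v y)"
    using v ab unfolding bil_left [symmetric] by (auto simp: tangent_def sym [of v y])
  then have "bil M2 v v = \<alpha> * bil M1 y v + \<beta> * bil M2 y v"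
    unfolding bil_left(2) [of v v] by (simp only: bil_eq)
  then show False using v by (simp add: tangent_def)
qed

text \<open>\<open>a\<close> and \<open>b\<close> are dependent modulo \<open>y\<close> by
  \<open>perp_dependent\<close>, and the last two hypotheses determine \<open>a'\<close> and
  \<open>b'\<close> from them modulo \<open>y\<close>. So a nontrivial combination of the two
  velocities is pure gauge.\<close>

lemma curv_vertex:
  assumes v: "tangent M1 M2 y v" "bil M2 v v \<noteq> 0"
    and ab: "tangent M1 M2 y a" "tangent M1 M2 y b" "bil M2 v a = 0" "bil M2 v b = 0"
    and J: "jac M1 M2 y m n \<noteq> 0"
    and a': "a' + t *s a = \<rho> *s y" and b': "b' + t *s b = \<sigma> *s y"
  shows "curv M1 M2 y w m n a a' b b' = 0"
proof -
  obtain p q r where pqr: "\<not> (p = 0 \<and> q = 0 \<and> r = 0)" "p *s y + q *s a + r *s b = 0"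
    using det5_tangent_dependent [OF tangent_y ab(1,2) J perp_dependent [OF v ab J]] .
  have qr: "\<not> (q = 0 \<and> r = 0)" using pqr y_nz by auto
  have k: "q *s a + r *s b = (- p) *s y"
    using pqr(2) by (simp add: eq_neg_iff_add_eq_0 add_ac)
  have "q *s a' + r *s b' = q *s (a' + t *s a) + r *s (b' + t *s b) - t *s (q *s a + r *s b)"
    by (simp add: vec_eq_iff algebra_simps)
  also have "\<dots> = (q * \<rho> + r * \<sigma> + t * p) *s y"
    unfolding k a' b' by (simp add: vec_eq_iff algebra_simps)
  finally have k': "q *s a' + r *s b' = (q * \<rho> + r * \<sigma> + t * p) *s y" .
  show ?thesis
    by (rule curv_dependent [OF qr]) (simp_all only: k k' curv_gauge [OF J])
qed

end

section \<open>Covectors off the zero section\<close>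

locale dp_vector = dp_point +
  fixes w
  assumes w: "tangent M1 M2 y w"
    and indep: "s *s y + t *s w = 0 \<Longrightarrow> s = 0 \<and> t = 0"
begin

lemma bil_y_w [simp]: "bil M1 y w = 0" "bil M2 y w = 0" "bil M1 w y = 0" "bil M2 w y = 0"
  using w sym [of w y] by (simp_all add: tangent_def)

lemma in_span_y_w:
  assumes "tangent M1 M2 y x" "jac M1 M2 y m n \<noteq> 0" "det5 y w x m n = 0"
  obtains s t where "x = s *s y + t *s w"
proof -
  obtain \<alpha> \<beta> \<gamma> where 0: "\<not> (\<alpha> = 0 \<and> \<beta> = 0 \<and> \<gamma> = 0)" "\<alpha> *s y + \<beta> *s w + \<gamma> *s x = 0"
    using det5_tangent_dependent [OF tangent_y w assms] .
  have "\<gamma> \<noteq> 0" using 0 indep [of \<alpha> \<beta>] by auto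
  have "\<gamma> *s x = - (\<alpha> *s y + \<beta> *s w)" using minus_unique [OF 0(2)] by simp
  then have "x = (- \<alpha> / \<gamma>) *s y + (- \<beta> / \<gamma>) *s w"
    using \<open>\<gamma> \<noteq> 0\<close> by (simp add: vec_eq_iff field_simps)
  then show ?thesis by (rule that)
qed

text \<open>By \<open>q\<close> the line through \<open>y\<close> and \<open>w\<close> lies on the
  surface. By \<open>det\<close> the coefficients form a 2 x 2 matrix of rank at most one, so the
  relation is one between the two gradients at a single point of that line.\<close>

lemma line_smooth:
  assumes q: "bil M1 w w = 0" "bil M2 w w = 0"
    and rel: "\<alpha> *s (M1 *v y) + \<beta> *s (M2 *v y) + \<gamma> *s (M1 *v w) + \<delta> *s (M2 *v w) = 0"
    and det: "\<alpha> * \<delta> = \<beta> * \<gamma>"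
  shows "\<alpha> = 0 \<and> \<beta> = 0 \<and> \<gamma> = 0 \<and> \<delta> = 0"
proof -
  have sm: "a = 0 \<and> b = 0" if "a *s (M1 *v (s *s y + t *s w)) + b *s (M2 *v (s *s y + t *s w)) = 0"
    "\<not> (s = 0 \<and> t = 0)" for a b s t
  proof -
    have "s *s y + t *s w \<noteq> 0" "quad M1 (s *s y + t *s w) = 0" "quad M2 (s *s y + t *s w) = 0"
      using that(2) indep q by (auto simp: quad_def bil_lin)
    then show ?thesis using dp that(1) unfolding del_pezzo_4_def by blast
  qed
  have lin: "M *v (s *s y + t *s w) = s *s (M *v y) + t *s (M *v w)" for M :: "complex^5^5" and s t
    by (simp add: matrix_vector_right_distrib vector_scalar_commute)
  show ?thesis
  proof (cases "\<alpha> = 0 \<and> \<beta> = 0")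
    case True
    then show ?thesis using rel sm [of \<gamma> 0 1 \<delta>] by simp
  next
    case False
    \<comment> \<open>The point in question is \<open>y + \<mu> w\<close>; the case treated before
      is the point \<open>w\<close>.\<close>
    define \<mu> where "\<mu> = (if \<alpha> = 0 then \<delta> / \<beta> else \<gamma> / \<alpha>)"
    have \<mu>: "\<gamma> = \<mu> * \<alpha>" "\<delta> = \<mu> * \<beta>" using False det by (auto simp: \<mu>_def field_simps)
    have "\<alpha> *s (M1 *v (1 *s y + \<mu> *s w)) + \<beta> *s (M2 *v (1 *s y + \<mu> *s w)) = 0"
      unfolding lin rel [symmetric] \<mu> by (simp add: vec_eq_iff algebra_simps)
    then show ?thesis using sm [of \<alpha> 1 \<mu> \<beta>] \<mu> by simp
  qed
qed

end

context dp_vector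
begin

text \<open>Infinitesimal rigidity of the line: \<open>rel\<close> lets \<open>bil M1 y\<close> be
  read as \<open>bil M2 w\<close>, so that \<open>a\<close> and \<open>a'\<close> are both tangent
  and orthogonal to \<open>w\<close> under \<open>M1\<close>. This forces them into the plane of
  \<open>y\<close> and \<open>w\<close>, and every determinant in \<open>curv\<close> then has three
  vectors in that plane.\<close>

lemma curv_line:
  assumes q: "bil M1 w w = 0" "bil M2 w w = 0" and rel: "M1 *v y = M2 *v w"
    and J: "jac M1 M2 y m n \<noteq> 0"
    and a: "inf_level M1 M2 y w a a'" and b: "inf_level M1 M2 y w b b'"
  shows "curv M1 M2 y w m n a a' b b' = 0"
proof -
  have r: "bil M1 y v = bil M2 w v" for v
    unfolding bil_left rel ..
  have span: "\<exists>s t. x = s *s y + t *s w" if T: "tangent M1 M2 y x" and x: "bil M1 w x = 0" for x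
  proof (rule ccontr)
    assume "\<not> ?thesis"
    then have "det5 y w x m n \<noteq> 0" using in_span_y_w [OF T J] by metis
    from tangent_dual [OF tangent_y w T J this, of "M1 *v w"]
    obtain \<alpha> \<beta> where ab: "M1 *v w = \<alpha> *s (M1 *v y) + \<beta> *s (M2 *v y)"
      using q x unfolding bil_left [symmetric] by auto
    \<comment> \<open>\<open>\<mu>\<close> is a root of
      \<open>\<mu>\<^sup>2 + \<alpha> \<mu> = \<beta>\<close>. Adding \<open>\<mu>\<close> times
      \<open>M1 y - M2 w = 0\<close> to the relation \<open>ab\<close> then makes its coefficients
      rank one, as \<open>line_smooth\<close> demands.\<close>
    define c where "c = csqrt (\<alpha>\<^sup>2 + 4 * \<beta>)"
    define \<mu> where "\<mu> = (c - \<alpha>) / 2"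
    have "c\<^sup>2 = \<alpha>\<^sup>2 + 4 * \<beta>" unfolding c_def by simp
    then have \<mu>: "(\<alpha> + \<mu>) * \<mu> = \<beta>"
      unfolding \<mu>_def by (simp add: field_simps power2_eq_square)
    have "(\<alpha> + \<mu>) *s (M1 *v y) + \<beta> *s (M2 *v y) + (- 1) *s (M1 *v w) + (- \<mu>) *s (M2 *v w) = 0"
      unfolding ab rel [symmetric] by (simp add: vec_eq_iff algebra_simps)
    from line_smooth [OF q this] \<mu> show False by simp
  qed
  have ex: "(\<exists>s t. a = s *s y + t *s w) \<and> (\<exists>s t. a' = s *s y + t *s w)"
    if "inf_level M1 M2 y w a a'" for a a'
  proof -
    have i: "bil M1 y a = 0" "bil M2 y a = 0" "bil M1 y a' + bil M1 w a = 0" "bil M2 y a' + bil M2 w a = 0"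
      "bil M1 w a' = 0" "bil M2 w a' = 0" using that by (simp_all add: inf_level_def)
    then show ?thesis using span [of a] span [of a'] r [of a] r [of a'] by (simp add: tangent_def)
  qed
  obtain s t where a1: "a = s *s y + t *s w" using ex [OF a] by blast
  obtain s' t' where a2: "a' = s' *s y + t' *s w" using ex [OF a] by blast
  obtain p q where b1: "b = p *s y + q *s w" using ex [OF b] by blast
  obtain p' q' where b2: "b' = p' *s y + q' *s w" using ex [OF b] by blast
  show ?thesis unfolding curv_def a1 a2 b1 b2 by (simp add: det5_lin)
qed

text \<open>The four gradients at \<open>y\<close> and \<open>w\<close> annihilate the plane of
  \<open>y\<close> and \<open>w\<close>, so they lie in a space of dimension 3 and are dependent;
  \<open>line_smooth\<close> excludes a singular coefficient matrix.\<close>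

lemma line_relation:
  assumes q: "bil M1 w w = 0" "bil M2 w w = 0"
  obtains \<alpha> \<beta> \<gamma> \<delta> where "\<alpha> * \<delta> \<noteq> \<beta> * \<gamma>"
    "\<alpha> *s (M1 *v y) + \<beta> *s (M2 *v y) + \<gamma> *s (M1 *v w) + \<delta> *s (M2 *v w) = 0"
proof -
  obtain i where i: "y $ i \<noteq> 0" using y_nz by (auto simp: vec_eq_iff)
  \<comment> \<open>A vector of that plane with vanishing \<open>i\<close>-th coordinate, so that
    \<open>axis i 1\<close> can be added as a fifth row; pairing with \<open>y\<close> removes its
    coefficient afterwards.\<close>
  define X where "X = (- w $ i) *s y + y $ i *s w"
  have "X \<noteq> 0" using indep [of "- w $ i" "y $ i"] i by (auto simp: X_def)
  moreover have s: "(\<Sum>j\<in>UNIV. v $ j * X $ j) = - w $ i * (\<Sum>j\<in>UNIV. v $ j * y $ j) + y $ i * (\<Sum>j\<in>UNIV. v $ j * w $ j)" for v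
    by (simp add: X_def algebra_simps sum.distrib sum_distrib_left sum_negf sum_subtractf)
  moreover have b: "(\<Sum>j\<in>UNIV. (M1 *v u) $ j * v $ j) = bil M1 u v" "(\<Sum>j\<in>UNIV. (M2 *v u) $ j * v $ j) = bil M2 u v" for u v
    unfolding bil_left by (simp_all add: mult.commute)
  moreover have ax: "(\<Sum>j\<in>UNIV. axis i 1 $ j * v $ j) = v $ i" for v :: "complex^5"
    by (simp add: axis_def if_distrib [of "\<lambda>x. x * _"] cong: if_cong)
  ultimately have "det5 (M1 *v y) (M2 *v y) (M1 *v w) (M2 *v w) (axis i 1) = 0"
    by (intro det5_eq_0 [of X]) (simp_all add: q)
  then obtain \<alpha> \<beta> \<gamma> \<delta> \<epsilon> where nz: "\<not> (\<alpha> = 0 \<and> \<beta> = 0 \<and> \<gamma> = 0 \<and> \<delta> = 0 \<and> \<epsilon> = 0)"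
    and e: "\<alpha> *s (M1 *v y) + \<beta> *s (M2 *v y) + \<gamma> *s (M1 *v w) + \<delta> *s (M2 *v w) + \<epsilon> *s axis i 1 = 0"
    by (rule det5_dependent)
  have lin: "(\<Sum>j\<in>UNIV. (p *s a + q *s b + r *s c + s *s d + t *s e) $ j * y $ j) =
    p * (\<Sum>j\<in>UNIV. a $ j * y $ j) + q * (\<Sum>j\<in>UNIV. b $ j * y $ j) + r * (\<Sum>j\<in>UNIV. c $ j * y $ j)
    + s * (\<Sum>j\<in>UNIV. d $ j * y $ j) + t * (\<Sum>j\<in>UNIV. e $ j * y $ j)" for a b c d e p q r s t
    by (simp add: algebra_simps sum.distrib sum_distrib_left)
  have "\<epsilon> * y $ i = 0"
    using lin [of \<alpha> "M1 *v y" \<beta> "M2 *v y" \<gamma> "M1 *v w" \<delta> "M2 *v w" \<epsilon> "axis i 1"]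
    unfolding e b ax by simp
  then have \<epsilon>: "\<epsilon> = 0" using i by simp
  have e': "\<alpha> *s (M1 *v y) + \<beta> *s (M2 *v y) + \<gamma> *s (M1 *v w) + \<delta> *s (M2 *v w) = 0"
    using e unfolding \<epsilon> by simp
  then show ?thesis
    using line_smooth [OF q e'] nz \<epsilon> by (intro that [OF _ e']) blast
qed

text \<open>The Hamiltonian vector of \<open>quad M1\<close> is vertical here, because \<open>w\<close> spans the kernel of \<open>quad M1\<close> modulo \<open>y\<close>.\<close>

lemma curv_focal:
  assumes w1: "bil M1 w w = 0" and w2: "bil M2 w w \<noteq> 0"
    and ns: "\<And>t. M1 *v (w + t *s y) \<noteq> 0"
    and rel: "M1 *v w = \<alpha> *s (M1 *v y) + \<beta> *s (M2 *v y)"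
    and J: "jac M1 M2 y m n \<noteq> 0"
    and a: "inf_level M1 M2 y w a a'" and b: "inf_level M1 M2 y w b b'"
  shows "curv M1 M2 y w m n a a' b b' = 0"
proof -
  have r: "bil M1 w v = \<alpha> * bil M1 y v + \<beta> * bil M2 y v" for v
    unfolding bil_left(1) [of w v] rel bil_eq ..
  \<comment> \<open>Otherwise \<open>M1\<close> would kill \<open>w - \<alpha> y\<close>.\<close>
  have "\<beta> \<noteq> 0"
  proof
    assume "\<beta> = 0"
    then have "M1 *v (w + (- \<alpha>) *s y) = 0"
      using rel unfolding matrix_vector_right_distrib vector_scalar_commute by (simp add: vec_eq_iff)
    with ns show False by blast
  qed
  \<comment> \<open>As \<open>a\<close> is tangent, \<open>r\<close> gives
    \<open>bil M1 w a = 0\<close>, hence \<open>bil M1 y a' = 0\<close>. Then \<open>r\<close> at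
    \<open>a'\<close> gives \<open>bil M2 y a' = 0\<close>, hence
    \<open>bil M2 w a = 0\<close>.\<close>
  have perp: "tangent M1 M2 y a \<and> bil M2 w a = 0" if a: "inf_level M1 M2 y w a a'" for a a'
  proof -
    have i: "bil M1 y a = 0" "bil M2 y a = 0" "bil M1 y a' + bil M1 w a = 0" "bil M2 y a' + bil M2 w a = 0"
      "bil M1 w a' = 0" "bil M2 w a' = 0" using a by (simp_all add: inf_level_def)
    have "bil M1 w a = 0" using r [of a] i by simp
    then show ?thesis using r [of a'] i \<open>\<beta> \<noteq> 0\<close> by (simp add: tangent_def)
  qed
  note pa = perp [OF a] and pb = perp [OF b]
  obtain p q r where pqr: "\<not> (p = 0 \<and> q = 0 \<and> r = 0)" "p *s y + q *s a + r *s b = 0"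
    using det5_tangent_dependent [OF tangent_y _ _ J perp_dependent [OF w w2 _ _ _ _ J]] pa pb by metis
  have qr: "\<not> (q = 0 \<and> r = 0)" using pqr y_nz by auto
  have k: "q *s a + r *s b = (- p) *s y"
    using pqr(2) by (simp add: eq_neg_iff_add_eq_0 add_ac)
  \<comment> \<open>This combination moves \<open>y\<close> along itself, so up to gauge it is the
    vertical velocity \<open>k'\<close>. Like the base part of every velocity, \<open>k'\<close> is
    orthogonal to \<open>w\<close> under \<open>M2\<close>, whence \<open>perp_dependent\<close>
    applies.\<close>
  define k' where "k' = q *s a' + r *s b'"
  have "inf_level M1 M2 y w ((- p) *s y) k'"
    using inf_level_lin [OF a b, of q r] unfolding k k'_def .
  then have pk: "tangent M1 M2 y k' \<and> bil M2 w k' = 0"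
    by (simp add: inf_level_def tangent_def bil_lin bil_minus)
  have 0: "curv M1 M2 y w m n ((- p) *s y) k' c c' = 0" if "inf_level M1 M2 y w c c'" for c c'
  proof -
    have "det5 y k' c m n = 0"
      using perp_dependent [OF w w2 _ _ _ _ J, of k' c] pk perp [OF that] by blast
    then have "curv M1 M2 y w m n 0 k' c c' = 0"
      using jac_deriv_lin [of M1 M2 y m n 0 0 0 0] det5_scale(1) [of 0 0] det5_scale(3) [of _ _ 0 0]
      by (simp add: curv_def)
    then show ?thesis
      using curv_add [of M1 M2 y w m n "(- p) *s y" 0 0 k' c c'] curv_gauge [OF J, of w "- p" 0 c c'] by simp
  qed
  show ?thesis
    by (rule curv_dependent [OF qr]) (simp_all only: k k'_def [symmetric] 0 [OF a] 0 [OF b])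
qed

text \<open>The Hamiltonian vector moves \<open>y\<close> towards \<open>w\<close>. Up to gauge its
  multiples are the only velocities whose base part lies in the plane of \<open>y\<close> and
  \<open>w\<close>, and this is a single linear condition on a velocity. So two given velocities
  always have a nontrivial combination that is, up to gauge, such a multiple.\<close>

lemma curv_generic:
  assumes w1: "bil M1 w w = 0" and w2: "bil M2 w w \<noteq> 0"
    and nrel: "\<And>\<alpha> \<beta>. M1 *v w \<noteq> \<alpha> *s (M1 *v y) + \<beta> *s (M2 *v y)"
  obtains m n where "jac M1 M2 y m n \<noteq> 0"
    "\<And>a a' b b'. inf_level M1 M2 y w a a' \<Longrightarrow> inf_level M1 M2 y w b b' \<Longrightarrow> curv M1 M2 y w m n a a' b b' = 0"
proof -
  \<comment> \<open>Pairing with \<open>w\<close> isolates \<open>\<beta>\<close>; then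
    \<open>nrel\<close> rules out \<open>\<alpha>\<close>, and smoothness at \<open>y\<close> the
    rest.\<close>
  have ind: "\<alpha> = 0 \<and> \<beta> = 0 \<and> \<gamma> = 0 \<and> \<delta> = 0"
    if 0: "\<alpha> *s (M1 *v w) + \<beta> *s (M2 *v w) + \<gamma> *s (M1 *v y) + \<delta> *s (M2 *v y) = 0" for \<alpha> \<beta> \<gamma> \<delta>
  proof -
    have "(\<Sum>i\<in>UNIV. w $ i * (\<alpha> *s (M1 *v w) + \<beta> *s (M2 *v w) + \<gamma> *s (M1 *v y) + \<delta> *s (M2 *v y)) $ i) = 0"
      unfolding 0 by simp
    then have "\<alpha> * bil M1 w w + \<beta> * bil M2 w w + \<gamma> * bil M1 y w + \<delta> * bil M2 y w = 0"
      unfolding bil_left by (simp add: distrib_left mult.left_commute sum.distrib sum_distrib_left)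
    then have "\<beta> = 0" using w1 w2 by simp
    have "\<alpha> = 0"
    proof (rule ccontr)
      assume a: "\<alpha> \<noteq> 0"
      have e: "\<alpha> * (M1 *v w) $ i + \<gamma> * (M1 *v y) $ i + \<delta> * (M2 *v y) $ i = 0" for i
        using arg_cong [OF 0, of "\<lambda>v. v $ i"] \<open>\<beta> = 0\<close> by simp
      have e': "\<alpha> * (M1 *v w) $ i = - \<gamma> * (M1 *v y) $ i - \<delta> * (M2 *v y) $ i" for i
        using e [of i] by algebra
      have "(M1 *v w) $ i = \<alpha> * (M1 *v w) $ i / \<alpha>" for i using a by simp
      then have "(M1 *v w) $ i = (- \<gamma> / \<alpha>) * (M1 *v y) $ i + (- \<delta> / \<alpha>) * (M2 *v y) $ i" for i
        unfolding e' by (simp add: diff_divide_distrib)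
      then have "M1 *v w = (- \<gamma> / \<alpha>) *s (M1 *v y) + (- \<delta> / \<alpha>) *s (M2 *v y)"
        by (simp add: vec_eq_iff)
      with nrel show False by blast
    qed
    with \<open>\<beta> = 0\<close> 0 smooth [of \<gamma> \<delta>] show ?thesis by simp
  qed
  obtain z where "(\<Sum>i\<in>UNIV. z $ i * (M1 *v w) $ i) = 0" "(\<Sum>i\<in>UNIV. z $ i * (M2 *v w) $ i) = 0"
    "(\<Sum>i\<in>UNIV. z $ i * (M1 *v y) $ i) = 0" "(\<Sum>i\<in>UNIV. z $ i * (M2 *v y) $ i) = - bil M2 w w"
    by (rule four_functionals [OF ind])
  note z = this [folded bil_left]
  \<comment> \<open>With \<open>m\<close>, \<open>z\<close> as the auxiliary pair the Hamiltonian
    vector is easy to test: \<open>z\<close> occurs twice in one determinant, and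
    \<open>M1 *v w\<close> annihilates all rows of another.\<close>
  obtain m where "(\<Sum>i\<in>UNIV. m $ i * (M1 *v w) $ i) = 0" "(\<Sum>i\<in>UNIV. m $ i * (M2 *v w) $ i) = 0"
    "(\<Sum>i\<in>UNIV. m $ i * (M1 *v y) $ i) = 1" "(\<Sum>i\<in>UNIV. m $ i * (M2 *v y) $ i) = 0"
    by (rule four_functionals [OF ind])
  note m = this [folded bil_left]
  have J: "jac M1 M2 y m z \<noteq> 0" using w2 by (simp add: jac_def z m)
  \<comment> \<open>\<open>(w, z)\<close> is, up to a factor, the Hamiltonian vector of \<open>quad M1\<close>.\<close>
  have H: "inf_level M1 M2 y w w z" using z w1 by (simp add: inf_level_def)
  have curv_H: "curv M1 M2 y w m z w z b b' = 0" if b: "inf_level M1 M2 y w b b'" for b b'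
  proof -
    have "M1 *v w \<noteq> 0" using nrel [of 0 0] by simp
    then have "det5 y b' w m z = 0"
      by (rule det5_eq_0) (use b w1 z m in \<open>simp_all add: inf_level_def flip: bil_left\<close>)
    moreover have "jac_deriv M1 M2 y m z w = 0" by (simp add: jac_deriv_def z m)
    ultimately show ?thesis by (simp add: curv_def)
  qed
  have key: "curv M1 M2 y w m z k k' b b' = 0"
    if k: "inf_level M1 M2 y w k k'" and d: "det5 y w k m z = 0" and b: "inf_level M1 M2 y w b b'" for k k' b b'
  proof -
    have "tangent M1 M2 y k" using k by (simp add: inf_level_def tangent_def)
    from in_span_y_w [OF this J d] obtain p q where pq: "k = p *s y + q *s w" .
    \<comment> \<open>Removing \<open>q\<close> times the Hamiltonian vector leaves the velocity
      \<open>(p y, l)\<close>. It is pure gauge, because \<open>l\<close> turns out to be a multiple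
      of \<open>y\<close>.\<close>
    define l where "l = k' - q *s z"
    have "inf_level M1 M2 y w (1 *s k + (- q) *s w) (1 *s k' + (- q) *s z)"
      by (rule inf_level_lin [OF k H])
    also have "1 *s k + (- q) *s w = p *s y" unfolding pq by (simp add: vec_eq_iff)
    also have "1 *s k' + (- q) *s z = l" unfolding l_def by (simp add: vec_eq_iff)
    finally have l: "tangent M1 M2 y l" "bil M1 w l = 0" "bil M2 w l = 0"
      by (simp_all add: inf_level_def tangent_def bil_lin)
    have "det5 y w l m z = 0"
    proof (rule ccontr)
      assume "det5 y w l m z \<noteq> 0"
      from tangent_dual [OF tangent_y w l(1) J this, of "M1 *v w"] show False
        using w1 l(2) nrel unfolding bil_left [symmetric] by auto
    qed
    from in_span_y_w [OF l(1) J this] obtain s t where st: "l = s *s y + t *s w" .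
    have "t = 0" using l(3) w2 unfolding st by (simp add: bil_lin)
    have "k' = s *s y + q *s z" using st \<open>t = 0\<close> unfolding l_def by (simp add: algebra_simps)
    then show ?thesis
      unfolding pq using curv_add [of M1 M2 y w m z "p *s y" "q *s w" "s *s y" "q *s z" b b']
        curv_gauge [OF J, of w p s b b'] curv_lin [of M1 M2 y w m z q w 0 w z z b b'] curv_H [OF b] by simp
  qed
  show ?thesis
  proof (rule that [OF J])
    fix a a' b b' assume a: "inf_level M1 M2 y w a a'" and b: "inf_level M1 M2 y w b b'"
    \<comment> \<open>Coefficients chosen so that the functional \<open>det5 y w _ m z\<close>
      vanishes on the combination.\<close>
    let ?s = "det5 y w b m z" and ?t = "- det5 y w a m z"
    show "curv M1 M2 y w m z a a' b b' = 0"
    proof (cases "?t = 0")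
      case True
      then show ?thesis using key [OF a _ b] by simp
    next
      case False
      have "det5 y w (?s *s a + ?t *s b) m z = 0" unfolding det5_lin by simp
      note k = key [OF inf_level_lin [OF a b] this]
      show ?thesis
        by (rule curv_dependent [OF _ k [OF a] k [OF b]]) (use False in simp)
    qed
  qed
qed

end

section \<open>Change of basis in the pencil of quadrics\<close>

definition pencil :: "complex^5^5 \<Rightarrow> complex^5^5 \<Rightarrow> complex \<Rightarrow> complex \<Rightarrow> complex^5^5"
  where "pencil M1 M2 \<alpha> \<beta> = (\<chi> i j. \<alpha> * M1 $ i $ j + \<beta> * M2 $ i $ j)"

lemma pencil_mult: "pencil M1 M2 \<alpha> \<beta> *v v = \<alpha> *s (M1 *v v) + \<beta> *s (M2 *v v)"
  by (simp add: pencil_def vec_eq_iff matrix_vector_mult_def algebra_simps sum.distrib sum_distrib_left)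

lemma bil_pencil: "bil (pencil M1 M2 \<alpha> \<beta>) u v = \<alpha> * bil M1 u v + \<beta> * bil M2 u v"
  by (simp add: bil_def pencil_mult algebra_simps sum.distrib sum_distrib_left)

lemma pencil_unique:
  assumes "\<alpha> * \<delta> - \<beta> * \<gamma> \<noteq> (0::complex)" "\<alpha> * x + \<beta> * y = 0" "\<gamma> * x + \<delta> * y = 0"
  shows "x = 0 \<and> y = 0"
proof -
  have "(\<alpha> * \<delta> - \<beta> * \<gamma>) * x = 0" "(\<alpha> * \<delta> - \<beta> * \<gamma>) * y = 0"
    using assms(2,3) by algebra+
  then show ?thesis using assms(1) by simp
qed

lemma del_pezzo_4_pencil:
  assumes dp: "del_pezzo_4 M1 M2" and d: "\<alpha> * \<delta> - \<beta> * \<gamma> \<noteq> 0"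
  shows "del_pezzo_4 (pencil M1 M2 \<alpha> \<beta>) (pencil M1 M2 \<gamma> \<delta>)"
  unfolding del_pezzo_4_def
proof (intro conjI allI impI)
  have "transpose (pencil M1 M2 p q) = pencil (transpose M1) (transpose M2) p q" for p q
    by (simp add: transpose_def pencil_def vec_eq_iff)
  moreover have "transpose M1 = M1" "transpose M2 = M2" using dp by (auto simp: del_pezzo_4_def)
  ultimately show "transpose (pencil M1 M2 \<alpha> \<beta>) = pencil M1 M2 \<alpha> \<beta>"
    "transpose (pencil M1 M2 \<gamma> \<delta>) = pencil M1 M2 \<gamma> \<delta>" by metis+
  fix y a b
  assume y: "y \<noteq> 0 \<and> quad (pencil M1 M2 \<alpha> \<beta>) y = 0 \<and> quad (pencil M1 M2 \<gamma> \<delta>) y = 0"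
    and e: "a *s (pencil M1 M2 \<alpha> \<beta> *v y) + b *s (pencil M1 M2 \<gamma> \<delta> *v y) = 0"
  have "quad M1 y = 0 \<and> quad M2 y = 0"
    by (rule pencil_unique [OF d]) (use y in \<open>simp_all add: quad_def bil_pencil\<close>)
  moreover have "(\<alpha> * a + \<gamma> * b) *s (M1 *v y) + (\<beta> * a + \<delta> * b) *s (M2 *v y) = 0"
    using e unfolding pencil_mult by (simp add: vec_eq_iff algebra_simps)
  ultimately have "\<alpha> * a + \<gamma> * b = 0 \<and> \<beta> * a + \<delta> * b = 0"
    using dp y unfolding del_pezzo_4_def by blast
  then show "a = 0" "b = 0" using pencil_unique [of \<alpha> \<delta> \<gamma> \<beta> a b] d by (simp_all add: mult.commute)
qed

lemma jac_pencil:
  "jac (pencil M1 M2 \<alpha> \<beta>) (pencil M1 M2 \<gamma> \<delta>) y m n = (\<alpha> * \<delta> - \<beta> * \<gamma>) * jac M1 M2 y m n"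
  by (simp add: jac_def bil_pencil algebra_simps)

lemma jac_deriv_pencil:
  "jac_deriv (pencil M1 M2 \<alpha> \<beta>) (pencil M1 M2 \<gamma> \<delta>) y m n a = (\<alpha> * \<delta> - \<beta> * \<gamma>) * jac_deriv M1 M2 y m n a"
  by (simp add: jac_deriv_def bil_pencil algebra_simps)

text \<open>The quadrics enter \<open>curv\<close> through the quotient of \<open>jac_deriv\<close>
  by \<open>jac\<close>, where the determinant of the base change cancels. The basis of the pencil
  can thus be adapted to \<open>w\<close>.\<close>

lemma curv_pencil:
  assumes "\<alpha> * \<delta> - \<beta> * \<gamma> \<noteq> 0"
  shows "curv (pencil M1 M2 \<alpha> \<beta>) (pencil M1 M2 \<gamma> \<delta>) = curv M1 M2"
proof (intro ext)
  fix y w m n a a' b b'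
  let ?d = "\<alpha> * \<delta> - \<beta> * \<gamma>"
  have "(x * (?d * p) - z * (?d * q)) / (?d * j) = (x * p - z * q) / j" for x z p q j
  proof -
    have "x * (?d * p) - z * (?d * q) = ?d * (x * p - z * q)" by (simp add: algebra_simps)
    then show ?thesis using assms by simp
  qed
  then show "curv (pencil M1 M2 \<alpha> \<beta>) (pencil M1 M2 \<gamma> \<delta>) y w m n a a' b b' = curv M1 M2 y w m n a a' b b'"
    by (simp add: curv_def jac_pencil jac_deriv_pencil)
qed

lemma inf_level_pencil:
  "inf_level M1 M2 y w a a' \<Longrightarrow> inf_level (pencil M1 M2 \<alpha> \<beta>) (pencil M1 M2 \<gamma> \<delta>) y w a a'"
proof -
  have "\<alpha> * p + \<beta> * q + (\<alpha> * p' + \<beta> * q') = \<alpha> * (p + p') + \<beta> * (q + q')" for \<alpha> \<beta> p q p' q' :: complex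
    by (simp add: algebra_simps)
  then show "inf_level M1 M2 y w a a' \<Longrightarrow> ?thesis"
    unfolding inf_level_def by (simp add: bil_pencil)
qed

context dp_vector
begin

lemma dp_vector_pencil:
  assumes "\<alpha> * \<delta> - \<beta> * \<gamma> \<noteq> 0"
  shows "dp_vector (pencil M1 M2 \<alpha> \<beta>) (pencil M1 M2 \<gamma> \<delta>) y w"
proof
  show "del_pezzo_4 (pencil M1 M2 \<alpha> \<beta>) (pencil M1 M2 \<gamma> \<delta>)" by (rule del_pezzo_4_pencil [OF dp assms])
qed (use y_nz indep in \<open>simp_all add: quad_def tangent_def bil_pencil\<close>)

lemma curv_eq_0:
  assumes ns: "\<And>\<alpha> \<beta> t. pencil M1 M2 \<alpha> \<beta> *v (w + t *s y) = 0 \<Longrightarrow> \<alpha> = 0 \<and> \<beta> = 0"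
  obtains m n where "jac M1 M2 y m n \<noteq> 0"
    "\<And>a a' b b'. inf_level M1 M2 y w a a' \<Longrightarrow> inf_level M1 M2 y w b b' \<Longrightarrow> curv M1 M2 y w m n a a' b b' = 0"
proof (cases "bil M1 w w = 0 \<and> bil M2 w w = 0")
  case True
  then have q: "bil M1 w w = 0" "bil M2 w w = 0" by simp_all
  obtain \<alpha> \<beta> \<gamma> \<delta> where d: "\<alpha> * \<delta> \<noteq> \<beta> * \<gamma>" and
    0: "\<alpha> *s (M1 *v y) + \<beta> *s (M2 *v y) + \<gamma> *s (M1 *v w) + \<delta> *s (M2 *v w) = 0"
    by (rule line_relation [OF q])
  \<comment> \<open>The signs bring the relation into the shape \<open>M1 y = M2 w\<close> of
    \<open>curv_line\<close>.\<close>
  have d': "\<alpha> * (- \<delta>) - \<beta> * (- \<gamma>) \<noteq> 0" using d by simp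
  interpret P: dp_vector "pencil M1 M2 \<alpha> \<beta>" "pencil M1 M2 (- \<gamma>) (- \<delta>)" y w
    by (rule dp_vector_pencil [OF d'])
  have eq: "pencil M1 M2 \<alpha> \<beta> *v y = pencil M1 M2 (- \<gamma>) (- \<delta>) *v w"
  proof -
    have "\<alpha> *s (M1 *v y) + \<beta> *s (M2 *v y) + (\<gamma> *s (M1 *v w) + \<delta> *s (M2 *v w)) = 0"
      using 0 by (simp only: add.assoc)
    then have "\<alpha> *s (M1 *v y) + \<beta> *s (M2 *v y) = - (\<gamma> *s (M1 *v w) + \<delta> *s (M2 *v w))"
      by (simp only: eq_neg_iff_add_eq_0)
    then show ?thesis unfolding pencil_mult by simp
  qed
  obtain m n where J: "jac M1 M2 y m n \<noteq> 0" by (rule jac_exists)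
  then have J': "jac (pencil M1 M2 \<alpha> \<beta>) (pencil M1 M2 (- \<gamma>) (- \<delta>)) y m n \<noteq> 0"
    using d' by (simp add: jac_pencil)
  show ?thesis
    using P.curv_line [OF _ _ eq J' inf_level_pencil inf_level_pencil] q
    by (intro that [OF J]) (simp add: curv_pencil [OF d'] bil_pencil)
next
  case False
  define e f where "e = bil M1 w w" and "f = bil M2 w w"
  \<comment> \<open>The member \<open>f M1 - e M2\<close> vanishes at \<open>w\<close>; it is
    completed to a basis by \<open>M1\<close> or \<open>M2\<close>, whichever does not vanish
    there.\<close>
  define \<gamma> \<delta> where "\<gamma> = (if e = 0 then 0 else 1 :: complex)" and "\<delta> = (if e = 0 then 1 else 0 :: complex)"
  have d: "f * \<delta> - (- e) * \<gamma> \<noteq> 0" using False by (auto simp: \<gamma>_def \<delta>_def e_def f_def)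
  interpret P: dp_vector "pencil M1 M2 f (- e)" "pencil M1 M2 \<gamma> \<delta>" y w
    by (rule dp_vector_pencil [OF d])
  have w1: "bil (pencil M1 M2 f (- e)) w w = 0" by (simp add: bil_pencil e_def f_def)
  have w2: "bil (pencil M1 M2 \<gamma> \<delta>) w w \<noteq> 0"
    using False by (auto simp: bil_pencil \<gamma>_def \<delta>_def e_def f_def)
  have ns': "pencil M1 M2 f (- e) *v (w + t *s y) \<noteq> 0" for t
    using ns [of f "- e" t] False by (auto simp: e_def f_def)
  show ?thesis
  proof (cases "\<exists>\<alpha> \<beta>. pencil M1 M2 f (- e) *v w = \<alpha> *s (pencil M1 M2 f (- e) *v y) + \<beta> *s (pencil M1 M2 \<gamma> \<delta> *v y)")
    case True
    then obtain \<alpha> \<beta> where rel: "pencil M1 M2 f (- e) *v w = \<alpha> *s (pencil M1 M2 f (- e) *v y) + \<beta> *s (pencil M1 M2 \<gamma> \<delta> *v y)"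
      by blast
    obtain m n where J: "jac M1 M2 y m n \<noteq> 0" by (rule jac_exists)
    then have J': "jac (pencil M1 M2 f (- e)) (pencil M1 M2 \<gamma> \<delta>) y m n \<noteq> 0"
      using d by (simp add: jac_pencil)
    show ?thesis
      using P.curv_focal [OF w1 w2 ns' rel J' inf_level_pencil inf_level_pencil]
      by (intro that [OF J]) (simp add: curv_pencil [OF d])
  next
    case False
    then have nrel: "pencil M1 M2 f (- e) *v w \<noteq> \<alpha> *s (pencil M1 M2 f (- e) *v y) + \<beta> *s (pencil M1 M2 \<gamma> \<delta> *v y)"
      for \<alpha> \<beta> by blast
    obtain m n where "jac (pencil M1 M2 f (- e)) (pencil M1 M2 \<gamma> \<delta>) y m n \<noteq> 0"
      and c: "\<And>a a' b b'. inf_level (pencil M1 M2 f (- e)) (pencil M1 M2 \<gamma> \<delta>) y w a a' \<Longrightarrow>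
        inf_level (pencil M1 M2 f (- e)) (pencil M1 M2 \<gamma> \<delta>) y w b b' \<Longrightarrow>
        curv (pencil M1 M2 f (- e)) (pencil M1 M2 \<gamma> \<delta>) y w m n a a' b b' = 0"
      by (rule P.curv_generic [OF w1 w2 nrel]) blast
    then have J: "jac M1 M2 y m n \<noteq> 0" by (simp add: jac_pencil)
    show ?thesis
      using c [OF inf_level_pencil inf_level_pencil] by (intro that [OF J]) (simp add: curv_pencil [OF d])
  qed
qed

end

section \<open>Residue form and covectors\<close>

lemma span_singleton: "v \<in> vec.span {y :: complex^5} \<longleftrightarrow> (\<exists>t. v = t *s y)"
  by (auto simp: vec.span_singleton)

context dp_point
begin

text \<open>By \<open>det5_jac\<close> a single pair \<open>m\<close>, \<open>n\<close> with nonzero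
  \<open>jac\<close> decides the defining identity for all pairs.\<close>

lemma residue_form_eqI:
  assumes T: "tangent M1 M2 y u" "tangent M1 M2 y v"
    and J: "jac M1 M2 y m n \<noteq> 0" and c: "det5 y u v m n = c * (4 * jac M1 M2 y m n)"
  shows "residue_form M1 M2 y u v = c"
  unfolding residue_form_def
proof (rule the_equality)
  have 4: "(2 * bil M1 y m) * (2 * bil M2 y n) - (2 * bil M1 y n) * (2 * bil M2 y m) = 4 * jac M1 M2 y m n" for m n
    by (simp add: jac_def algebra_simps)
  show "\<forall>m n. det5 y u v m n = c * (2 * bil M1 y m * (2 * bil M2 y n) - 2 * bil M1 y n * (2 * bil M2 y m))"
  proof (intro allI)
    fix m' n'
    have "det5 y u v m' n' * jac M1 M2 y m n = c * (4 * jac M1 M2 y m n) * jac M1 M2 y m' n'"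
      using det5_jac [OF tangent_y T, of m' n' m n] unfolding c by simp
    then show "det5 y u v m' n' = c * (2 * bil M1 y m' * (2 * bil M2 y n') - 2 * bil M1 y n' * (2 * bil M2 y m'))"
      unfolding 4 using J by simp
  qed
  fix c' assume "\<forall>m n. det5 y u v m n = c' * (2 * bil M1 y m * (2 * bil M2 y n) - 2 * bil M1 y n * (2 * bil M2 y m))"
  then have "c' * (4 * jac M1 M2 y m n) = c * (4 * jac M1 M2 y m n)" using c unfolding 4 by metis
  then show "c' = c" using J by simp
qed

lemma residue_form:
  assumes T: "tangent M1 M2 y u" "tangent M1 M2 y v"
  shows "det5 y u v m n = residue_form M1 M2 y u v * (4 * jac M1 M2 y m n)"
proof -
  obtain m' n' where J: "jac M1 M2 y m' n' \<noteq> 0" by (rule jac_exists)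
  have "residue_form M1 M2 y u v = det5 y u v m' n' / (4 * jac M1 M2 y m' n')"
    by (rule residue_form_eqI [OF T J]) (use J in simp)
  then have r: "det5 y u v m' n' = residue_form M1 M2 y u v * (4 * jac M1 M2 y m' n')" using J by simp
  have "det5 y u v m n * jac M1 M2 y m' n' = residue_form M1 M2 y u v * (4 * jac M1 M2 y m n) * jac M1 M2 y m' n'"
    unfolding det5_jac [OF tangent_y T, of m n m' n'] r by simp
  then show ?thesis using J by simp
qed

lemma residue_form_lin:
  assumes "tangent M1 M2 y u" "tangent M1 M2 y v" "tangent M1 M2 y w"
  shows "residue_form M1 M2 y u (a *s v + b *s w) = a * residue_form M1 M2 y u v + b * residue_form M1 M2 y u w"
    and "residue_form M1 M2 y (a *s v + b *s w) u = a * residue_form M1 M2 y v u + b * residue_form M1 M2 y w u"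
proof -
  obtain m n where J: "jac M1 M2 y m n \<noteq> 0" by (rule jac_exists)
  note r = residue_form [of _ _ m n]
  show "residue_form M1 M2 y u (a *s v + b *s w) = a * residue_form M1 M2 y u v + b * residue_form M1 M2 y u w"
    by (rule residue_form_eqI [OF _ _ J])
      (use assms in \<open>simp_all add: tangent_lin det5_lin r algebra_simps\<close>)
  show "residue_form M1 M2 y (a *s v + b *s w) u = a * residue_form M1 M2 y v u + b * residue_form M1 M2 y w u"
    by (rule residue_form_eqI [OF _ _ J])
      (use assms in \<open>simp_all add: tangent_lin det5_lin r algebra_simps\<close>)
qed

lemma residue_form_swap:
  assumes "tangent M1 M2 y u" "tangent M1 M2 y v"
  shows "residue_form M1 M2 y u v = - residue_form M1 M2 y v u"
proof -
  obtain m n where J: "jac M1 M2 y m n \<noteq> 0" by (rule jac_exists)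
  show ?thesis
    by (rule residue_form_eqI [OF assms J]) (use assms residue_form [of v u m n] det5_swap(3) [of y u v m n] in simp)
qed

lemma residue_form_self:
  assumes "tangent M1 M2 y u"
  shows "residue_form M1 M2 y u u = 0" "residue_form M1 M2 y u y = 0"
proof -
  obtain m n where J: "jac M1 M2 y m n \<noteq> 0" by (rule jac_exists)
  show "residue_form M1 M2 y u u = 0" "residue_form M1 M2 y u y = 0"
    by (rule residue_form_eqI [OF _ _ J]; use assms tangent_y in simp)+
qed

lemma dp_point_scale: "t \<noteq> 0 \<Longrightarrow> dp_point M1 M2 (t *s y)"
  by standard (use dp y_nz in \<open>auto simp: quad_def bil_lin\<close>)

lemma tangent_scale: "t \<noteq> 0 \<Longrightarrow> tangent M1 M2 (t *s y) v \<longleftrightarrow> tangent M1 M2 y v"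
  by (simp add: tangent_def bil_lin)

text \<open>The determinant has degree 1 in \<open>y\<close>, and \<open>jac\<close> has degree
  2.\<close>

lemma residue_form_scale:
  assumes T: "tangent M1 M2 y u" "tangent M1 M2 y v" and t: "t \<noteq> 0"
  shows "residue_form M1 M2 (t *s y) u v = residue_form M1 M2 y u v / t"
proof -
  interpret P: dp_point M1 M2 "t *s y" by (rule dp_point_scale [OF t])
  obtain m n where J: "jac M1 M2 y m n \<noteq> 0" by (rule jac_exists)
  have j: "jac M1 M2 (t *s y) m n = t\<^sup>2 * jac M1 M2 y m n"
    by (simp add: jac_def bil_lin algebra_simps power2_eq_square)
  show ?thesis
    by (rule P.residue_form_eqI [of _ _ m n])
      (use t T J residue_form [OF T, of m n] in \<open>simp_all add: tangent_scale j det5_lin power2_eq_square\<close>)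
qed

lemma tangent_cone_span: "tangent_cone M1 M2 (vec.span {y}) = {v. tangent M1 M2 y v}"
proof -
  have "(\<forall>y'\<in>vec.span {y}. bil M1 y' v = 0 \<and> bil M2 y' v = 0) \<longleftrightarrow> tangent M1 M2 y v" for v
    using vec.span_base [of y "{y}"] by (auto simp: tangent_def span_singleton bil_lin)
  then show ?thesis unfolding tangent_cone_def by simp
qed

lemma span_minus_0: "y' \<in> vec.span {y} - {0} \<longleftrightarrow> (\<exists>t. t \<noteq> 0 \<and> y' = t *s y)"
  using y_nz by (auto simp: span_singleton)

end

section \<open>Covectors in a frame of the tangent cone\<close>

locale dp_frame = dp_point +
  fixes p q
  assumes p: "tangent M1 M2 y p" and q: "tangent M1 M2 y q"
    and frame_indep: "\<alpha> *s y + \<beta> *s p + \<gamma> *s q = 0 \<Longrightarrow> \<alpha> = 0 \<and> \<beta> = 0 \<and> \<gamma> = 0"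
begin

lemma residue_form_nz: "residue_form M1 M2 y p q \<noteq> 0"
proof
  assume 0: "residue_form M1 M2 y p q = 0"
  obtain m n where J: "jac M1 M2 y m n \<noteq> 0" by (rule jac_exists)
  have "det5 y p q m n = 0" unfolding residue_form [OF p q] 0 by simp
  from det5_tangent_dependent [OF tangent_y p q J this] show False using frame_indep by metis
qed

lemma frame_span:
  assumes v: "tangent M1 M2 y v"
  obtains a b c where "v = a *s y + b *s p + c *s q"
proof -
  obtain m n where J: "jac M1 M2 y m n \<noteq> 0" by (rule jac_exists)
  have "det5 y p q v n = 0" by (rule det5_tangent [OF tangent_y p q v])
  then obtain \<alpha> \<beta> \<gamma> \<delta> \<epsilon> where nz: "\<not> (\<alpha> = 0 \<and> \<beta> = 0 \<and> \<gamma> = 0 \<and> \<delta> = 0 \<and> \<epsilon> = 0)"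
    and 0: "\<alpha> *s y + \<beta> *s p + \<gamma> *s q + \<delta> *s v + \<epsilon> *s n = 0" by (rule det5_dependent)
  have "bil M1 y (\<alpha> *s y + \<beta> *s p + \<gamma> *s q + \<delta> *s v + \<epsilon> *s n) = 0"
    "bil M2 y (\<alpha> *s y + \<beta> *s p + \<gamma> *s q + \<delta> *s v + \<epsilon> *s n) = 0" unfolding 0 by simp_all
  then have "\<epsilon> = 0" using p q v J by (auto simp: bil_lin tangent_def jac_def)
  then have 0: "(\<alpha> *s y + \<beta> *s p + \<gamma> *s q) + \<delta> *s v = 0" using 0 by simp
  then have "\<delta> \<noteq> 0" using frame_indep [of \<alpha> \<beta> \<gamma>] nz \<open>\<epsilon> = 0\<close> by auto
  have "\<delta> *s v = - (\<alpha> *s y + \<beta> *s p + \<gamma> *s q)" using minus_unique [OF 0] by simp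
  then have "v = (- \<alpha> / \<delta>) *s y + (- \<beta> / \<delta>) *s p + (- \<gamma> / \<delta>) *s q"
    using \<open>\<delta> \<noteq> 0\<close> by (simp add: vec_eq_iff field_simps)
  then show ?thesis by (rule that)
qed

text \<open>The vector of the tangent cone corresponding to the covector with values \<open>a\<close>, \<open>b\<close> on \<open>p\<close>, \<open>q\<close>.\<close>

definition dual :: "complex \<Rightarrow> complex \<Rightarrow> complex^5"
  where "dual a b = (b / residue_form M1 M2 y p q) *s p + (- a / residue_form M1 M2 y p q) *s q"

lemma tangent_dual_vector: "tangent M1 M2 y (dual a b)"
  unfolding dual_def by (rule tangent_lin(1) [OF p q])

lemma residue_form_dual:
  "residue_form M1 M2 y (dual a b) p = a" "residue_form M1 M2 y (dual a b) q = b"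
  unfolding dual_def residue_form_lin(2) [OF p p q] residue_form_lin(2) [OF q p q]
    residue_form_self(1) [OF p] residue_form_self(1) [OF q] residue_form_swap [OF q p]
  using residue_form_nz by simp_all

definition covec :: "complex \<Rightarrow> complex \<Rightarrow> complex^5 \<Rightarrow> complex^5 \<Rightarrow> complex"
  where "covec a b y' v = (if y' \<in> vec.span {y} - {0} \<and> tangent M1 M2 y v
    then residue_form M1 M2 y' (dual a b) v else 0)"

lemma covec_scale:
  assumes "t \<noteq> 0" "tangent M1 M2 y v"
  shows "covec a b (t *s y) v = residue_form M1 M2 y (dual a b) v / t"
  using assms span_minus_0 [of "t *s y"] residue_form_scale [OF tangent_dual_vector assms(2,1)]
  by (auto simp: covec_def)

lemma covec_y:
  assumes "tangent M1 M2 y v"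
  shows "covec a b y v = residue_form M1 M2 y (dual a b) v"
  using covec_scale [of 1 v a b] assms by simp

lemma covec_in_cotangent_space: "covec a b \<in> cotangent_space M1 M2 (vec.span {y})"
proof -
  have 1: "covec a b y' v = 0" if "y' \<notin> vec.span {y} - {0} \<or> \<not> tangent M1 M2 y v" for y' v
    using that by (auto simp: covec_def)
  have 2: "covec a b (t *s y) (t *s y) = 0" if t: "t \<noteq> 0" for t
    unfolding covec_scale [OF t tangent_lin(2) [OF tangent_y]]
    using residue_form_lin(1) [OF tangent_dual_vector [of a b] tangent_y tangent_y, of t 0]
      residue_form_self(2) [OF tangent_dual_vector [of a b]] by simp
  have 3: "covec a b (t *s y) (c *s u + d *s v) = c * covec a b (t *s y) u + d * covec a b (t *s y) v"
    if "t \<noteq> 0" "tangent M1 M2 y u" "tangent M1 M2 y v" for t u v c d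
    using that by (simp add: covec_scale tangent_lin residue_form_lin tangent_dual_vector add_divide_distrib)
  have 4: "covec a b (s *s (t *s y)) (s *s v) = covec a b (t *s y) v"
    if t: "t \<noteq> 0" and s: "s \<noteq> 0" and T: "tangent M1 M2 y v" for t s v
  proof -
    have "residue_form M1 M2 y (dual a b) (s *s v) = s * residue_form M1 M2 y (dual a b) v"
      using residue_form_lin(1) [OF tangent_dual_vector [of a b] T T, of s 0] by simp
    then show ?thesis
      using covec_scale [of "s * t" "s *s v" a b] covec_scale [OF t T] s t T
      by (simp add: tangent_lin vector_smult_assoc)
  qed
  show ?thesis
    unfolding cotangent_space_def tangent_cone_span mem_Collect_eq
  proof (intro conjI allI ballI)
    fix y' assume "y' \<in> vec.span {y} - {0}"
    then obtain t where t: "t \<noteq> 0" "y' = t *s y" unfolding span_minus_0 by blast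
    show "covec a b y' y' = 0" unfolding t(2) by (rule 2 [OF t(1)])
    show "covec a b y' (c *s u + d *s v) = c * covec a b y' u + d * covec a b y' v"
      if "u \<in> {v. tangent M1 M2 y v}" "v \<in> {v. tangent M1 M2 y v}" for u v c d
      unfolding t(2) using 3 [OF t(1)] that by blast
    show "s \<noteq> 0 \<longrightarrow> covec a b (s *s y') (s *s v) = covec a b y' v"
      if "v \<in> {v. tangent M1 M2 y v}" for v s
      unfolding t(2) using 4 [OF t(1)] that by blast
  qed (use 1 in blast)
qed

text \<open>A covector is linear and vanishes on \<open>y\<close>, so its values on \<open>p\<close>
  and \<open>q\<close> determine it at \<open>y\<close>; homogeneity carries this over to the
  multiples of \<open>y\<close>.\<close>

lemma cotangent_space_unique:
  assumes \<xi>: "\<xi> \<in> cotangent_space M1 M2 (vec.span {y})" and v: "\<xi> y p = a" "\<xi> y q = b"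
  shows "\<xi> = covec a b"
proof (intro ext)
  fix y' v
  have ax: "y' \<notin> vec.span {y} - {0} \<or> \<not> tangent M1 M2 y v \<Longrightarrow> \<xi> y' v = 0"
    "y' \<in> vec.span {y} - {0} \<Longrightarrow> \<xi> y' y' = 0"
    "y' \<in> vec.span {y} - {0} \<Longrightarrow> tangent M1 M2 y u \<Longrightarrow> tangent M1 M2 y v \<Longrightarrow>
      \<xi> y' (c *s u + d *s v) = c * \<xi> y' u + d * \<xi> y' v"
    "y' \<in> vec.span {y} - {0} \<Longrightarrow> tangent M1 M2 y v \<Longrightarrow> t \<noteq> 0 \<Longrightarrow> \<xi> (t *s y') (t *s v) = \<xi> y' v" for y' u v c d t
    using \<xi> unfolding cotangent_space_def tangent_cone_span by blast+
  have y1: "y \<in> vec.span {y} - {0}" using span_minus_0 [of y] by (auto intro: exI [of _ 1])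
  have at_y: "\<xi> y v = residue_form M1 M2 y (dual a b) v" if "tangent M1 M2 y v" for v
  proof -
    obtain r s t where v': "v = r *s y + s *s p + t *s q" using frame_span [OF \<open>tangent M1 M2 y v\<close>] .
    have *: "v = 1 *s (r *s y + s *s p) + t *s q" unfolding v' by simp
    have Ta: "tangent M1 M2 y (r *s y + s *s p)" by (rule tangent_lin(1) [OF tangent_y p])
    show ?thesis unfolding *
      unfolding ax(3) [OF y1 Ta q] ax(3) [OF y1 tangent_y p] residue_form_lin(1) [OF tangent_dual_vector Ta q]
        residue_form_lin(1) [OF tangent_dual_vector tangent_y p]
      by (simp only: ax(2) [OF y1] v residue_form_dual residue_form_self(2) [OF tangent_dual_vector])
  qed
  show "\<xi> y' v = covec a b y' v"
  proof (cases "y' \<in> vec.span {y} - {0} \<and> tangent M1 M2 y v")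
    case False
    then show ?thesis using ax(1) by (auto simp: covec_def)
  next
    case True
    then obtain t where t: "t \<noteq> 0" "y' = t *s y" unfolding span_minus_0 by blast
    have T: "tangent M1 M2 y ((1 / t) *s v)" using True tangent_lin by blast
    have "\<xi> (t *s y) (t *s ((1 / t) *s v)) = \<xi> y ((1 / t) *s v)"
      by (rule ax(4) [OF y1 T t(1)])
    also have "t *s ((1 / t) *s v) = v" using t(1) by (simp add: vector_smult_assoc)
    also have "\<xi> y ((1 / t) *s v) = \<xi> y v / t"
      using ax(3) [OF y1, of v v "1 / t" 0] True by simp
    finally show ?thesis unfolding t(2) using True t(1) by (simp add: at_y covec_scale)
  qed
qed

text \<open>Another vector representing the covector differs from \<open>dual a b\<close> by an
  element of the radical of \<open>residue_form\<close>, that is, by a multiple of \<open>y\<close>,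
  and this does not change \<open>quad M\<close> on the cone. Rescaling \<open>y\<close> multiplies
  both residues by the same factor.\<close>

lemma sym2_section_covec:
  assumes M: "M = M1 \<or> M = M2"
  shows "sym2_section M1 M2 M (vec.span {y}, covec a b) = quad M (dual a b)"
  unfolding sym2_section_def prod.case tangent_cone_span
proof (rule the_equality)
  have "y \<in> vec.span {y} - {0}" using span_minus_0 [of y] by (auto intro: exI [of _ 1])
  then show "\<exists>y'\<in>vec.span {y} - {0}. \<exists>w\<in>{v. tangent M1 M2 y v}.
    (\<forall>u\<in>{v. tangent M1 M2 y v}. covec a b y' u = residue_form M1 M2 y' w u) \<and> quad M (dual a b) = quad M w"
    using tangent_dual_vector [of a b] by (intro bexI [of _ y] bexI [of _ "dual a b"]) (auto simp: covec_y)
next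
  fix c assume "\<exists>y'\<in>vec.span {y} - {0}. \<exists>w\<in>{v. tangent M1 M2 y v}.
    (\<forall>u\<in>{v. tangent M1 M2 y v}. covec a b y' u = residue_form M1 M2 y' w u) \<and> c = quad M w"
  then obtain y' w where "y' \<in> vec.span {y} - {0}" and w: "tangent M1 M2 y w" "c = quad M w"
    and r: "\<And>u. tangent M1 M2 y u \<Longrightarrow> covec a b y' u = residue_form M1 M2 y' w u"
    by blast
  then obtain t where t: "t \<noteq> 0" "y' = t *s y" unfolding span_minus_0 by blast
  have r': "residue_form M1 M2 y (dual a b) u = residue_form M1 M2 y w u" if "tangent M1 M2 y u" for u
    using r [OF that] t(1) unfolding t(2) by (simp add: covec_scale residue_form_scale that w(1))
  have T: "tangent M1 M2 y (w - dual a b)" by (rule tangent_lin(4) [OF w(1) tangent_dual_vector])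
  obtain r s k where e: "w - dual a b = r *s y + s *s p + k *s q" using frame_span [OF T] .
  have z: "residue_form M1 M2 y (w - dual a b) u = 0" if "tangent M1 M2 y u" for u
    using residue_form_lin(2) [OF that w(1) tangent_dual_vector, of 1 "-1" a b] r' [OF that] by simp
  have R: "residue_form M1 M2 y (1 *s (r *s y + s *s p) + k *s q) u =
      r * residue_form M1 M2 y y u + s * residue_form M1 M2 y p u + k * residue_form M1 M2 y q u"
    if "tangent M1 M2 y u" for u
    unfolding residue_form_lin(2) [OF that tangent_lin(1) [OF tangent_y p] q]
      residue_form_lin(2) [OF that tangent_y p] by simp
  have y0: "residue_form M1 M2 y y u = 0" if "tangent M1 M2 y u" for u
    using residue_form_self(2) [OF that] residue_form_swap [OF that tangent_y] by simp
  have "k = 0" "s = 0"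
    using z [OF p] z [OF q] R [OF p] R [OF q] residue_form_nz residue_form_swap [OF q p]
    unfolding e by (simp_all add: y0 p q residue_form_self)
  then have "w = dual a b + r *s y" using e by (simp add: algebra_simps)
  moreover have "bil M y (dual a b) = 0" "bil M (dual a b) y = 0" "bil M y y = 0"
    using M tangent_dual_vector [of a b] sym [of "dual a b" y] by (auto simp: tangent_def)
  ultimately show "c = quad M (dual a b)" unfolding w(2) by (simp add: quad_def bil_lin)
qed

lemma the_covec:
  "(THE \<xi>. \<xi> \<in> cotangent_space M1 M2 (vec.span {y}) \<and> \<xi> y p = a \<and> \<xi> y q = b) = covec a b"
proof (rule the_equality)
  show "covec a b \<in> cotangent_space M1 M2 (vec.span {y}) \<and> covec a b y p = a \<and> covec a b y q = b"
    using covec_in_cotangent_space by (simp add: covec_y p q residue_form_dual)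
qed (use cotangent_space_unique in blast)

end

section \<open>Holomorphic curves and maps\<close>

text \<open>Taylor's formula, with the second derivative bounded by Cauchy's estimate on circles of
  radius \<open>r / 3\<close> about points of the ball of radius \<open>r / 3\<close>; the constant
  is \<open>2 B / (r / 3)\<^sup>2\<close>.\<close>

lemma second_order_bound:
  assumes r: "0 < r" and f: "f holomorphic_on ball 0 r" and B: "\<And>z. z \<in> ball 0 r \<Longrightarrow> cmod (f z) \<le> B"
    and z: "cmod z < r / 3"
  shows "cmod (f z - f 0 - deriv f 0 * z) \<le> 18 * B / r\<^sup>2 * (cmod z)\<^sup>2"
proof -
  have "cmod (f z - (\<Sum>i\<le>1. (deriv ^^ i) f 0 * (z - 0) ^ i / fact i)) \<le> 18 * B / r\<^sup>2 * cmod (z - 0) ^ Suc 1 / fact 1"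
  proof (rule complex_Taylor [of "ball 0 (r / 3)" 1 "\<lambda>i. (deriv ^^ i) f", simplified funpow_0])
    fix i and x :: complex assume x: "x \<in> ball 0 (r / 3)"
    have "x \<in> ball 0 r" using x r by auto
    have "((deriv ^^ i) f) holomorphic_on ball 0 r" by (intro holomorphic_higher_deriv f) auto
    then have "((deriv ^^ i) f has_field_derivative deriv ((deriv ^^ i) f) x) (at x)"
      using \<open>x \<in> ball 0 r\<close> by (auto intro: holomorphic_derivI)
    then show "((deriv ^^ i) f has_field_derivative (deriv ^^ Suc i) f x) (at x within ball 0 (r / 3))"
      using has_field_derivative_at_within by auto
  next
    fix x assume x: "x \<in> ball (0::complex) (r / 3)"
    have sub: "cball x (r / 3) \<subseteq> ball 0 r"
    proof
      fix z assume "z \<in> cball x (r / 3)"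
      moreover have "cmod z \<le> cmod x + cmod (x - z)" by (metis norm_minus_commute norm_triangle_sub)
      ultimately show "z \<in> ball 0 r" using x r by (simp add: dist_norm)
    qed
    have "cmod ((deriv ^^ 2) f x) \<le> fact 2 * B / (r / 3) ^ 2"
    proof (rule Cauchy_inequality)
      show "f holomorphic_on ball x (r / 3)" "continuous_on (cball x (r / 3)) f"
        using sub f by (auto intro: holomorphic_on_subset holomorphic_on_imp_continuous_on
            dest: subsetD [OF ball_subset_cball])
      show "cmod (f w) \<le> B" if "cmod (x - w) = r / 3" for w
        using that sub by (intro B) (auto simp: dist_norm)
    qed (use r in auto)
    then show "cmod ((deriv ^^ Suc 1) f x) \<le> 18 * B / r\<^sup>2"
      using r by (simp add: numeral_2_eq_2 power2_eq_square field_simps)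
  qed (use r z in auto)
  then show ?thesis by (simp add: power2_eq_square mult.assoc algebra_simps)
qed

text \<open>The difference quotients in \<open>y\<close> at 0 converge uniformly in \<open>x\<close>
  by \<open>second_order_bound\<close>, so by Weierstrass their \<open>x\<close>-derivatives
  converge too. These are the difference quotients of the \<open>x\<close>-derivative of
  \<open>g\<close>. Existence and symmetry of the mixed derivative thus come together.\<close>

lemma mixed_derivatives:
  fixes g :: "complex \<Rightarrow> complex \<Rightarrow> complex"
  assumes r: "0 < r" and cont: "continuous_on (ball 0 r \<times> ball 0 r) (\<lambda>p. g (fst p) (snd p))"
    and h1: "\<And>y. y \<in> ball 0 r \<Longrightarrow> (\<lambda>x. g x y) holomorphic_on ball 0 r"
    and h2: "\<And>x. x \<in> ball 0 r \<Longrightarrow> g x holomorphic_on ball 0 r"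
  obtains c where "((\<lambda>x. deriv (g x) 0) has_field_derivative c) (at 0)"
    "((\<lambda>y. deriv (\<lambda>x. g x y) 0) has_field_derivative c) (at 0)"
proof -
  define R where "R = r / 2"
  have R: "0 < R" "cball (0::complex) R \<subseteq> ball 0 r" using r by (auto simp: R_def)
  have "compact (cball 0 R \<times> cball (0::complex) R :: (complex \<times> complex) set)" by (intro compact_Times compact_cball)
  moreover have "continuous_on (cball 0 R \<times> cball 0 R) (\<lambda>p. g (fst p) (snd p))"
    by (rule continuous_on_subset [OF cont]) (use R in blast)
  ultimately have "bounded ((\<lambda>p. g (fst p) (snd p)) ` (cball 0 R \<times> cball 0 R))"
    by (intro compact_imp_bounded compact_continuous_image)
  then obtain B where B': "\<forall>z\<in>(\<lambda>p. g (fst p) (snd p)) ` (cball 0 R \<times> cball 0 R). cmod z \<le> B"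
    unfolding bounded_iff by blast
  have B: "cmod (g x y) \<le> B" if "x \<in> cball 0 R" "y \<in> cball 0 R" for x y
    using bspec [OF B' imageI [of "(x, y)"]] that by simp
  have "0 \<le> B" by (rule order.trans [OF norm_ge_zero B [of 0 0]]) (use R in auto)
  have ball_R: "ball (0::complex) R \<subseteq> ball 0 r" using R(2) ball_subset_cball by blast
  define h where "h = (\<lambda>y x. (g x y - g x 0) / y)"
  have lim: "uniform_limit (cball 0 R) h (\<lambda>x. deriv (g x) 0) (at 0)"
  proof (rule uniform_limitI)
    fix e :: real assume e: "0 < e"
    define C where "C = 18 * B / R\<^sup>2"
    have C: "C \<ge> 0" using \<open>0 \<le> B\<close> by (simp add: C_def)
    \<comment> \<open>\<open>C + 1\<close> rather than \<open>C\<close> in the denominator, because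
      \<open>C\<close> may be 0.\<close>
    have ev: "\<forall>\<^sub>F y in at (0::complex). 0 < cmod y \<and> cmod y < min (R / 3) (e / (C + 1))"
      unfolding eventually_at using R e C by (intro exI [of _ "min (R / 3) (e / (C + 1))"]) auto
    show "\<forall>\<^sub>F y in at 0. \<forall>x\<in>cball 0 R. dist (h y x) (deriv (g x) 0) < e"
    proof (rule eventually_mono [OF ev], intro ballI)
      fix x y :: complex assume y: "0 < cmod y \<and> cmod y < min (R / 3) (e / (C + 1))" and x: "x \<in> cball 0 R"
      have "cmod (g x y - g x 0 - deriv (g x) 0 * y) \<le> C * (cmod y)\<^sup>2"
        unfolding C_def
      proof (rule second_order_bound [OF R(1)])
        show "g x holomorphic_on ball 0 R"
          by (rule holomorphic_on_subset [OF h2 ball_R]) (use x R in blast)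
        show "cmod (g x z) \<le> B" if "z \<in> ball 0 R" for z using B x that by auto
      qed (use y in auto)
      moreover have "h y x - deriv (g x) 0 = (g x y - g x 0 - deriv (g x) 0 * y) / y"
        using y by (auto simp: h_def field_simps)
      ultimately have "cmod (h y x - deriv (g x) 0) \<le> C * cmod y"
        using y by (auto simp: norm_divide divide_le_eq power2_eq_square mult.assoc)
      also have "\<dots> \<le> (C + 1) * cmod y" using y by (intro mult_right_mono) auto
      also have "\<dots> < e" using y C by (auto simp: field_simps)
      finally show "dist (h y x) (deriv (g x) 0) < e" by (simp add: dist_norm)
    qed
  qed
  define f' where "f' = (\<lambda>y w. (deriv (\<lambda>x. g x y) w - deriv (\<lambda>x. g x 0) w) / y)"
  have ev: "\<forall>\<^sub>F y in at 0. continuous_on (cball 0 R) (h y) \<and>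
      (\<forall>w\<in>ball 0 R. (h y has_field_derivative f' y w) (at w))"
  proof -
    have "\<forall>\<^sub>F y in at (0::complex). y \<noteq> 0 \<and> y \<in> ball 0 r"
      unfolding eventually_at using r by (intro exI [of _ r]) auto
    then show ?thesis
    proof (rule eventually_mono)
      fix y :: complex assume y: "y \<noteq> 0 \<and> y \<in> ball 0 r"
      then have hol: "(\<lambda>x. g x y) holomorphic_on ball 0 r" "(\<lambda>x. g x 0) holomorphic_on ball 0 r"
        using h1 r by auto
      have "h y holomorphic_on ball 0 r"
        unfolding h_def using y by (intro holomorphic_intros hol) auto
      then have "continuous_on (cball 0 R) (h y)"
        by (rule continuous_on_subset [OF holomorphic_on_imp_continuous_on R(2)])
      moreover have "(h y has_field_derivative f' y w) (at w)" if "w \<in> ball 0 R" for w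
      proof -
        have "w \<in> ball 0 r" using that ball_R by blast
        then show ?thesis
          unfolding h_def f'_def using hol y
          by (intro DERIV_cdivide DERIV_diff holomorphic_derivI [of _ "ball 0 r"]) auto
      qed
      ultimately show "continuous_on (cball 0 R) (h y) \<and> (\<forall>w\<in>ball 0 R. (h y has_field_derivative f' y w) (at w))"
        by blast
    qed
  qed
  obtain g' where g': "\<And>w. w \<in> ball 0 R \<Longrightarrow>
      ((\<lambda>x. deriv (g x) 0) has_field_derivative g' w) (at w) \<and> ((\<lambda>y. f' y w) \<longlongrightarrow> g' w) (at 0)"
    by (rule has_complex_derivative_uniform_limit [OF ev lim _ R(1)]) (auto simp: trivial_limit_at)
  show ?thesis
    by (rule that [of "g' 0"]) (use g' [of 0] R in \<open>simp_all add: DERIV_def f'_def\<close>)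
qed

section \<open>Velocities of holomorphic curves\<close>

definition has_velocity :: "(complex \<Rightarrow> complex^'n) \<Rightarrow> complex^'n \<Rightarrow> complex \<Rightarrow> bool"
  where "has_velocity c v t \<longleftrightarrow> (\<forall>i. ((\<lambda>t. c t $ i) has_field_derivative v $ i) (at t))"

lemma has_derivative_vec:
  fixes f :: "'a::real_normed_vector \<Rightarrow> complex^'n"
  assumes "\<And>i. ((\<lambda>x. f x $ i) has_derivative (\<lambda>h. f' h $ i)) (at a)"
  shows "(f has_derivative f') (at a)"
  unfolding has_derivative_componentwise_within [of f f' a UNIV]
proof
  fix b :: "complex^'n" assume "b \<in> Basis"
  then obtain i k where b: "b = axis i k" unfolding Basis_vec_def by auto
  show "((\<lambda>x. f x \<bullet> b) has_derivative (\<lambda>x. f' x \<bullet> b)) (at a)"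
    unfolding b inner_axis using assms by (intro has_derivative_inner_left)
qed

lemma has_velocity_has_derivative:
  assumes "has_velocity c v t"
  shows "(c has_derivative (\<lambda>h. h *s v)) (at t)"
  using assms unfolding has_velocity_def has_field_derivative_def
  by (intro has_derivative_vec) (simp add: mult_commute_abs)

lemma has_velocity_isCont: "has_velocity c v t \<Longrightarrow> isCont c t"
  using has_derivative_continuous has_velocity_has_derivative by blast

lemma has_velocity_unique: "has_velocity c v t \<Longrightarrow> has_velocity c u t \<Longrightarrow> v = u"
  unfolding has_velocity_def vec_eq_iff using DERIV_unique by blast

lemma has_velocity_line: "has_velocity (\<lambda>t. a + t *s v) v t"
  unfolding has_velocity_def by (auto intro!: derivative_eq_intros)

lemma has_velocity_deriv: "has_velocity c v t \<Longrightarrow> deriv (\<lambda>t. c t $ i) t = v $ i"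
  unfolding has_velocity_def by (auto intro: DERIV_imp_deriv)

lemma holomorphic_map_deriv:
  assumes "holomorphic_map f U" "z \<in> U"
  shows "(f has_derivative frechet_derivative f (at z)) (at z)"
    "frechet_derivative f (at z) (c *s v) = c *s frechet_derivative f (at z) v"
  using assms frechet_derivative_at unfolding holomorphic_map_def by metis+

lemma frechet_derivative_partial:
  fixes f :: "complex^2 \<Rightarrow> complex^'m"
  assumes "holomorphic_map f U" "z \<in> U"
  shows "frechet_derivative f (at z) v = v $ 1 *s partial_deriv 1 f z + v $ 2 *s partial_deriv 2 f z"
proof -
  note d = holomorphic_map_deriv [OF assms]
  have "v = v $ 1 *s axis 1 1 + v $ 2 *s axis 2 1"
    by (simp add: vec_eq_iff forall_2 axis_def)
  then have "frechet_derivative f (at z) v = frechet_derivative f (at z) (v $ 1 *s axis 1 1 + v $ 2 *s axis 2 1)"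
    by simp
  also have "\<dots> = frechet_derivative f (at z) (v $ 1 *s axis 1 1) + frechet_derivative f (at z) (v $ 2 *s axis 2 1)"
    using has_derivative_linear [OF d(1)] by (rule linear_add)
  finally show ?thesis unfolding d(2) partial_deriv_def .
qed

lemma has_velocity_compose:
  assumes "holomorphic_map f U" "c t \<in> U" "has_velocity c v t"
  shows "has_velocity (\<lambda>t. f (c t)) (frechet_derivative f (at (c t)) v) t"
proof -
  have "((\<lambda>t. f (c t)) has_derivative (\<lambda>h. frechet_derivative f (at (c t)) (h *s v))) (at t)"
    by (rule has_derivative_compose [OF has_velocity_has_derivative [OF assms(3)] holomorphic_map_deriv(1) [OF assms(1,2)]])
  then have "((\<lambda>t. f (c t) $ i) has_derivative (\<lambda>h. (h *s frechet_derivative f (at (c t)) v) $ i)) (at t)" for i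
    unfolding holomorphic_map_deriv(2) [OF assms(1,2)]
    by (rule bounded_linear.has_derivative [OF bounded_linear_vec_nth])
  then show ?thesis
    unfolding has_velocity_def has_field_derivative_def by (simp add: mult_commute_abs)
qed

lemma holomorphic_map_continuous:
  assumes "holomorphic_map f U" shows "continuous_on U f"
proof (intro continuous_at_imp_continuous_on ballI)
  fix z assume "z \<in> U"
  then show "isCont f z" by (rule has_derivative_continuous [OF holomorphic_map_deriv(1) [OF assms]])
qed

lemma has_velocity_holomorphic:
  assumes "\<And>t. t \<in> S \<Longrightarrow> \<exists>v. has_velocity c v t" "open S"
  shows "(\<lambda>t. c t $ i) holomorphic_on S"
  unfolding holomorphic_on_open [OF assms(2)] using assms(1) has_velocity_def by metis

lemma tangent_space_iff:
  "u \<in> tangent_space A q \<longleftrightarrow> (\<exists>\<gamma> r. 0 < r \<and> \<gamma> ` ball 0 r \<subseteq> A \<and> \<gamma> 0 = q \<and>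
    (\<forall>t\<in>ball 0 r. \<exists>v. has_velocity \<gamma> v t) \<and> has_velocity \<gamma> u 0)" (is "?L \<longleftrightarrow> ?R")
proof
  assume ?L
  then obtain \<gamma> r where r: "0 < r" "\<gamma> ` ball 0 r \<subseteq> A" "\<gamma> 0 = q"
    and h: "\<And>i. (\<lambda>t. \<gamma> t $ i) holomorphic_on ball 0 r" "\<And>i. deriv (\<lambda>t. \<gamma> t $ i) 0 = u $ i"
    unfolding tangent_space_def by auto
  have v: "has_velocity \<gamma> (\<chi> i. deriv (\<lambda>t. \<gamma> t $ i) t) t" if "t \<in> ball 0 r" for t
    unfolding has_velocity_def using holomorphic_derivI [OF h(1) open_ball that] by simp
  moreover have "(\<chi> i. deriv (\<lambda>t. \<gamma> t $ i) 0) = u" using h(2) by (simp add: vec_eq_iff)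
  ultimately show ?R using r by (metis centre_in_ball)
next
  assume ?R
  then obtain \<gamma> r where "0 < r" "\<gamma> ` ball 0 r \<subseteq> A" "\<gamma> 0 = q"
    "\<And>t. t \<in> ball 0 r \<Longrightarrow> \<exists>v. has_velocity \<gamma> v t" "has_velocity \<gamma> u 0" by blast
  then show ?L
    unfolding tangent_space_def using has_velocity_holomorphic [of "ball 0 r" \<gamma>] has_velocity_deriv by blast
qed

text \<open>\<open>holomorphic_map\<close> asks for one complex derivative at each point, so it has
  to be proved that partial derivatives can be differentiated again. The two velocities are the
  mixed derivatives at 0, in both orders, of \<open>f (s x + y *s axis j 1)\<close>.\<close>

lemma partial_deriv_along_curve:
  fixes f :: "complex^2 \<Rightarrow> complex^'m"
  assumes f: "holomorphic_map f U" and r: "0 < r" and s: "s ` ball 0 r \<subseteq> U"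
    and v: "\<And>t. t \<in> ball 0 r \<Longrightarrow> \<exists>v. has_velocity s v t" and u: "has_velocity s u 0"
  obtains c where "has_velocity (\<lambda>t. partial_deriv j f (s t)) c 0"
    "has_velocity (\<lambda>y. frechet_derivative f (at (s 0 + y *s axis j 1)) u) c 0"
proof -
  define \<phi> where "\<phi> = (\<lambda>p. s (fst p) + snd p *s axis j 1)"
  have open_U: "open U" using f by (simp add: holomorphic_map_def)
  have "isCont s t" if "t \<in> ball 0 r" for t using v [OF that] has_velocity_isCont by blast
  then have cs: "continuous_on (ball 0 r) s" by (simp add: continuous_at_imp_continuous_on)
  have c\<phi>: "continuous_on (ball 0 r \<times> UNIV) \<phi>"
    unfolding \<phi>_def
  proof (intro continuous_on_add continuous_on_compose2 [OF cs])
    show "continuous_on (ball 0 r \<times> UNIV) (\<lambda>p. snd p *s axis j (1::complex))"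
      unfolding vector_scalar_mult_def
      by (intro continuous_on_vec_lambda continuous_intros)
  qed (auto intro: continuous_intros)
  have "open (ball 0 r \<times> UNIV \<inter> \<phi> -` U)"
    by (rule continuous_open_preimage [OF c\<phi> _ open_U]) (auto intro: open_Times)
  moreover have "(0, 0) \<in> ball 0 r \<times> UNIV \<inter> \<phi> -` U"
    using r s by (auto simp: \<phi>_def)
  ultimately obtain V W where VW: "open V" "open W" "(0, 0) \<in> V \<times> W" "V \<times> W \<subseteq> ball 0 r \<times> UNIV \<inter> \<phi> -` U"
    by (rule open_prod_elim)
  then have "0 \<in> V" "0 \<in> W" by auto
  obtain \<delta>1 where \<delta>1: "\<delta>1 > 0" "ball 0 \<delta>1 \<subseteq> V" using openE [OF VW(1) \<open>0 \<in> V\<close>] .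
  obtain \<delta>2 where \<delta>2: "\<delta>2 > 0" "ball 0 \<delta>2 \<subseteq> W" using openE [OF VW(2) \<open>0 \<in> W\<close>] .
  note \<delta> = \<delta>1 \<delta>2
  define \<delta> where "\<delta> = min \<delta>1 \<delta>2"
  have \<delta>0: "\<delta> > 0" using \<delta> by (simp add: \<delta>_def)
  have inU: "s x + y *s axis j 1 \<in> U" "x \<in> ball 0 r" if "x \<in> ball 0 \<delta>" "y \<in> ball 0 \<delta>" for x y
  proof -
    have "(x, y) \<in> V \<times> W" using that \<delta> by (auto simp: \<delta>_def)
    then show "s x + y *s axis j 1 \<in> U" "x \<in> ball 0 r" using VW(4) by (auto simp: \<phi>_def)
  qed
  have vx: "has_velocity (\<lambda>x. s x + y *s axis j 1) v x" if "has_velocity s v x" for x y v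
    using that unfolding has_velocity_def by (auto intro!: derivative_eq_intros)
  have d1: "has_velocity (\<lambda>x. f (s x + y *s axis j 1)) (frechet_derivative f (at (s x + y *s axis j 1)) v) x"
    if "has_velocity s v x" "x \<in> ball 0 \<delta>" "y \<in> ball 0 \<delta>" for x y v
    by (rule has_velocity_compose [OF f inU(1) [OF that(2,3)] vx [OF that(1)]])
  have d2: "has_velocity (\<lambda>y. f (s x + y *s axis j 1)) (partial_deriv j f (s x + y *s axis j 1)) y"
    if "x \<in> ball 0 \<delta>" "y \<in> ball 0 \<delta>" for x y
    unfolding partial_deriv_def
    by (rule has_velocity_compose [OF f inU(1) [OF that] has_velocity_line])
  have "\<exists>c. ((\<lambda>x. partial_deriv j f (s x) $ k) has_field_derivative c) (at 0) \<and>
    ((\<lambda>y. frechet_derivative f (at (s 0 + y *s axis j 1)) u $ k) has_field_derivative c) (at 0)" for k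
  proof -
    define g where "g = (\<lambda>x y. f (s x + y *s axis j 1) $ k)"
    have "continuous_on (ball 0 \<delta> \<times> ball 0 \<delta>) \<phi>"
      by (rule continuous_on_subset [OF c\<phi>]) (use inU(2) \<delta>0 in \<open>auto; blast\<close>)
    then have "continuous_on (ball 0 \<delta> \<times> ball 0 \<delta>) (\<lambda>p. f (\<phi> p))"
      by (rule continuous_on_compose2 [OF holomorphic_map_continuous [OF f]]) (use inU(1) in \<open>auto simp: \<phi>_def\<close>)
    then have "continuous_on (ball 0 \<delta> \<times> ball 0 \<delta>) (\<lambda>p. g (fst p) (snd p))"
      unfolding g_def \<phi>_def by (intro continuous_intros)
    moreover have "(\<lambda>x. g x y) holomorphic_on ball 0 \<delta>" if "y \<in> ball 0 \<delta>" for y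
      unfolding g_def using d1 v inU(2) that by (intro has_velocity_holomorphic) (blast, simp)
    moreover have "g x holomorphic_on ball 0 \<delta>" if "x \<in> ball 0 \<delta>" for x
      unfolding g_def using d2 that by (intro has_velocity_holomorphic) (blast, simp)
    ultimately obtain c where c: "((\<lambda>x. deriv (g x) 0) has_field_derivative c) (at 0)"
      "((\<lambda>y. deriv (\<lambda>x. g x y) 0) has_field_derivative c) (at 0)"
      by (rule mixed_derivatives [OF \<delta>0])
    have "deriv (g x) 0 = partial_deriv j f (s x) $ k" if "x \<in> ball 0 \<delta>" for x
      unfolding g_def using has_velocity_deriv [OF d2 [OF that, of 0], of k] \<delta>0 by simp
    then have 1: "((\<lambda>x. partial_deriv j f (s x) $ k) has_field_derivative c) (at 0)"
      using has_field_derivative_transform_within_open [OF c(1), of "ball 0 \<delta>"] \<delta>0 by auto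
    have "deriv (\<lambda>x. g x y) 0 = frechet_derivative f (at (s 0 + y *s axis j 1)) u $ k" if "y \<in> ball 0 \<delta>" for y
      unfolding g_def using has_velocity_deriv [OF d1 [OF u _ that], of k] \<delta>0 by simp
    then have "((\<lambda>y. frechet_derivative f (at (s 0 + y *s axis j 1)) u $ k) has_field_derivative c) (at 0)"
      using has_field_derivative_transform_within_open [OF c(2), of "ball 0 \<delta>"] \<delta>0 by auto
    with 1 show ?thesis by blast
  qed
  then have "\<exists>c. \<forall>k. ((\<lambda>x. partial_deriv j f (s x) $ k) has_field_derivative c k) (at 0) \<and>
    ((\<lambda>y. frechet_derivative f (at (s 0 + y *s axis j 1)) u $ k) has_field_derivative c k) (at 0)"
    by (intro choice allI)
  then obtain c where "\<And>k. ((\<lambda>x. partial_deriv j f (s x) $ k) has_field_derivative c k) (at 0)"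
    "\<And>k. ((\<lambda>y. frechet_derivative f (at (s 0 + y *s axis j 1)) u $ k) has_field_derivative c k) (at 0)"
    by blast
  then show ?thesis by (intro that [of "\<chi> k. c k"]) (simp_all add: has_velocity_def)
qed

section \<open>Tangent spaces near a smooth point\<close>

lemma vec_subspace_closed:
  fixes L :: "(complex^'n) set"
  assumes "vec.subspace L"
  shows "closed L"
proof (rule closed_subspace)
  have "r *\<^sub>R x = complex_of_real r *s x" for r and x :: "complex^'n"
    by (simp add: vec_eq_iff) (simp add: scaleR_conv_of_real)
  then show "subspace L"
    using assms unfolding subspace_def vec.subspace_def by simp
qed

text \<open>The difference quotients at \<open>1 / (n + 1)\<close> lie in \<open>L\<close>, which is
  closed.\<close>

lemma velocity_in_subspace:
  fixes L :: "(complex^'n) set"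
  assumes L: "vec.subspace L" and c: "has_velocity c v 0" and r: "0 < r" and cL: "c ` ball 0 r \<subseteq> L"
  shows "v \<in> L"
proof -
  define h where "h = (\<lambda>n. 1 / of_nat (Suc n) :: complex)"
  have h: "h \<longlonglongrightarrow> 0" unfolding h_def by (rule LIMSEQ_Suc [OF lim_1_over_n])
  have hnz: "h n \<noteq> 0" for n by (simp add: h_def del: of_nat_Suc)
  have at: "filterlim h (at 0) sequentially"
    using h hnz by (simp add: filterlim_at)
  have "((\<lambda>t. (c (0 + t) $ i - c 0 $ i) / t) \<longlongrightarrow> v $ i) (at 0)" for i
    using c unfolding has_velocity_def DERIV_def by blast
  from filterlim_compose [OF this at]
  have l: "(\<lambda>n. inverse (h n) *s (c (h n) - c 0)) \<longlonglongrightarrow> v"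
    by (intro vec_tendstoI) (simp add: divide_inverse algebra_simps)
  have "\<forall>\<^sub>F n in sequentially. h n \<in> ball 0 r"
    using topological_tendstoD [OF h open_ball, of 0 r] r by simp
  then have ev: "\<forall>\<^sub>F n in sequentially. inverse (h n) *s (c (h n) - c 0) \<in> L"
  proof (rule eventually_mono)
    fix n assume "h n \<in> ball 0 r"
    moreover have "0 \<in> ball (0::complex) r" using r by simp
    ultimately have "c (h n) \<in> L" "c 0 \<in> L" using cL by blast+
    then show "inverse (h n) *s (c (h n) - c 0) \<in> L"
      using L vec.subspace_diff vec.subspace_scale by blast
  qed
  show ?thesis
    by (rule Lim_in_closed_set [OF vec_subspace_closed [OF L] ev _ l]) simp
qed

text \<open>In straightening coordinates the tangent vector is a direction of the linear subspace, so it can be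
  transported to the nearby points.\<close>

lemma tangent_space_limit:
  fixes A :: "(complex^'n) set"
  assumes sm: "smooth_point A q" and u: "u \<in> tangent_space A q"
    and Q: "\<And>n. Q n \<in> A" and lim: "Q \<longlonglongrightarrow> q"
  obtains V where "\<forall>\<^sub>F n in sequentially. V n \<in> tangent_space A (Q n)" "V \<longlonglongrightarrow> u"
proof -
  obtain W and F :: "complex^'n \<Rightarrow> complex^'n" and G L where qW: "q \<in> W"
    and F: "holomorphic_map F W" and G: "holomorphic_map G (F ` W)"
    and GF: "\<And>z. z \<in> W \<Longrightarrow> G (F z) = z" and L: "vec.subspace L" and FL: "F ` (W \<inter> A) = F ` W \<inter> L"
    using sm unfolding smooth_point_def by auto
  have oW: "open W" and oFW: "open (F ` W)" using F G by (simp_all add: holomorphic_map_def)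
  obtain \<gamma> r where r: "0 < r" "\<gamma> ` ball 0 r \<subseteq> A" "\<gamma> 0 = q" and \<gamma>: "has_velocity \<gamma> u 0"
    using u unfolding tangent_space_iff by blast
  define l where "l = frechet_derivative F (at q) u"
  have vF: "has_velocity (\<lambda>t. F (\<gamma> t)) l 0"
    using has_velocity_compose [OF F _ \<gamma>] qW r(3) by (simp add: l_def)
  have "\<forall>\<^sub>F t in nhds 0. \<gamma> t \<in> W"
    using has_velocity_isCont [OF \<gamma>] topological_tendstoD [OF _ oW, of \<gamma> q "at 0"] qW r(3)
    unfolding isCont_def eventually_nhds_conv_at by auto
  then obtain \<delta> where \<delta>: "\<delta> > 0" "\<And>t. t \<in> ball 0 \<delta> \<Longrightarrow> \<gamma> t \<in> W"
    unfolding eventually_nhds_metric by (auto simp: dist_commute)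
  define \<epsilon> where "\<epsilon> = min r \<delta>"
  have \<epsilon>: "\<epsilon> > 0" "\<And>t. t \<in> ball 0 \<epsilon> \<Longrightarrow> \<gamma> t \<in> W \<inter> A" using r \<delta> by (auto simp: \<epsilon>_def)
  have lL: "l \<in> L"
    by (rule velocity_in_subspace [OF L vF \<epsilon>(1)]) (use \<epsilon>(2) FL in blast)
  \<comment> \<open>\<open>G\<close> inverts \<open>F\<close> along the curve, so its differential
    takes \<open>l\<close> back to \<open>u\<close>.\<close>
  have vG: "frechet_derivative G (at (F q)) l = u"
  proof (rule has_velocity_unique)
    show "has_velocity (\<lambda>t. G (F (\<gamma> t))) (frechet_derivative G (at (F q)) l) 0"
      using has_velocity_compose [OF G _ vF] qW r(3) by simp
    show "has_velocity (\<lambda>t. G (F (\<gamma> t))) u 0"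
      unfolding has_velocity_def
    proof
      fix i show "((\<lambda>t. G (F (\<gamma> t)) $ i) has_field_derivative u $ i) (at 0)"
      proof (rule has_field_derivative_transform_within_open [where S = "ball 0 \<epsilon>"])
        show "((\<lambda>t. \<gamma> t $ i) has_field_derivative u $ i) (at 0)" using \<gamma> by (simp add: has_velocity_def)
      qed (use \<epsilon> GF in auto)
    qed
  qed
  \<comment> \<open>One \<open>\<rho>\<close> is reserved for the base point \<open>F (Q n)\<close>,
    the other for the displacement \<open>t *s l\<close>.\<close>
  obtain \<rho> where \<rho>: "\<rho> > 0" "cball (F q) (2 * \<rho>) \<subseteq> F ` W"
  proof -
    obtain e where "e > 0" "cball (F q) e \<subseteq> F ` W" using oFW qW open_contains_cball by blast
    then show ?thesis using that [of "e / 2"] by simp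
  qed
  have "isCont (\<lambda>t. F q + t *s l) 0" by (rule has_velocity_isCont [OF has_velocity_line])
  then obtain R where R: "R > 0" "\<And>t. t \<in> ball 0 R \<Longrightarrow> dist (F q + t *s l) (F q) < \<rho>"
    unfolding continuous_at_eps_delta using \<rho>(1) by (auto simp: dist_commute)
  have inball: "p + t *s l \<in> cball (F q) (2 * \<rho>)" if "p \<in> ball (F q) \<rho>" "t \<in> ball 0 R" for p t
  proof -
    have "dist (F q) (p + t *s l) \<le> dist (F q) p + dist p (p + t *s l)" by (rule dist_triangle)
    also have "dist p (p + t *s l) = dist (F q + t *s l) (F q)" by (simp add: dist_norm)
    finally show ?thesis using that R(2) [OF that(2)] by simp
  qed
  have vline: "has_velocity (\<lambda>t. G (p + t *s l)) (frechet_derivative G (at (p + t *s l)) l) t"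
    if "p \<in> ball (F q) \<rho>" "t \<in> ball 0 R" for p t
    by (rule has_velocity_compose [OF G _ has_velocity_line]) (use inball [OF that] \<rho> in blast)
  have FQ: "(\<lambda>n. F (Q n)) \<longlonglongrightarrow> F q"
    using holomorphic_map_continuous [OF F] oW qW lim
    by (metis continuous_on_eq_continuous_at isCont_tendsto_compose)
  have evW: "\<forall>\<^sub>F n in sequentially. Q n \<in> W" by (rule topological_tendstoD [OF lim oW qW])
  have evb: "\<forall>\<^sub>F n in sequentially. F (Q n) \<in> ball (F q) \<rho>"
    by (rule topological_tendstoD [OF FQ open_ball]) (use \<rho> in simp)
  define V where "V = (\<lambda>n. frechet_derivative G (at (F (Q n))) l)"
  have ev: "\<forall>\<^sub>F n in sequentially. V n \<in> tangent_space A (Q n)"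
  proof (rule eventually_elim2 [OF evW evb])
    fix n assume QW: "Q n \<in> W" and b: "F (Q n) \<in> ball (F q) \<rho>"
    show "V n \<in> tangent_space A (Q n)"
      unfolding tangent_space_iff
    proof (intro exI conjI ballI)
      show "(\<lambda>t. G (F (Q n) + t *s l)) ` ball 0 R \<subseteq> A"
      proof
        fix x assume "x \<in> (\<lambda>t. G (F (Q n) + t *s l)) ` ball 0 R"
        then obtain t where t: "t \<in> ball 0 R" "x = G (F (Q n) + t *s l)" by blast
        have "F (Q n) \<in> L" using FL QW Q by blast
        then have "F (Q n) + t *s l \<in> L" using L lL vec.subspace_add vec.subspace_scale by blast
        moreover have "F (Q n) + t *s l \<in> F ` W" using inball [OF b t(1)] \<rho> by blast
        ultimately obtain a where "a \<in> W \<inter> A" "F (Q n) + t *s l = F a" using FL by blast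
        then show "x \<in> A" using t(2) GF by simp
      qed
      show "has_velocity (\<lambda>t. G (F (Q n) + t *s l)) (V n) 0"
        using vline [OF b, of 0] R by (simp add: V_def)
    qed (use vline [OF b] QW GF R in auto)
  qed
  have "V \<longlonglongrightarrow> u"
  proof (rule vec_tendstoI)
    fix i
    have "uniformly_continuous_on (cball (F q) (2 * \<rho>)) G"
      by (intro compact_uniformly_continuous continuous_on_subset [OF holomorphic_map_continuous [OF G] \<rho>(2)]) simp
    \<comment> \<open>Continuity of the differential of \<open>G\<close> is not part of
      \<open>holomorphic_map\<close>. Instead the curves
      \<open>t \<mapsto> G (F (Q n) + t *s l)\<close> converge uniformly, and so do their
      derivatives at 0, which are the \<open>V n\<close>.\<close>
    have "uniform_limit (ball 0 R) (\<lambda>n t. G (F (Q n) + t *s l) $ i) (\<lambda>t. G (F q + t *s l) $ i) sequentially"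
    proof (rule uniform_limitI)
      fix e :: real assume "0 < e"
      then obtain d where d: "d > 0" "\<And>x x'. x \<in> cball (F q) (2 * \<rho>) \<Longrightarrow> x' \<in> cball (F q) (2 * \<rho>) \<Longrightarrow>
          dist x' x < d \<Longrightarrow> dist (G x') (G x) < e"
        using \<open>uniformly_continuous_on _ G\<close> unfolding uniformly_continuous_on_def by metis
      have "\<forall>\<^sub>F n in sequentially. dist (F (Q n)) (F q) < d" using tendstoD [OF FQ d(1)] .
      then show "\<forall>\<^sub>F n in sequentially. \<forall>t\<in>ball 0 R. dist (G (F (Q n) + t *s l) $ i) (G (F q + t *s l) $ i) < e"
      proof (rule eventually_elim2 [OF _ evb], intro ballI)
        fix n t assume n: "dist (F (Q n)) (F q) < d" "F (Q n) \<in> ball (F q) \<rho>" and t: "t \<in> ball (0::complex) R"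
        have "dist (G (F (Q n) + t *s l)) (G (F q + t *s l)) < e"
        proof (rule d(2))
          show "F q + t *s l \<in> cball (F q) (2 * \<rho>)" by (rule inball [OF _ t]) (use \<rho> in simp)
          show "F (Q n) + t *s l \<in> cball (F q) (2 * \<rho>)" by (rule inball [OF n(2) t])
        qed (use n(1) in \<open>simp add: dist_norm\<close>)
        then show "dist (G (F (Q n) + t *s l) $ i) (G (F q + t *s l) $ i) < e"
          using dist_vec_nth_le order.strict_trans1 by blast
      qed
    qed
    moreover have "\<forall>\<^sub>F n in sequentially. (\<lambda>t. G (F (Q n) + t *s l) $ i) holomorphic_on ball 0 R"
    proof (rule eventually_mono [OF evb])
      fix n assume n: "F (Q n) \<in> ball (F q) \<rho>"
      show "(\<lambda>t. G (F (Q n) + t *s l) $ i) holomorphic_on ball 0 R"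
        by (rule has_velocity_holomorphic) (use vline [OF n] in blast, simp)
    qed
    ultimately have "(\<lambda>n. deriv (\<lambda>t. G (F (Q n) + t *s l) $ i) 0) \<longlonglongrightarrow> deriv (\<lambda>t. G (F q + t *s l) $ i) 0"
      by (rule deriv_complex_uniform_limit) (use R in auto)
    also have "deriv (\<lambda>t. G (F q + t *s l) $ i) 0 = u $ i"
      using has_velocity_deriv [OF vline [of "F q" 0]] vG R \<rho> by simp
    finally show "(\<lambda>n. V n $ i) \<longlonglongrightarrow> u $ i"
    proof (rule Lim_transform_eventually)
      show "\<forall>\<^sub>F n in sequentially. deriv (\<lambda>t. G (F (Q n) + t *s l) $ i) 0 = V n $ i"
        by (rule eventually_mono [OF evb]) (use has_velocity_deriv [OF vline, of _ 0] R in \<open>simp add: V_def\<close>)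
    qed
  qed
  with ev show ?thesis by (rule that)
qed

lemma has_velocity_transform:
  assumes "has_velocity c v t" "open S" "t \<in> S" "\<And>x. x \<in> S \<Longrightarrow> c x = d x"
  shows "has_velocity d v t"
  unfolding has_velocity_def
proof
  fix i
  show "((\<lambda>t. d t $ i) has_field_derivative v $ i) (at t)"
    by (rule has_field_derivative_transform_within_open [of "\<lambda>t. c t $ i"])
      (use assms in \<open>auto simp: has_velocity_def\<close>)
qed

lemma has_velocity_lin:
  assumes "has_velocity c v t" "has_velocity d u t"
  shows "has_velocity (\<lambda>t. a *s c t + b *s d t) (a *s v + b *s u) t"
  using assms unfolding has_velocity_def by (auto intro!: derivative_eq_intros)

lemma open_line:
  fixes z v :: "complex^'n"
  assumes "open U" "z \<in> U"
  obtains r where "r > 0" "(\<lambda>t. z + t *s v) ` ball 0 r \<subseteq> U"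
proof -
  have "isCont (\<lambda>t. z + t *s v) 0" by (rule has_velocity_isCont [OF has_velocity_line])
  then have "\<forall>\<^sub>F t in nhds 0. z + t *s v \<in> U"
    using topological_tendstoD [OF _ assms(1), of "\<lambda>t. z + t *s v" z "at 0"] assms(2)
    unfolding isCont_def eventually_nhds_conv_at by auto
  then show ?thesis unfolding eventually_nhds_metric using that by (auto simp: dist_commute image_subset_iff)
qed

text \<open>\<open>H i j\<close> is the derivative of the \<open>j\<close>-th partial along the
  \<open>i\<close>-th axis. For a general curve, the second velocity in
  \<open>partial_deriv_along_curve\<close> involves the differential in direction \<open>u\<close>,
  which is linear in \<open>u\<close>; so the same \<open>H\<close> serves all curves through
  \<open>z\<close>.\<close>

lemma second_partials:
  fixes f :: "complex^2 \<Rightarrow> complex^'m"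
  assumes f: "holomorphic_map f U" and z: "z \<in> U"
  obtains H :: "2 \<Rightarrow> 2 \<Rightarrow> complex^'m" where "\<And>i j. H i j = H j i"
    "\<And>s r u j. 0 < r \<Longrightarrow> s ` ball 0 r \<subseteq> U \<Longrightarrow> s 0 = z \<Longrightarrow> (\<And>t. t \<in> ball 0 r \<Longrightarrow> \<exists>v. has_velocity s v t) \<Longrightarrow>
      has_velocity s u 0 \<Longrightarrow> has_velocity (\<lambda>t. partial_deriv j f (s t)) (u $ 1 *s H 1 j + u $ 2 *s H 2 j) 0"
proof -
  have oU: "open U" using f by (simp add: holomorphic_map_def)
  have "\<exists>c. has_velocity (\<lambda>t. partial_deriv j f (z + t *s axis i 1)) c 0 \<and>
    has_velocity (\<lambda>t. partial_deriv i f (z + t *s axis j 1)) c 0" for i j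
  proof -
    obtain r where r: "r > 0" "(\<lambda>t. z + t *s axis i 1) ` ball 0 r \<subseteq> U" by (rule open_line [OF oU z])
    obtain c where "has_velocity (\<lambda>t. partial_deriv j f (z + t *s axis i 1)) c 0"
      "has_velocity (\<lambda>y. frechet_derivative f (at (z + 0 *s axis i 1 + y *s axis j 1)) (axis i 1)) c 0"
      by (rule partial_deriv_along_curve [OF f r]) (use has_velocity_line in blast)+
    then show ?thesis unfolding partial_deriv_def by auto
  qed
  then obtain H where H: "\<And>i j. has_velocity (\<lambda>t. partial_deriv j f (z + t *s axis i 1)) (H i j) 0"
    "\<And>i j. has_velocity (\<lambda>t. partial_deriv i f (z + t *s axis j 1)) (H i j) 0" by metis
  have sym: "H i j = H j i" for i j by (rule has_velocity_unique [OF H(1) H(2)])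
  show ?thesis
  proof (rule that [OF sym])
    fix s :: "complex \<Rightarrow> complex^2" and r u j
    assume r: "0 < r" and s: "s ` ball 0 r \<subseteq> U" "s 0 = z" "\<And>t. t \<in> ball 0 r \<Longrightarrow> \<exists>v. has_velocity s v t"
      and u: "has_velocity s u 0"
    obtain c where c: "has_velocity (\<lambda>t. partial_deriv j f (s t)) c 0"
      "has_velocity (\<lambda>y. frechet_derivative f (at (s 0 + y *s axis j 1)) u) c 0"
      by (rule partial_deriv_along_curve [OF f r s(1,3) u])
    obtain r' where r': "r' > 0" "(\<lambda>t. z + t *s axis j 1) ` ball 0 r' \<subseteq> U" by (rule open_line [OF oU z])
    have "has_velocity (\<lambda>y. u $ 1 *s partial_deriv 1 f (z + y *s axis j 1) + u $ 2 *s partial_deriv 2 f (z + y *s axis j 1)) c 0"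
    proof (rule has_velocity_transform [OF c(2) open_ball])
      fix y :: complex assume "y \<in> ball 0 r'"
      then have "z + y *s axis j 1 \<in> U" using r'(2) by blast
      then show "frechet_derivative f (at (s 0 + y *s axis j 1)) u =
        u $ 1 *s partial_deriv 1 f (z + y *s axis j 1) + u $ 2 *s partial_deriv 2 f (z + y *s axis j 1)"
        unfolding s(2) by (rule frechet_derivative_partial [OF f])
    qed (use r' in simp)
    moreover have "has_velocity (\<lambda>y. u $ 1 *s partial_deriv 1 f (z + y *s axis j 1) + u $ 2 *s partial_deriv 2 f (z + y *s axis j 1))
        (u $ 1 *s H 1 j + u $ 2 *s H 2 j) 0"
      by (intro has_velocity_lin H(2))
    ultimately have "c = u $ 1 *s H 1 j + u $ 2 *s H 2 j" by (rule has_velocity_unique)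
    with c(1) show "has_velocity (\<lambda>t. partial_deriv j f (s t)) (u $ 1 *s H 1 j + u $ 2 *s H 2 j) 0" by simp
  qed
qed

section \<open>Product rules along a curve\<close>

lemma has_derivative_bil:
  assumes "has_velocity a a' t" "has_velocity b b' t"
  shows "((\<lambda>t. bil M (a t) (b t)) has_field_derivative bil M a' (b t) + bil M (a t) b') (at t)"
proof -
  have "((\<lambda>t. \<Sum>i\<in>UNIV. \<Sum>j\<in>UNIV. a t $ i * M $ i $ j * b t $ j) has_field_derivative
    (\<Sum>i\<in>UNIV. \<Sum>j\<in>UNIV. a' $ i * M $ i $ j * b t $ j + a t $ i * M $ i $ j * b' $ j)) (at t)"
    using assms unfolding has_velocity_def
    by (intro DERIV_sum) (auto intro!: derivative_eq_intros)
  then show ?thesis unfolding bil_sum by (simp add: sum.distrib)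
qed

lemma has_velocity_const: "has_velocity (\<lambda>t. a) 0 t"
  by (simp add: has_velocity_def)

text \<open>Expanding in the three varying arguments gives a polynomial in their coordinates, to
  which the product rule applies termwise.\<close>

lemma det5_expand:
  "det5 a b c m n = (\<Sum>i\<in>UNIV. \<Sum>j\<in>UNIV. \<Sum>k\<in>UNIV.
    a $ i * b $ j * c $ k * det5 (axis i 1) (axis j 1) (axis k 1) m n)"
proof -
  have z: "det5 0 b c m n = 0" "det5 a 0 c m n = 0" "det5 a b 0 m n = 0" for a b c
    using det5_scale(1) [of 0 0] det5_scale(2) [of _ 0 0] det5_scale(3) [of _ _ 0 0] by simp_all
  have s: "det5 (sum f I) b c m n = (\<Sum>i\<in>I. det5 (f i) b c m n)"
    "det5 a (sum f I) c m n = (\<Sum>i\<in>I. det5 a (f i) c m n)"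
    "det5 a b (sum f I) m n = (\<Sum>i\<in>I. det5 a b (f i) m n)" if "finite I" for f a b c and I :: "5 set"
    using that by (induction I) (simp_all add: z det5_add)
  have e: "v = (\<Sum>i\<in>UNIV. v $ i *s axis i 1)" for v :: "complex^5"
    by (simp add: vec_eq_iff axis_def if_distrib cong: if_cong)
  have e1: "det5 a b c m n = (\<Sum>i\<in>UNIV. a $ i * det5 (axis i 1) b c m n)" for a b c
    using s(1) [of UNIV "\<lambda>i. a $ i *s axis i 1" b c] e [of a] by (simp add: det5_scale)
  have e2: "det5 a b c m n = (\<Sum>i\<in>UNIV. b $ i * det5 a (axis i 1) c m n)" for a b c
    using s(2) [of UNIV a "\<lambda>i. b $ i *s axis i 1" c] e [of b] by (simp add: det5_scale)
  have e3: "det5 a b c m n = (\<Sum>i\<in>UNIV. c $ i * det5 a b (axis i 1) m n)" for a b c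
    using s(3) [of UNIV a b "\<lambda>i. c $ i *s axis i 1"] e [of c] by (simp add: det5_scale)
  show ?thesis
    unfolding e1 [of a b c] e2 [of "axis i 1" b c for i] e3 [of "axis i 1" "axis j 1" c for i j]
    by (simp add: sum_distrib_left mult.assoc)
qed

lemma has_derivative_det5:
  assumes "has_velocity a a' t" "has_velocity b b' t" "has_velocity c c' t"
  shows "((\<lambda>t. det5 (a t) (b t) (c t) m n) has_field_derivative
    det5 a' (b t) (c t) m n + det5 (a t) b' (c t) m n + det5 (a t) (b t) c' m n) (at t)"
proof -
  define T where "T = (\<lambda>i j k. det5 (axis i 1) (axis j 1) (axis k 1) m n)"
  have "((\<lambda>t. \<Sum>i\<in>UNIV. \<Sum>j\<in>UNIV. \<Sum>k\<in>UNIV. a t $ i * b t $ j * c t $ k * T i j k) has_field_derivative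
    (\<Sum>i\<in>UNIV. \<Sum>j\<in>UNIV. \<Sum>k\<in>UNIV. a' $ i * b t $ j * c t $ k * T i j k + a t $ i * b' $ j * c t $ k * T i j k
      + a t $ i * b t $ j * c' $ k * T i j k)) (at t)"
    using assms unfolding has_velocity_def
    by (intro DERIV_sum) (auto intro!: derivative_eq_intros simp: algebra_simps)
  then show ?thesis
    unfolding det5_expand [of "a _"] det5_expand [of a'] T_def by (simp add: sum.distrib)
qed

lemma has_derivative_jac:
  assumes "has_velocity a a' t"
  shows "((\<lambda>t. jac M1 M2 (a t) m n) has_field_derivative jac_deriv M1 M2 (a t) m n a') (at t)"
proof -
  note d = has_derivative_bil [OF assms has_velocity_const, simplified]
  show ?thesis
    unfolding jac_def jac_deriv_def
    by (rule derivative_eq_intros d refl | simp)+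
qed

section \<open>The symplectic form on the level sets\<close>

lemma deriv_of_constant:
  assumes "(f has_field_derivative D) (at 0)" "0 < r" "\<And>t. t \<in> ball 0 r \<Longrightarrow> f t = c"
  shows "D = 0"
proof -
  have "((\<lambda>t. c) has_field_derivative D) (at 0)"
    by (rule has_field_derivative_transform_within_open [OF assms(1) open_ball, of 0 r])
      (use assms in auto)
  then show ?thesis using DERIV_unique DERIV_const by blast
qed

lemma has_velocity_matrix_mult:
  assumes "has_velocity c v t"
  shows "has_velocity (\<lambda>t. M *v c t) (M *v v) t"
  using assms unfolding has_velocity_def matrix_vector_mult_def
  by (auto intro!: DERIV_sum derivative_eq_intros)

context dp_point
begin

text \<open>Exchanging the two quadrics is a change of basis of the pencil, under which
  \<open>curv\<close> is invariant.\<close>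

lemma curv_vertex_any:
  assumes N: "N = M1 \<or> N = M2"
    and v: "tangent M1 M2 y v" "bil N v v \<noteq> 0"
    and ab: "tangent M1 M2 y a" "tangent M1 M2 y b" "bil N v a = 0" "bil N v b = 0"
    and J: "jac M1 M2 y m n \<noteq> 0"
    and a': "a' + t *s a = \<rho> *s y" and b': "b' + t *s b = \<sigma> *s y"
  shows "curv M1 M2 y w m n a a' b b' = 0"
proof (cases "N = M2")
  case True
  then show ?thesis using curv_vertex [OF v(1) _ ab(1,2) _ _ J a' b'] v(2) ab(3,4) by simp
next
  case False
  with N have N: "N = M1" by simp
  have p: "pencil M1 M2 0 1 = M2" "pencil M1 M2 1 0 = M1" by (simp_all add: pencil_def vec_eq_iff)
  have "dp_point M2 M1 y"
    using del_pezzo_4_pencil [OF dp, of 0 0 1 1] quad1 quad2 y_nz unfolding p by (simp add: dp_point_def)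
  then interpret S: dp_point M2 M1 y .
  have T: "tangent M2 M1 y x \<longleftrightarrow> tangent M1 M2 y x" for x by (auto simp: tangent_def)
  have "jac M2 M1 y m n \<noteq> 0" using J jac_pencil [of M1 M2 0 1 1 0 y m n] unfolding p by simp
  then have "curv M2 M1 y w m n a a' b b' = 0"
    using S.curv_vertex [OF _ _ _ _ _ _ _ a' b', of v] v ab unfolding N T by blast
  then show ?thesis using curv_pencil [of 0 0 1 1 M1 M2] unfolding p by simp
qed

end

section \<open>Vertices of singular members of the pencil\<close>

context dp_vector
begin

text \<open>A kernel of larger dimension would contain a nonzero vector isotropic for
  \<open>N\<close>. As \<open>M\<close> and \<open>N\<close> span the pencil, both quadrics vanish
  there, and \<open>M\<close> gives a relation between the two gradients, against
  smoothness.\<close>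

lemma vertex_kernel:
  assumes N: "N = M1 \<and> f \<noteq> 0 \<or> N = M2 \<and> e \<noteq> 0"
    and M: "M = pencil M1 M2 e f"
    and v: "M *v v = 0" "bil N v v \<noteq> 0" and x: "M *v x = 0"
  obtains c where "x = c *s v"
proof -
  have bM: "bil M u z = 0" if "M *v z = 0" for u z using that by (simp add: bil_def)
  define A B C where "A = bil N v v" and "B = bil N v x" and "C = bil N x x"
  have symN: "bil N x v = bil N v x" using N sym by auto
  define d where "d = csqrt (B\<^sup>2 - A * C)"
  \<comment> \<open>A root of \<open>C + 2 k B + k\<^sup>2 A = 0\<close>, which makes
    \<open>x + k v\<close> isotropic for \<open>N\<close>.\<close>
  define k where "k = (d - B) / A"
  define z where "z = x + k *s v"
  have "d\<^sup>2 = B\<^sup>2 - A * C" by (simp add: d_def)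
  moreover have kA: "k * A = d - B" using v(2) by (simp add: k_def A_def)
  have "A * (C + 2 * k * B + k\<^sup>2 * A) = A * C + 2 * (k * A) * B + (k * A)\<^sup>2"
    by (simp add: algebra_simps power2_eq_square)
  ultimately have "A * (C + 2 * k * B + k\<^sup>2 * A) = 0"
    unfolding kA by (simp add: algebra_simps power2_eq_square)
  then have "C + 2 * k * B + k\<^sup>2 * A = 0" using v(2) by (simp add: A_def)
  then have q: "bil N z z = 0"
    by (simp add: z_def bil_lin symN A_def B_def C_def algebra_simps power2_eq_square)
  have Mz: "M *v z = 0"
    using v(1) x unfolding z_def matrix_vector_right_distrib vector_scalar_commute by simp
  have "e * bil M1 z z + f * bil M2 z z = 0" using bM [OF Mz, of z] unfolding M bil_pencil .
  then have "quad M1 z = 0 \<and> quad M2 z = 0" using q N by (auto simp: quad_def)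
  moreover have "e *s (M1 *v z) + f *s (M2 *v z) = 0" using Mz unfolding M pencil_mult .
  ultimately have "z = 0" using dp N unfolding del_pezzo_4_def by blast
  then have "x = (- k) *s v" unfolding z_def by (simp add: eq_neg_iff_add_eq_0)
  then show ?thesis by (rule that)
qed

text \<open>Along the curve \<open>V s = c v + \<tau> Y s\<close> with \<open>v\<close> constant,
  but \<open>c\<close> and \<open>\<tau>\<close> are only chosen pointwise and not known to be
  differentiable. They are eliminated: \<open>c\<close> through the square of
  \<open>bil N v (V s)\<close>, and \<open>\<tau>\<close> through the 2 x 2 minors of
  \<open>M *v V s\<close> and \<open>M *v Y s\<close>.\<close>

lemma vertex_velocity:
  assumes N: "N = M1 \<and> f \<noteq> 0 \<or> N = M2 \<and> e \<noteq> 0"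
    and M: "M = pencil M1 M2 e f"
    and v: "M *v (w + t *s y) = 0" "bil N w w \<noteq> 0"
    and Y: "has_velocity Y a 0" "Y 0 = y" and V: "has_velocity V a' 0" "V 0 = w"
    and r: "0 < r" and P: "\<And>s. s \<in> ball 0 r \<Longrightarrow> dp_vector M1 M2 (Y s) (V s)"
    and q: "\<And>s. s \<in> ball 0 r \<Longrightarrow> bil N (V s) (V s) = bil N w w"
    and k: "\<And>s. s \<in> ball 0 r \<Longrightarrow> \<exists>t. M *v (V s + t *s Y s) = 0"
  obtains \<kappa> where "a' + t *s a = \<kappa> *s y" "bil N (w + t *s y) a = 0"
proof -
  define v where "v = w + t *s y"
  have Mv: "M *v v = 0" using v by (simp add: v_def)
  have N': "N = M1 \<or> N = M2" using N by blast
  have symN: "bil N x z = bil N z x" for x z using N' sym by auto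
  have bNY: "bil N (Y s) (V s) = 0 \<and> bil N (Y s) (Y s) = 0" if "s \<in> ball 0 r" for s
  proof -
    interpret S: dp_vector M1 M2 "Y s" "V s" by (rule P [OF that])
    show ?thesis using N' by auto
  qed
  have yw: "bil N y w = 0" "bil N w y = 0" "bil N y y = 0" using N' by auto
  have vv: "bil N v v = bil N w w" by (simp add: v_def bil_lin yw)
  have nz: "bil N v v \<noteq> 0" using v vv by simp
  have on_curve: "\<exists>c \<tau>. V s = c *s v + \<tau> *s Y s \<and> c \<noteq> 0" if s: "s \<in> ball 0 r" for s
  proof -
    interpret S: dp_vector M1 M2 "Y s" "V s" by (rule P [OF s])
    obtain \<tau> where "M *v (V s + \<tau> *s Y s) = 0" using k [OF s] by blast
    then obtain c where c: "V s + \<tau> *s Y s = c *s v"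
      by (rule vertex_kernel [OF N M Mv nz])
    have "c \<noteq> 0" using S.indep [of \<tau> 1] c by (auto simp: add.commute)
    moreover have "V s = c *s v + (- \<tau>) *s Y s" unfolding c [symmetric] by (simp add: vec_eq_iff)
    ultimately show ?thesis by blast
  qed
  have vY: "bil N v (Y s) = 0" if s: "s \<in> ball 0 r" for s
  proof -
    obtain c \<tau> where c: "V s = c *s v + \<tau> *s Y s" "c \<noteq> 0" using on_curve [OF s] by blast
    have "bil N (Y s) (V s) = c * bil N v (Y s) + \<tau> * bil N (Y s) (Y s)"
      unfolding c(1) bil_lin symN [of "Y s" v] ..
    then show ?thesis using bNY [OF s] c(2) by simp
  qed
  have va: "bil N v a = 0"
    using deriv_of_constant [OF has_derivative_bil [OF has_velocity_const [of v] Y(1)] r vY] by simp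
  \<comment> \<open>The level condition forces \<open>c * c = 1\<close>; squaring avoids a choice of
    sign.\<close>
  have vV: "bil N v (V s) * bil N v (V s) = bil N w w * bil N w w" if s: "s \<in> ball 0 r" for s
  proof -
    obtain c \<tau> where c: "V s = c *s v + \<tau> *s Y s" using on_curve [OF s] by blast
    have 1: "bil N v (V s) = c * bil N v v" unfolding c bil_lin vY [OF s] by simp
    have "bil N (V s) (V s) = c * c * bil N v v"
      unfolding c bil_lin symN [of "Y s" v] vY [OF s] using bNY [OF s] by simp
    then have "c * c * bil N w w = bil N w w" using q [OF s] vv by simp
    then show ?thesis unfolding 1 vv by (simp add: algebra_simps)
  qed
  have d: "((\<lambda>s. bil N v (V s)) has_field_derivative bil N v a') (at 0)"
    using has_derivative_bil [OF has_velocity_const [of v] V(1)] by simp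
  have "2 * bil N v w * bil N v a' = 0"
    using deriv_of_constant [OF DERIV_mult [OF d d] r vV] by (simp add: V(2) algebra_simps)
  moreover have "bil N v w = bil N w w" by (simp add: v_def bil_lin yw)
  ultimately have va': "bil N v a' = 0" using v(2) by simp
  define p where "p = M *v y"
  have Mw: "M *v w = (- t) *s p"
    using v(1) unfolding matrix_vector_right_distrib vector_scalar_commute p_def
    by (simp add: eq_neg_iff_add_eq_0)
  have "p \<noteq> 0" using smooth [of e f] N unfolding p_def M pencil_mult by blast
  then obtain i where i: "p $ i \<noteq> 0" by (auto simp: vec_eq_iff)
  \<comment> \<open>\<open>M *v V s\<close> is a multiple of \<open>M *v Y s\<close>, so their
    minors vanish identically; this is the derivative at 0.\<close>
  have minors: "p $ j * (M *v (a' + t *s a)) $ i = p $ i * (M *v (a' + t *s a)) $ j" for j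
  proof -
    have vel: "((\<lambda>s. (M *v V s) $ l) has_field_derivative (M *v a') $ l) (at 0)"
      "((\<lambda>s. (M *v Y s) $ l) has_field_derivative (M *v a) $ l) (at 0)" for l
      using has_velocity_matrix_mult [OF V(1), of M] has_velocity_matrix_mult [OF Y(1), of M]
      by (simp_all add: has_velocity_def)
    have "(M *v V s) $ i * (M *v Y s) $ j - (M *v V s) $ j * (M *v Y s) $ i = 0" if s: "s \<in> ball 0 r" for s
    proof -
      obtain \<tau> where "M *v (V s + \<tau> *s Y s) = 0" using k [OF s] by blast
      then have "M *v V s = (- \<tau>) *s (M *v Y s)"
        unfolding matrix_vector_right_distrib vector_scalar_commute by (simp add: eq_neg_iff_add_eq_0)
      then show ?thesis by simp
    qed
    from deriv_of_constant [OF DERIV_diff [OF DERIV_mult [OF vel(1) [of i] vel(2) [of j]] DERIV_mult [OF vel(1) [of j] vel(2) [of i]]] r this]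
    show ?thesis
      unfolding V(2) Y(2) Mw p_def [symmetric] matrix_vector_right_distrib vector_scalar_commute
      by (simp add: algebra_simps)
  qed
  define \<kappa> where "\<kappa> = (M *v (a' + t *s a)) $ i / p $ i"
  have "(M *v (a' + t *s a)) $ j = \<kappa> * p $ j" for j
    using minors [of j] i by (simp add: \<kappa>_def field_simps)
  then have "M *v (a' + t *s a) = \<kappa> *s p" by (simp add: vec_eq_iff)
  then have "M *v ((a' + t *s a) + (- \<kappa>) *s y) = 0"
    unfolding matrix_vector_right_distrib [of _ "a' + t *s a"] vector_scalar_commute p_def by simp
  \<comment> \<open>The vector in the kernel is a multiple of \<open>v\<close> and orthogonal to
    \<open>v\<close> under \<open>N\<close>, hence 0.\<close>
  then obtain c where c: "(a' + t *s a) + (- \<kappa>) *s y = c *s v"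
    by (rule vertex_kernel [OF N M Mv nz])
  have "bil N v ((a' + t *s a) + (- \<kappa>) *s y) = 0"
    using vY [of 0] r Y(2) unfolding bil_lin va va' by simp
  then have "c * bil N v v = 0" unfolding c bil_lin .
  then have "c = 0" using nz by simp
  then have "a' + t *s a = \<kappa> *s y" using c by simp
  then show ?thesis using va unfolding v_def by (rule that)
qed

end

section \<open>Lifting cotangent charts to pairs of vectors\<close>

locale dp_chart =
  fixes M1 M2 U \<sigma>
  assumes dp: "del_pezzo_4 M1 M2" and chart: "local_parametrisation M1 M2 U \<sigma>"
begin

definition Y :: "complex^4 \<Rightarrow> complex^5" where "Y z = \<sigma> (base_point z)"

definition P :: "2 \<Rightarrow> complex^4 \<Rightarrow> complex^5" where "P j z = partial_deriv j \<sigma> (base_point z)"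

text \<open>The representative modulo \<open>Y z\<close> that has no component along
  \<open>Y z\<close> in the coordinate frame.\<close>

definition W :: "complex^4 \<Rightarrow> complex^5"
  where "W z = dp_frame.dual M1 M2 (Y z) (P 1 z) (P 2 z) (z $ 3) (z $ 4)"

definition push :: "complex^4 \<Rightarrow> complex^4 \<Rightarrow> complex^5"
  where "push z u = u $ 1 *s P 1 z + u $ 2 *s P 2 z"

definition curve :: "(complex \<Rightarrow> complex^4) \<Rightarrow> real \<Rightarrow> complex^4 \<Rightarrow> complex^4 \<Rightarrow> bool"
  where "curve \<gamma> r z u \<longleftrightarrow> 0 < r \<and> (\<forall>t\<in>ball 0 r. base_point (\<gamma> t) \<in> U) \<and> \<gamma> 0 = z \<and>
    (\<forall>t\<in>ball 0 r. \<exists>v. has_velocity \<gamma> v t) \<and> has_velocity \<gamma> u 0"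

lemma holo: "holomorphic_map \<sigma> U" and open_U: "open U"
  using chart by (auto simp: local_parametrisation_def holomorphic_map_def)

lemma quad_\<sigma>:
  assumes "s \<in> U"
  shows "quad M1 (\<sigma> s) = 0" "quad M2 (\<sigma> s) = 0"
proof -
  have "vec.span {\<sigma> s} \<in> surface M1 M2" using chart assms by (auto simp: local_parametrisation_def)
  then obtain y where y: "vec.span {\<sigma> s} = vec.span {y}" "quad M1 y = 0" "quad M2 y = 0"
    unfolding surface_def by blast
  have "\<sigma> s \<in> vec.span {\<sigma> s}" by (rule vec.span_base) simp
  then obtain t where "\<sigma> s = t *s y" unfolding y(1) span_singleton by blast
  then show "quad M1 (\<sigma> s) = 0" "quad M2 (\<sigma> s) = 0" using y by (simp_all add: quad_def bil_lin)
qed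

text \<open>Both quadrics vanish on the image of \<open>\<sigma>\<close>; differentiating this along
  coordinate lines puts the partial derivatives into the tangent cone.\<close>

lemma frame:
  assumes z: "base_point z \<in> U"
  shows "dp_frame M1 M2 (Y z) (P 1 z) (P 2 z)"
proof -
  have lp: "\<sigma> (base_point z) \<noteq> 0" "\<And>a b c. a *s \<sigma> (base_point z) + b *s P 1 z + c *s P 2 z = 0 \<Longrightarrow> a = 0 \<and> b = 0 \<and> c = 0"
    using chart z unfolding local_parametrisation_def P_def by blast+
  interpret dp_point M1 M2 "Y z"
    by standard (use dp lp quad_\<sigma> [OF z] in \<open>simp_all add: Y_def\<close>)
  have T: "tangent M1 M2 (Y z) (P j z)" for j
  proof -
    obtain r where r: "r > 0" "(\<lambda>t. base_point z + t *s axis j 1) ` ball 0 r \<subseteq> U" by (rule open_line [OF open_U z])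
    have v: "has_velocity (\<lambda>t. \<sigma> (base_point z + t *s axis j 1)) (P j z) 0"
      using has_velocity_compose [OF holo _ has_velocity_line, of "base_point z" 0 "axis j 1"] z
      by (simp add: P_def partial_deriv_def)
    have q: "bil M1 (\<sigma> (base_point z + t *s axis j 1)) (\<sigma> (base_point z + t *s axis j 1)) = 0"
      "bil M2 (\<sigma> (base_point z + t *s axis j 1)) (\<sigma> (base_point z + t *s axis j 1)) = 0" if "t \<in> ball 0 r" for t
    proof -
      have "base_point z + t *s axis j 1 \<in> U" using r(2) that by blast
      from quad_\<sigma> [OF this] show "bil M1 (\<sigma> (base_point z + t *s axis j 1)) (\<sigma> (base_point z + t *s axis j 1)) = 0"
        "bil M2 (\<sigma> (base_point z + t *s axis j 1)) (\<sigma> (base_point z + t *s axis j 1)) = 0" by (simp_all add: quad_def)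
    qed
    show ?thesis
      using deriv_of_constant [OF has_derivative_bil [OF v v] r(1) q(1)]
        deriv_of_constant [OF has_derivative_bil [OF v v] r(1) q(2)] sym [of "P j z" "Y z"]
      by (simp add: tangent_def Y_def)
  qed
  show ?thesis by standard (use T lp in \<open>auto simp: Y_def\<close>)
qed

lemma bil_W_level:
  assumes z: "base_point z \<in> U" and e: "cotangent_chart M1 M2 \<sigma> z \<in> level_surface M1 M2 e"
  shows "bil M1 (W z) (W z) = fst e" "bil M2 (W z) (W z) = snd e"
proof -
  interpret F: dp_frame M1 M2 "Y z" "P 1 z" "P 2 z" by (rule frame [OF z])
  have "cotangent_chart M1 M2 \<sigma> z = (vec.span {Y z}, F.covec (z $ 3) (z $ 4))"
    unfolding cotangent_chart_def Let_def Y_def [symmetric] P_def [symmetric] F.the_covec ..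
  then have "(quad M1 (W z), quad M2 (W z)) = e"
    using e by (simp add: level_surface_def Phi_def F.sym2_section_covec W_def)
  then show "bil M1 (W z) (W z) = fst e" "bil M2 (W z) (W z) = snd e" by (auto simp: quad_def)
qed

lemma dp_vector_W:
  assumes z: "base_point z \<in> U" and nz: "z $ 3 \<noteq> 0 \<or> z $ 4 \<noteq> 0"
  shows "dp_vector M1 M2 (Y z) (W z)"
proof -
  interpret F: dp_frame M1 M2 "Y z" "P 1 z" "P 2 z" by (rule frame [OF z])
  show ?thesis
  proof
    show "tangent M1 M2 (Y z) (W z)" unfolding W_def by (rule F.tangent_dual_vector)
    fix s t assume 0: "s *s Y z + t *s W z = 0"
    define \<rho> where "\<rho> = residue_form M1 M2 (Y z) (P 1 z) (P 2 z)"
    have \<rho>: "\<rho> \<noteq> 0" using F.residue_form_nz by (simp add: \<rho>_def)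
    have "s *s Y z + (t * (z $ 4 / \<rho>)) *s P 1 z + (t * (- z $ 3 / \<rho>)) *s P 2 z = 0"
      using 0 unfolding W_def F.dual_def \<rho>_def by (simp add: vec_eq_iff algebra_simps)
    from F.frame_indep [OF this] show "s = 0 \<and> t = 0" using nz \<rho> by auto
  qed
qed

lemma base_point_velocity:
  assumes "has_velocity \<gamma> u t"
  shows "has_velocity (\<lambda>t. base_point (\<gamma> t)) (base_point u) t"
  using assms unfolding has_velocity_def base_point_def forall_2 by simp

lemma base_point_nth [simp]: "base_point z $ 1 = z $ 1" "base_point z $ 2 = z $ 2"
  by (simp_all add: base_point_def)

lemma curve_base:
  assumes "curve \<gamma> r z u"
  shows "(\<lambda>t. base_point (\<gamma> t)) ` ball 0 r \<subseteq> U" "0 < r" "base_point (\<gamma> 0) = base_point z"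
    "\<And>t. t \<in> ball 0 r \<Longrightarrow> \<exists>v. has_velocity (\<lambda>t. base_point (\<gamma> t)) v t"
    "has_velocity (\<lambda>t. base_point (\<gamma> t)) (base_point u) 0" "base_point z \<in> U" "\<gamma> 0 = z"
proof -
  show "\<And>t. t \<in> ball 0 r \<Longrightarrow> \<exists>v. has_velocity (\<lambda>t. base_point (\<gamma> t)) v t"
    using assms base_point_velocity unfolding curve_def by blast
  show "base_point z \<in> U" using assms unfolding curve_def by (metis centre_in_ball)
qed (use assms base_point_velocity in \<open>auto simp: curve_def\<close>)

lemma Y_velocity:
  assumes "curve \<gamma> r z u"
  shows "has_velocity (\<lambda>t. Y (\<gamma> t)) (push z u) 0"
proof -
  note c = curve_base [OF assms]
  have "has_velocity (\<lambda>t. \<sigma> (base_point (\<gamma> t))) (frechet_derivative \<sigma> (at (base_point (\<gamma> 0))) (base_point u)) 0"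
    by (rule has_velocity_compose [OF holo _ c(5)]) (use c in simp)
  then show ?thesis
    unfolding c(3) frechet_derivative_partial [OF holo c(6)] by (simp add: Y_def push_def P_def)
qed

lemma second_order:
  assumes "base_point z \<in> U"
  obtains H :: "2 \<Rightarrow> 2 \<Rightarrow> complex^5" where "H 1 2 = H 2 1"
    "\<And>\<gamma> r u j. curve \<gamma> r z u \<Longrightarrow> has_velocity (\<lambda>t. P j (\<gamma> t)) (u $ 1 *s H 1 j + u $ 2 *s H 2 j) 0"
proof -
  obtain H :: "2 \<Rightarrow> 2 \<Rightarrow> complex^5" where sym: "\<And>i j. H i j = H j i" and
    H: "\<And>s r u j. 0 < r \<Longrightarrow> s ` ball 0 r \<subseteq> U \<Longrightarrow> s 0 = base_point z \<Longrightarrow> (\<And>t. t \<in> ball 0 r \<Longrightarrow> \<exists>v. has_velocity s v t) \<Longrightarrow>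
      has_velocity s u 0 \<Longrightarrow> has_velocity (\<lambda>t. partial_deriv j \<sigma> (s t)) (u $ 1 *s H 1 j + u $ 2 *s H 2 j) 0"
    by (rule second_partials [OF holo assms]) blast
  show ?thesis
  proof (rule that [OF sym])
    fix \<gamma> r u j assume "curve \<gamma> r z u"
    note c = curve_base [OF this]
    show "has_velocity (\<lambda>t. P j (\<gamma> t)) (u $ 1 *s H 1 j + u $ 2 *s H 2 j) 0"
      unfolding P_def using H [OF c(2,1,3,4,5), of j] by simp
  qed
qed

lemma det5_W:
  assumes z: "base_point z \<in> U"
  shows "det5 (Y z) (W z) (P 1 z) m n = z $ 3 * (4 * jac M1 M2 (Y z) m n)"
    "det5 (Y z) (W z) (P 2 z) m n = z $ 4 * (4 * jac M1 M2 (Y z) m n)"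
proof -
  interpret F: dp_frame M1 M2 "Y z" "P 1 z" "P 2 z" by (rule frame [OF z])
  show "det5 (Y z) (W z) (P 1 z) m n = z $ 3 * (4 * jac M1 M2 (Y z) m n)"
    "det5 (Y z) (W z) (P 2 z) m n = z $ 4 * (4 * jac M1 M2 (Y z) m n)"
    unfolding W_def F.residue_form [OF F.tangent_dual_vector F.p] F.residue_form [OF F.tangent_dual_vector F.q]
      F.residue_form_dual by simp_all
qed

text \<open>\<open>residue_form\<close> is a definite description, which hides its
  differentiability. Near the given point it equals, for constant \<open>m\<close> and
  \<open>n\<close>, the quotient of \<open>det5\<close> by \<open>4 * jac\<close>, which is
  differentiable and nonzero.\<close>

lemma W_velocity:
  assumes c: "curve \<gamma> r z u"
  obtains a' where "has_velocity (\<lambda>t. W (\<gamma> t)) a' 0"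
proof -
  note cb = curve_base [OF c]
  interpret F: dp_frame M1 M2 "Y z" "P 1 z" "P 2 z" by (rule frame [OF cb(6)])
  obtain H :: "2 \<Rightarrow> 2 \<Rightarrow> complex^5" where
    "\<And>\<gamma> r u j. curve \<gamma> r z u \<Longrightarrow> has_velocity (\<lambda>t. P j (\<gamma> t)) (u $ 1 *s H 1 j + u $ 2 *s H 2 j) 0"
    by (rule second_order [OF cb(6)]) blast
  then obtain p q where p: "has_velocity (\<lambda>t. P 1 (\<gamma> t)) p 0" and q: "has_velocity (\<lambda>t. P 2 (\<gamma> t)) q 0"
    using c by blast
  obtain m n where J: "jac M1 M2 (Y z) m n \<noteq> 0" by (rule F.jac_exists)
  define j d where "j = (\<lambda>t. jac M1 M2 (Y (\<gamma> t)) m n)" and "d = (\<lambda>t. det5 (Y (\<gamma> t)) (P 1 (\<gamma> t)) (P 2 (\<gamma> t)) m n)"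
  have j: "j field_differentiable at 0"
    unfolding j_def field_differentiable_def using has_derivative_jac [OF Y_velocity [OF c]] by blast
  have d: "d field_differentiable at 0"
    unfolding d_def field_differentiable_def using has_derivative_det5 [OF Y_velocity [OF c] p q] by blast
  have "isCont j 0" using j field_differentiable_imp_continuous_at by blast
  moreover have "j 0 \<noteq> 0" using J cb(7) by (simp add: j_def)
  ultimately have "\<forall>\<^sub>F t in nhds 0. j t \<noteq> 0"
    using tendsto_imp_eventually_ne [of j "j 0" "at 0" 0] unfolding isCont_def eventually_nhds_conv_at by simp
  then obtain \<delta> where \<delta>: "\<delta> > 0" "\<And>t. t \<in> ball 0 \<delta> \<Longrightarrow> j t \<noteq> 0"
    unfolding eventually_nhds_metric by (auto simp: dist_commute)
  define \<rho> where "\<rho> = (\<lambda>t. d t / (4 * j t))"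
  have \<rho>: "residue_form M1 M2 (Y (\<gamma> t)) (P 1 (\<gamma> t)) (P 2 (\<gamma> t)) = \<rho> t" if "t \<in> ball 0 r" "t \<in> ball 0 \<delta>" for t
  proof -
    interpret T: dp_frame M1 M2 "Y (\<gamma> t)" "P 1 (\<gamma> t)" "P 2 (\<gamma> t)"
      by (rule frame) (use cb(1) that in blast)
    show ?thesis
      by (rule T.residue_form_eqI [OF T.p T.q, of m n]) (use \<delta>(2) [OF that(2)] in \<open>simp_all add: \<rho>_def j_def d_def\<close>)
  qed
  have \<rho>0: "\<rho> 0 \<noteq> 0" using \<rho> [of 0] F.residue_form_nz cb(2,7) \<delta>(1) by simp
  have d\<rho>: "\<rho> field_differentiable at 0"
    unfolding \<rho>_def using \<open>j 0 \<noteq> 0\<close> j d by (intro derivative_intros) auto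
  have comp: "(\<lambda>t. c t $ i) field_differentiable at 0" if "has_velocity c v 0" for c and v :: "complex^'k" and i
    using that unfolding has_velocity_def field_differentiable_def by blast
  have u: "has_velocity \<gamma> u 0" using c by (simp add: curve_def)
  define V where "V = (\<lambda>t. (\<gamma> t $ 4 / \<rho> t) *s P 1 (\<gamma> t) + (- \<gamma> t $ 3 / \<rho> t) *s P 2 (\<gamma> t))"
  have "(\<lambda>t. V t $ i) field_differentiable at 0" for i
    unfolding V_def vector_add_component vector_smult_component
    by (intro derivative_intros comp [OF u] comp [OF p] comp [OF q] d\<rho> \<rho>0)
  then have V: "has_velocity V (\<chi> i. deriv (\<lambda>t. V t $ i) 0) 0"
    unfolding has_velocity_def by (simp add: DERIV_deriv_iff_field_differentiable)
  have "has_velocity (\<lambda>t. W (\<gamma> t)) (\<chi> i. deriv (\<lambda>t. V t $ i) 0) 0"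
  proof (rule has_velocity_transform [OF V])
    show "open (ball 0 r \<inter> ball (0::complex) \<delta>)" by auto
    show "0 \<in> ball 0 r \<inter> ball (0::complex) \<delta>" using cb(2) \<delta> by simp
    fix t :: complex assume t: "t \<in> ball 0 r \<inter> ball 0 \<delta>"
    interpret T: dp_frame M1 M2 "Y (\<gamma> t)" "P 1 (\<gamma> t)" "P 2 (\<gamma> t)"
      by (rule frame) (use cb(1) t in blast)
    show "V t = W (\<gamma> t)" unfolding V_def W_def T.dual_def using \<rho> t by simp
  qed
  then show ?thesis by (rule that)
qed

lemma inf_level_curve:
  assumes c: "curve \<gamma> r z u" and W: "has_velocity (\<lambda>t. W (\<gamma> t)) a' 0"
    and e: "\<And>t. t \<in> ball 0 r \<Longrightarrow> bil M1 (W (\<gamma> t)) (W (\<gamma> t)) = e1 \<and> bil M2 (W (\<gamma> t)) (W (\<gamma> t)) = e2"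
  shows "inf_level M1 M2 (Y z) (W z) (push z u) a'"
proof -
  note cb = curve_base [OF c]
  interpret F: dp_frame M1 M2 "Y z" "P 1 z" "P 2 z" by (rule frame [OF cb(6)])
  note Yv = Y_velocity [OF c]
  have T: "bil M1 (Y (\<gamma> t)) (W (\<gamma> t)) = 0" "bil M2 (Y (\<gamma> t)) (W (\<gamma> t)) = 0"
    "bil M1 (Y (\<gamma> t)) (Y (\<gamma> t)) = 0" "bil M2 (Y (\<gamma> t)) (Y (\<gamma> t)) = 0" if "t \<in> ball 0 r" for t
  proof -
    interpret T: dp_frame M1 M2 "Y (\<gamma> t)" "P 1 (\<gamma> t)" "P 2 (\<gamma> t)"
      by (rule frame) (use cb(1) that in blast)
    show "bil M1 (Y (\<gamma> t)) (W (\<gamma> t)) = 0" "bil M2 (Y (\<gamma> t)) (W (\<gamma> t)) = 0"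
    "bil M1 (Y (\<gamma> t)) (Y (\<gamma> t)) = 0" "bil M2 (Y (\<gamma> t)) (Y (\<gamma> t)) = 0"
      using T.tangent_dual_vector unfolding W_def tangent_def by simp_all
  qed
  have d: "bil M f' (g 0) + bil M (f 0) g' = 0"
    if "has_velocity f f' 0" "has_velocity g g' 0" "\<And>t. t \<in> ball 0 r \<Longrightarrow> bil M (f t) (g t) = c" for M f f' g g' c
    using deriv_of_constant [OF has_derivative_bil cb(2)] that by blast
  have "bil M1 (push z u) (Y z) + bil M1 (Y z) (push z u) = 0" "bil M2 (push z u) (Y z) + bil M2 (Y z) (push z u) = 0"
    "bil M1 (push z u) (W z) + bil M1 (Y z) a' = 0" "bil M2 (push z u) (W z) + bil M2 (Y z) a' = 0"
    "bil M1 a' (W z) + bil M1 (W z) a' = 0" "bil M2 a' (W z) + bil M2 (W z) a' = 0"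
    using d [OF Yv Yv T(3)] d [OF Yv Yv T(4)] d [OF Yv W T(1)] d [OF Yv W T(2)]
      d [OF W W, of M1 e1] d [OF W W, of M2 e2] e cb(7) by simp_all
  then show ?thesis
    unfolding F.sym [of "push z u" "Y z"] F.sym [of "push z u" "W z"] F.sym [of a' "W z"]
    by (simp add: inf_level_def add.commute)
qed

text \<open>\<open>z $ 3\<close> and \<open>z $ 4\<close> are the values of the tautological form on
  the coordinate frame, and \<open>det5_W\<close> expresses them by determinants. Differentiating
  along both curves and antisymmetrising gives the exterior derivative; the terms with
  \<open>H\<close> cancel because \<open>H 1 2 = H 2 1\<close>.\<close>

lemma symplectic_form_curv:
  assumes c: "curve \<gamma> r z u" "curve \<delta> r' z v"
    and W: "has_velocity (\<lambda>t. W (\<gamma> t)) a' 0" "has_velocity (\<lambda>t. W (\<delta> t)) b' 0"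
    and J: "jac M1 M2 (Y z) m n \<noteq> 0"
  shows "4 * jac M1 M2 (Y z) m n * symplectic_form u v =
    curv M1 M2 (Y z) (W z) m n (push z u) a' (push z v) b'"
proof -
  have U: "base_point z \<in> U" using curve_base [OF c(1)] by simp
  let ?J = "jac M1 M2 (Y z) m n" and ?y = "Y z" and ?w = "W z" and ?p = "P 1 z" and ?q = "P 2 z"
  obtain H :: "2 \<Rightarrow> 2 \<Rightarrow> complex^5" where sym: "H 1 2 = H 2 1" and
    H: "\<And>\<gamma> r u j. curve \<gamma> r z u \<Longrightarrow> has_velocity (\<lambda>t. P j (\<gamma> t)) (u $ 1 *s H 1 j + u $ 2 *s H 2 j) 0"
    by (rule second_order [OF U]) blast
  have key: "u $ 3 * (4 * ?J) + z $ 3 * (4 * jac_deriv M1 M2 ?y m n (push z u)) =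
      det5 (push z u) ?w ?p m n + det5 ?y a' ?p m n + det5 ?y ?w (u $ 1 *s H 1 1 + u $ 2 *s H 2 1) m n"
    "u $ 4 * (4 * ?J) + z $ 4 * (4 * jac_deriv M1 M2 ?y m n (push z u)) =
      det5 (push z u) ?w ?q m n + det5 ?y a' ?q m n + det5 ?y ?w (u $ 1 *s H 1 2 + u $ 2 *s H 2 2) m n"
    if c: "curve \<gamma> r z u" and W: "has_velocity (\<lambda>t. W (\<gamma> t)) a' 0" for \<gamma> r u a'
  proof -
    note cb = curve_base [OF c]
    have g: "((\<lambda>t. \<gamma> t $ i) has_field_derivative u $ i) (at 0)" for i
      using c by (simp add: curve_def has_velocity_def)
    have l: "((\<lambda>t. \<gamma> t $ i * (4 * jac M1 M2 (Y (\<gamma> t)) m n)) has_field_derivative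
        u $ i * (4 * ?J) + z $ i * (4 * jac_deriv M1 M2 ?y m n (push z u))) (at 0)" for i
      using DERIV_mult [OF g [of i] DERIV_cmult [OF has_derivative_jac [OF Y_velocity [OF c]], of 4]]
      unfolding cb(7) by (simp add: add.commute mult.commute)
    have u: "(f has_field_derivative D) (at 0) \<Longrightarrow> (h has_field_derivative E) (at 0) \<Longrightarrow>
      (\<And>t. t \<in> ball 0 r \<Longrightarrow> h t = f t) \<Longrightarrow> D = E" for f h D E
      using deriv_of_constant [OF DERIV_diff cb(2), of f D h E 0] by force
    have in_U: "base_point (\<gamma> t) \<in> U" if "t \<in> ball 0 r" for t using cb(1) that by blast
    show "u $ 3 * (4 * ?J) + z $ 3 * (4 * jac_deriv M1 M2 ?y m n (push z u)) =
      det5 (push z u) ?w ?p m n + det5 ?y a' ?p m n + det5 ?y ?w (u $ 1 *s H 1 1 + u $ 2 *s H 2 1) m n"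
      using u [OF l has_derivative_det5 [OF Y_velocity [OF c] W H [OF c]] det5_W(1) [OF in_U]]
      unfolding cb(7) .
    show "u $ 4 * (4 * ?J) + z $ 4 * (4 * jac_deriv M1 M2 ?y m n (push z u)) =
      det5 (push z u) ?w ?q m n + det5 ?y a' ?q m n + det5 ?y ?w (u $ 1 *s H 1 2 + u $ 2 *s H 2 2) m n"
      using u [OF l has_derivative_det5 [OF Y_velocity [OF c] W H [OF c]] det5_W(2) [OF in_U]]
      unfolding cb(7) .
  qed
  note ku = key [OF c(1) W(1)] and kv = key [OF c(2) W(2)]
  let ?Du = "jac_deriv M1 M2 ?y m n (push z u)" and ?Dv = "jac_deriv M1 M2 ?y m n (push z v)"
  \<comment> \<open>The values of the tautological form on \<open>u\<close> and
    \<open>v\<close>.\<close>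
  define lu lv where "lu = z $ 3 * u $ 1 + z $ 4 * u $ 2" and "lv = z $ 3 * v $ 1 + z $ 4 * v $ 2"
  have L: "det5 ?y ?w (push z u) m n = lu * (4 * ?J)" "det5 ?y ?w (push z v) m n = lv * (4 * ?J)"
    unfolding lu_def lv_def push_def det5_lin det5_W [OF U] by (simp_all add: algebra_simps)
  have push: "det5 x x' (push z v) m n = v $ 1 * det5 x x' ?p m n + v $ 2 * det5 x x' ?q m n"
    "det5 x x' (push z u) m n = u $ 1 * det5 x x' ?p m n + u $ 2 * det5 x x' ?q m n" for x x'
    by (simp_all add: push_def det5_lin)
  have s: "4 * ?J * symplectic_form u v =
     v $ 1 * (u $ 3 * (4 * ?J) + z $ 3 * (4 * ?Du)) + v $ 2 * (u $ 4 * (4 * ?J) + z $ 4 * (4 * ?Du))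
     - u $ 1 * (v $ 3 * (4 * ?J) + z $ 3 * (4 * ?Dv)) - u $ 2 * (v $ 4 * (4 * ?J) + z $ 4 * (4 * ?Dv))
     - 4 * (lv * ?Du - lu * ?Dv)"
    by (simp add: symplectic_form_def lu_def lv_def algebra_simps)
  also have "\<dots> = det5 (push z u) ?w (push z v) m n + det5 ?y a' (push z v) m n
      - det5 (push z v) ?w (push z u) m n - det5 ?y b' (push z u) m n - 4 * (lv * ?Du - lu * ?Dv)"
    unfolding ku kv push(1) [of "push z u" ?w] push(1) [of ?y a'] push(2) [of "push z v" ?w] push(2) [of ?y b']
    unfolding det5_lin sym by (simp add: algebra_simps)
  \<comment> \<open>A transposition merges the two determinants in which \<open>Y\<close> is
    differentiated; hence the factor 2 in \<open>curv\<close>.\<close>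
  finally have "4 * ?J * symplectic_form u v = 2 * det5 (push z u) ?w (push z v) m n + det5 ?y a' (push z v) m n
      - det5 ?y b' (push z u) m n - 4 * (lv * ?Du - lu * ?Dv)"
    using det5_swap(2) [of "push z v" ?w "push z u" m n] by simp
  moreover have "(lv * (4 * ?J) * ?Du - lu * (4 * ?J) * ?Dv) / ?J = 4 * (lv * ?Du - lu * ?Dv)"
    using J by (simp add: field_simps)
  ultimately show ?thesis unfolding curv_def L by (simp only:)
qed

end

lemma symplectic_form_tendsto:
  assumes "(f \<longlongrightarrow> u) F" "(g \<longlongrightarrow> v) F"
  shows "((\<lambda>n. symplectic_form (f n) (g n)) \<longlongrightarrow> symplectic_form u v) F"
  unfolding symplectic_form_def by (intro tendsto_intros assms)

section \<open>Fibres and their degenerate points\<close>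

context dp_chart
begin

definition fibre :: "complex \<times> complex \<Rightarrow> (complex^4) set"
  where "fibre e = {z. base_point z \<in> U \<and> cotangent_chart M1 M2 \<sigma> z \<in> level_surface M1 M2 e}"

text \<open>The complement of the points where \<open>dp_vector_W\<close> and
  \<open>curv_eq_0\<close> apply. Quantifying over \<open>t\<close> makes the second clause a
  condition on the class of \<open>W z\<close> modulo \<open>Y z\<close>.\<close>

definition degenerate :: "complex^4 \<Rightarrow> bool"
  where "degenerate z \<longleftrightarrow> z $ 3 = 0 \<and> z $ 4 = 0 \<or>
    (\<exists>\<alpha> \<beta> t. \<not> (\<alpha> = 0 \<and> \<beta> = 0) \<and> pencil M1 M2 \<alpha> \<beta> *v (W z + t *s Y z) = 0)"

lemma fibre_quad:
  assumes "z \<in> fibre e"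
  shows "base_point z \<in> U" "bil M1 (W z) (W z) = fst e" "bil M2 (W z) (W z) = snd e"
  using assms bil_W_level unfolding fibre_def by blast+

lemma fibre_curve:
  assumes u: "u \<in> tangent_space (fibre e) q" and N: "open N" "q \<in> N"
  obtains \<gamma> r where "curve \<gamma> r q u" "\<gamma> ` ball 0 r \<subseteq> fibre e \<inter> N"
proof -
  obtain \<gamma> r where r: "0 < r" "\<gamma> ` ball 0 r \<subseteq> fibre e" "\<gamma> 0 = q"
    and v: "\<And>t. t \<in> ball 0 r \<Longrightarrow> \<exists>v. has_velocity \<gamma> v t" and \<gamma>: "has_velocity \<gamma> u 0"
    using u unfolding tangent_space_iff by blast
  have "\<forall>\<^sub>F t in nhds 0. \<gamma> t \<in> N"
    using has_velocity_isCont [OF \<gamma>] topological_tendstoD [OF _ N(1), of \<gamma> q "at 0"] N(2) r(3)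
    unfolding isCont_def eventually_nhds_conv_at by auto
  then obtain \<delta> where \<delta>: "\<delta> > 0" "\<And>t. t \<in> ball 0 \<delta> \<Longrightarrow> \<gamma> t \<in> N"
    unfolding eventually_nhds_metric by (auto simp: dist_commute)
  show ?thesis
  proof (rule that)
    show im: "\<gamma> ` ball 0 (min r \<delta>) \<subseteq> fibre e \<inter> N" using r(2) \<delta>(2) by auto
    show "curve \<gamma> (min r \<delta>) q u"
      unfolding curve_def
    proof (intro conjI ballI)
      show "base_point (\<gamma> t) \<in> U" if "t \<in> ball 0 (min r \<delta>)" for t
        using fibre_quad(1) im that by blast
    qed (use r v \<gamma> \<delta> in auto)
  qed
qed

lemma isotropic_nondegenerate:
  assumes nd: "\<not> degenerate q"
    and uv: "u \<in> tangent_space (fibre e) q" "v \<in> tangent_space (fibre e) q"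
  shows "symplectic_form u v = 0"
proof -
  obtain \<gamma> r where \<gamma>: "curve \<gamma> r q u" "\<gamma> ` ball 0 r \<subseteq> fibre e \<inter> UNIV"
    by (rule fibre_curve [OF uv(1) open_UNIV UNIV_I])
  obtain \<delta> r' where \<delta>: "curve \<delta> r' q v" "\<delta> ` ball 0 r' \<subseteq> fibre e \<inter> UNIV"
    by (rule fibre_curve [OF uv(2) open_UNIV UNIV_I])
  obtain a' where a': "has_velocity (\<lambda>t. W (\<gamma> t)) a' 0" by (rule W_velocity [OF \<gamma>(1)])
  obtain b' where b': "has_velocity (\<lambda>t. W (\<delta> t)) b' 0" by (rule W_velocity [OF \<delta>(1)])
  have ia: "inf_level M1 M2 (Y q) (W q) (push q u) a'"
    by (rule inf_level_curve [OF \<gamma>(1) a', of "fst e" "snd e"]) (use \<gamma>(2) fibre_quad in blast)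
  have ib: "inf_level M1 M2 (Y q) (W q) (push q v) b'"
    by (rule inf_level_curve [OF \<delta>(1) b', of "fst e" "snd e"]) (use \<delta>(2) fibre_quad in blast)
  have q: "base_point q \<in> U" using curve_base(6) [OF \<gamma>(1)] .
  interpret V: dp_vector M1 M2 "Y q" "W q"
    by (rule dp_vector_W [OF q]) (use nd in \<open>auto simp: degenerate_def\<close>)
  have "\<alpha> = 0 \<and> \<beta> = 0" if "pencil M1 M2 \<alpha> \<beta> *v (W q + t *s Y q) = 0" for \<alpha> \<beta> t
    using nd that unfolding degenerate_def by blast
  then obtain m n where J: "jac M1 M2 (Y q) m n \<noteq> 0" and
    *: "\<forall>a a' b b'. inf_level M1 M2 (Y q) (W q) a a' \<longrightarrow> inf_level M1 M2 (Y q) (W q) b b' \<longrightarrow>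
      curv M1 M2 (Y q) (W q) m n a a' b b' = 0"
    using V.curv_eq_0 by (metis (no_types, lifting))
  have "4 * jac M1 M2 (Y q) m n * symplectic_form u v = 0"
    unfolding symplectic_form_curv [OF \<gamma>(1) \<delta>(1) a' b' J] using * ia ib by blast
  then show ?thesis using J by simp
qed

text \<open>A singular point \<open>w + t y\<close> of a pencil member gives a relation between the
  four gradients at \<open>y\<close> and \<open>w\<close> with proportional pairs of coefficients,
  which \<open>line_smooth\<close> excludes when both quadrics vanish at \<open>w\<close>.\<close>

lemma degenerate_zero_fibre:
  assumes z: "z \<in> fibre (0, 0)" and d: "degenerate z"
  shows "z $ 3 = 0 \<and> z $ 4 = 0"
proof (rule ccontr)
  assume nz: "\<not> (z $ 3 = 0 \<and> z $ 4 = 0)"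
  note f = fibre_quad [OF z]
  interpret V: dp_vector M1 M2 "Y z" "W z" by (rule dp_vector_W [OF f(1)]) (use nz in blast)
  obtain \<alpha> \<beta> t where ab: "\<not> (\<alpha> = 0 \<and> \<beta> = 0)" "pencil M1 M2 \<alpha> \<beta> *v (W z + t *s Y z) = 0"
    using d nz unfolding degenerate_def by blast
  have "(\<alpha> * t) *s (M1 *v Y z) + (\<beta> * t) *s (M2 *v Y z) + \<alpha> *s (M1 *v W z) + \<beta> *s (M2 *v W z) = 0"
    using ab(2) unfolding pencil_mult matrix_vector_right_distrib vector_scalar_commute
    by (simp add: vec_eq_iff algebra_simps)
  from V.line_smooth [OF _ _ this] ab(1) f(2,3) show False by simp
qed

text \<open>A quadric vanishes at its singular points, hence here also at \<open>w\<close>, and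
  \<open>e\<close> alone determines the member with this property up to a factor. So one and the
  same singular quadric occurs at all degenerate points of the fibre.\<close>

lemma degenerate_vertex:
  assumes z: "z \<in> fibre e" and e: "e \<noteq> (0, 0)" and d: "degenerate z"
  shows "dp_vector M1 M2 (Y z) (W z)" "\<exists>t. pencil M1 M2 (snd e) (- fst e) *v (W z + t *s Y z) = 0"
proof -
  note f = fibre_quad [OF z]
  interpret F: dp_frame M1 M2 "Y z" "P 1 z" "P 2 z" by (rule frame [OF f(1)])
  have nz: "z $ 3 \<noteq> 0 \<or> z $ 4 \<noteq> 0"
  proof (rule ccontr)
    assume "\<not> ?thesis"
    then have "W z = 0" by (simp add: W_def F.dual_def)
    then show False using f(2,3) e by (simp add: prod_eq_iff)
  qed
  show "dp_vector M1 M2 (Y z) (W z)" by (rule dp_vector_W [OF f(1) nz])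
  then interpret V: dp_vector M1 M2 "Y z" "W z" .
  obtain \<alpha> \<beta> t where ab: "\<not> (\<alpha> = 0 \<and> \<beta> = 0)" "pencil M1 M2 \<alpha> \<beta> *v (W z + t *s Y z) = 0"
    using d nz unfolding degenerate_def by blast
  have "bil (pencil M1 M2 \<alpha> \<beta>) (W z + t *s Y z) (W z + t *s Y z) = 0" by (simp add: bil_def ab(2))
  then have rel: "\<alpha> * fst e + \<beta> * snd e = 0" by (simp add: bil_pencil bil_lin f)
  obtain c where l: "snd e = c * \<alpha>" "- fst e = c * \<beta>"
  proof (cases "\<alpha> = 0")
    case True
    then show ?thesis using ab(1) rel by (intro that [of "- fst e / \<beta>"]) auto
  next
    case False
    then have "fst e = - \<beta> * snd e / \<alpha>" using rel by (simp add: field_simps add_eq_0_iff)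
    then show ?thesis using False by (intro that [of "snd e / \<alpha>"]) auto
  qed
  have "pencil M1 M2 (snd e) (- fst e) *v (W z + t *s Y z) = c *s (pencil M1 M2 \<alpha> \<beta> *v (W z + t *s Y z))"
    unfolding pencil_mult l by (simp add: vec_eq_iff algebra_simps)
  then show "\<exists>t. pencil M1 M2 (snd e) (- fst e) *v (W z + t *s Y z) = 0"
    unfolding ab(2) by auto
qed

lemma isotropic_degenerate:
  assumes N: "open N" "q \<in> N" and d: "\<And>z. z \<in> fibre e \<inter> N \<Longrightarrow> degenerate z"
    and uv: "u \<in> tangent_space (fibre e) q" "v \<in> tangent_space (fibre e) q"
  shows "symplectic_form u v = 0"
proof -
  obtain \<gamma> r where \<gamma>: "curve \<gamma> r q u" "\<gamma> ` ball 0 r \<subseteq> fibre e \<inter> N"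
    by (rule fibre_curve [OF uv(1) N])
  obtain \<delta> r' where \<delta>: "curve \<delta> r' q v" "\<delta> ` ball 0 r' \<subseteq> fibre e \<inter> N"
    by (rule fibre_curve [OF uv(2) N])
  show ?thesis
  proof (cases "e = (0, 0)")
    case True
    \<comment> \<open>The curve stays in the zero section, so the fibre coordinates of its velocity
      vanish.\<close>
    have "w $ 3 = 0 \<and> w $ 4 = 0" if c: "curve \<gamma> r q w" "\<gamma> ` ball 0 r \<subseteq> fibre e \<inter> N" for \<gamma> r w
    proof -
      have "\<gamma> t $ 3 = 0 \<and> \<gamma> t $ 4 = 0" if "t \<in> ball 0 r" for t
        using degenerate_zero_fibre [of "\<gamma> t"] d c(2) that unfolding True by blast
      moreover have w: "((\<lambda>t. \<gamma> t $ i) has_field_derivative w $ i) (at 0)" and r: "0 < r" for i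
        using c(1) by (auto simp: curve_def has_velocity_def)
      ultimately show ?thesis
        using deriv_of_constant [OF w [of 3] r] deriv_of_constant [OF w [of 4] r] by blast
    qed
    from this [OF \<gamma>] this [OF \<delta>] show ?thesis by (simp add: symplectic_form_def)
  next
    case e: False
    obtain a' where a': "has_velocity (\<lambda>t. W (\<gamma> t)) a' 0" by (rule W_velocity [OF \<gamma>(1)])
    obtain b' where b': "has_velocity (\<lambda>t. W (\<delta> t)) b' 0" by (rule W_velocity [OF \<delta>(1)])
    have qf: "q \<in> fibre e \<inter> N" using \<gamma> curve_base(2,7) [OF \<gamma>(1)] by force
    have q: "base_point q \<in> U" using fibre_quad(1) qf by blast
    interpret F: dp_frame M1 M2 "Y q" "P 1 q" "P 2 q" by (rule frame [OF q])
    interpret V: dp_vector M1 M2 "Y q" "W q" using degenerate_vertex(1) [OF _ e] qf d by blast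
    obtain t where t: "pencil M1 M2 (snd e) (- fst e) *v (W q + t *s Y q) = 0"
      using degenerate_vertex(2) [OF _ e] qf d by blast
    \<comment> \<open>\<open>K\<close> spans the pencil together with the singular member and takes
      the constant nonzero value \<open>k\<close> on \<open>W\<close> along the fibre.\<close>
    define K k where "K = (if fst e \<noteq> 0 then M1 else M2)" and "k = (if fst e \<noteq> 0 then fst e else snd e)"
    have K: "K = M1 \<and> - fst e \<noteq> 0 \<or> K = M2 \<and> snd e \<noteq> 0" and k: "k \<noteq> 0"
      using e by (auto simp: K_def k_def prod_eq_iff)
    have KW: "bil K (W z) (W z) = k" if "z \<in> fibre e" for z
      using fibre_quad(2,3) [OF that] by (simp add: K_def k_def)
    have vel: "\<exists>\<kappa>. a' + t *s push q w = \<kappa> *s Y q \<and> bil K (W q + t *s Y q) (push q w) = 0"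
      if c: "curve \<gamma> r q w" "\<gamma> ` ball 0 r \<subseteq> fibre e \<inter> N" and a': "has_velocity (\<lambda>t. W (\<gamma> t)) a' 0" for \<gamma> r w a'
    proof -
      note cb = curve_base [OF c(1)]
      have in_f: "\<gamma> s \<in> fibre e" "degenerate (\<gamma> s)" if "s \<in> ball 0 r" for s
        using c(2) d that by blast+
      have "bil K (W q) (W q) \<noteq> 0" using KW qf k by simp
      show ?thesis
        by (rule V.vertex_velocity [OF K refl t \<open>bil K (W q) (W q) \<noteq> 0\<close> Y_velocity [OF c(1)] _ a' _ cb(2)])
          (use in_f cb(7) degenerate_vertex [OF _ e] KW qf in auto)
    qed
    obtain \<kappa> where \<kappa>: "a' + t *s push q u = \<kappa> *s Y q" "bil K (W q + t *s Y q) (push q u) = 0"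
      using vel [OF \<gamma> a'] by blast
    obtain \<kappa>' where \<kappa>': "b' + t *s push q v = \<kappa>' *s Y q" "bil K (W q + t *s Y q) (push q v) = 0"
      using vel [OF \<delta> b'] by blast
    obtain m n where J: "jac M1 M2 (Y q) m n \<noteq> 0" by (rule F.jac_exists)
    have T: "tangent M1 M2 (Y q) (W q + t *s Y q)" "tangent M1 M2 (Y q) (push q w)" for w
      unfolding push_def using F.tangent_lin V.w F.tangent_y F.p F.q by blast+
    have "bil K (W q + t *s Y q) (W q + t *s Y q) = k"
      using KW qf K by (auto simp: bil_lin)
    then have "curv M1 M2 (Y q) (W q) m n (push q u) a' (push q v) b' = 0"
      using F.curv_vertex_any [OF _ T(1) _ T(2) T(2) \<kappa>(2) \<kappa>'(2) J \<kappa>(1) \<kappa>'(1)] K k by auto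
    then show ?thesis using symplectic_form_curv [OF \<gamma>(1) \<delta>(1) a' b' J] J by simp
  qed
qed

lemma isotropic:
  assumes sm: "smooth_point (fibre e) q"
    and uv: "u \<in> tangent_space (fibre e) q" "v \<in> tangent_space (fibre e) q"
  shows "symplectic_form u v = 0"
\<comment> \<open>Degeneracy of \<open>q\<close> itself does not decide the case: what counts is
  whether nondegenerate fibre points occur arbitrarily close to \<open>q\<close>.\<close>
proof (cases "\<exists>N. open N \<and> q \<in> N \<and> (\<forall>z\<in>fibre e \<inter> N. degenerate z)")
  case True
  then show ?thesis using isotropic_degenerate uv by blast
next
  case False
  have "\<exists>z. z \<in> fibre e \<and> dist q z < 1 / Suc n \<and> \<not> degenerate z" for n
  proof -
    have "q \<in> ball q (1 / Suc n)" by simp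
    then have "\<exists>z\<in>fibre e \<inter> ball q (1 / Suc n). \<not> degenerate z"
      using False open_ball by blast
    then show ?thesis by auto
  qed
  then have "\<exists>Q. \<forall>n. Q n \<in> fibre e \<and> dist q (Q n) < 1 / Suc n \<and> \<not> degenerate (Q n)"
    by (intro choice allI)
  then obtain Q where Q: "\<And>n. Q n \<in> fibre e" "\<And>n. dist q (Q n) < 1 / Suc n" "\<And>n. \<not> degenerate (Q n)"
    by blast
  have lim: "Q \<longlonglongrightarrow> q"
  proof (rule metric_tendsto_imp_tendsto [where f = "\<lambda>n. 1 / real (Suc n)" and a = 0])
    show "(\<lambda>n. 1 / real (Suc n)) \<longlonglongrightarrow> 0" by (rule LIMSEQ_Suc [OF lim_1_over_n])
    show "\<forall>\<^sub>F n in sequentially. dist (Q n) q \<le> dist (1 / real (Suc n)) 0"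
      using Q(2) by (intro always_eventually allI) (simp add: dist_commute less_imp_le)
  qed
  obtain Us where Us: "\<forall>\<^sub>F n in sequentially. Us n \<in> tangent_space (fibre e) (Q n)" "Us \<longlonglongrightarrow> u"
    by (rule tangent_space_limit [OF sm uv(1) Q(1) lim])
  obtain Vs where Vs: "\<forall>\<^sub>F n in sequentially. Vs n \<in> tangent_space (fibre e) (Q n)" "Vs \<longlonglongrightarrow> v"
    by (rule tangent_space_limit [OF sm uv(2) Q(1) lim])
  have "\<forall>\<^sub>F n in sequentially. symplectic_form (Us n) (Vs n) = 0"
    using Us(1) Vs(1) by eventually_elim (rule isotropic_nondegenerate [OF Q(3)])
  then have "(\<lambda>n. symplectic_form (Us n) (Vs n)) \<longlonglongrightarrow> 0" by (rule tendsto_eventually)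
  then show ?thesis
    using symplectic_form_tendsto [OF Us(2) Vs(2)] LIMSEQ_unique by blast
qed

end

theorem theorem1p1:
  fixes M1 M2 :: "complex^5^5"
  assumes "del_pezzo_4 M1 M2"
  shows "\<forall>e :: complex \<times> complex.
    symplectic_form_vanishes_on M1 M2 (level_surface M1 M2 e)"
  unfolding symplectic_form_vanishes_on_def Let_def
proof (intro allI impI ballI)
  fix e :: "complex \<times> complex" and U \<sigma> q u v
  assume "local_parametrisation M1 M2 U \<sigma>"
  then interpret dp_chart M1 M2 U \<sigma> using assms by unfold_locales
  assume "smooth_point {z. base_point z \<in> U \<and> cotangent_chart M1 M2 \<sigma> z \<in> level_surface M1 M2 e} q"
    "u \<in> tangent_space {z. base_point z \<in> U \<and> cotangent_chart M1 M2 \<sigma> z \<in> level_surface M1 M2 e} q"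
    "v \<in> tangent_space {z. base_point z \<in> U \<and> cotangent_chart M1 M2 \<sigma> z \<in> level_surface M1 M2 e} q"
  then show "symplectic_form u v = 0" unfolding fibre_def [symmetric] by (rule isotropic)
qed

end
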